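(* For every $\alpha\in\mathbb{R}\setminus\mathbb{Q}$ one of the following statements holds: (i) $\alpha$ is a Herman number and $\mathbb{A}_\alpha$ is a Jordan curve; (ii) $\alpha$ is a Brjuno but not a Herman number, and $\mathbb{A}_\alpha$ is a one-sided hairy Jordan curve; (iii) $\alpha$ is not a Brjuno number, and $\mathbb{A}_\alpha$ is a Cantor bouquet.
   Context: Continued fraction (nearest integer). Let $d(x,\mathbb{Z})=\min_{k\in\mathbb{Z}}|x-k|$. For irrational $\alpha$ set $\alpha_0=d(\alpha,\mathbb{Z})$, $\alpha_{n+1}=d(1/\alpha_n,\mathbb{Z})$ for $n\ge0$ (so $\alpha_n\in(0,1/2)$), and let $a_n\in\mathbb{Z}$ ($n\ge-1$), $\varepsilon_n\in\{+1,-1\}$ ($n\ge0$) be the unique numbers with $\alpha=a_{-1}+\varepsilon_0\alpha_0$, $1/\alpha_n=a_n+\varepsilon_{n+1}\alpha_{n+1}$. Changes of coordinates. Let $s(w)=\overline{w}$ and $\mathbb{H}'=\{w\in\mathbb{C}:\operatorname{Im}w>-1\}$. For $r\in(0,1/2]$ and $w\in\overline{\mathbb{H}'}$ let $$Y_r(w)=r\operatorname{Re}w+\frac{i}{2\pi}\log\left|\frac{e^{-3\pi r}-e^{-\pi ri}e^{-2\pi riw}}{e^{-3\pi r}-e^{\pi ri}}\right|.$$ Let $\mathbb{Y}_n=Y_{\alpha_n}$ if $\varepsilon_n=-1$ and $\mathbb{Y}_n=-s\circ Y_{\alpha_n}$ if $\varepsilon_n=+1$. The sets. For $n\ge0$ let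 $I_n^0=\{w\in\overline{\mathbb{H}'}:\operatorname{Re}w\in[0,1/\alpha_n]\}$. For all $n,j\ge0$ let $J_n^j=\{w\in I_n^j:\operatorname{Re}w\in[1/\alpha_n-1,1/\alpha_n]\}$, $K_n^j=\{w\in I_n^j:\operatorname{Re}w\in[0,1/\alpha_n-1]\}$, and inductively $I_n^{j+1}=\bigcup_{l=0}^{a_n-2}(\mathbb{Y}_{n+1}(I_{n+1}^j)+l)\cup(\mathbb{Y}_{n+1}(K_{n+1}^j)+a_n-1)$ if $\varepsilon_{n+1}=-1$, $I_n^{j+1}=\bigcup_{l=1}^{a_n}(\mathbb{Y}_{n+1}(I_{n+1}^j)+l)\cup(\mathbb{Y}_{n+1}(J_{n+1}^j)+a_n+1)$ if $\varepsilon_{n+1}=+1$. Let $I_{-1}^j=\mathbb{Y}_0(I_0^{j-1})+(\varepsilon_0+1)/2$ for $j\ge1$ and $I_{-1}=\bigcap_{j\ge1}I_{-1}^j$. Define $\mathbb{M}_\alpha=\{s(e^{2\pi iw}):w\in I_{-1}\}\cup\{0\}$ and $\mathbb{A}_\alpha=\partial\mathbb{M}_\alpha$ (topological boundary in $\mathbb{C}$). Brjuno and Herman numbers. Let $\langle x\rangle$ be the fractional part of $x$; for irrational $\alpha$ let $\tilde\alpha_0=\langle\alpha\rangle$, $\tilde\alpha_{n+1}=\langle1/\tilde\alpha_n\rangle$, $\tilde\beta_{-1}=1$, $\tilde\beta_n=\prod_{i=0}^n\tilde\alpha_i$, and $\tilde{\mathcal{B}}(\alpha)=\sum_{n=-1}^{\infty}\tilde\beta_n\log(1/\tilde\alpha_{n+1})\in(0,+\infty]$.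 The number $\alpha$ is a Brjuno number if $\tilde{\mathcal{B}}(\alpha)<+\infty$. For $r\in(0,1)$ let $h_r:\mathbb{R}\to(0,+\infty)$, $h_r(y)=r^{-1}(y-\log r^{-1}+1)$ if $y\ge\log r^{-1}$ and $h_r(y)=e^y$ if $y\le\log r^{-1}$. The number $\alpha$ is a Herman number if for all $n\ge0$ there is $m\ge n$ with $h_{\tilde\alpha_{m-1}}\circ\cdots\circ h_{\tilde\alpha_n}(0)\ge\tilde{\mathcal{B}}(\tilde\alpha_m)$ (the composition is the identity if $m=n$ and $h_{\tilde\alpha_n}$ if $m=n+1$). Topological objects. Consider functions $R:\mathbb{R}/\mathbb{Z}\to[0,1]$ such that (a) $R=0$ on a dense subset of $\mathbb{R}/\mathbb{Z}$ and $R>0$ on a dense subset of $\mathbb{R}/\mathbb{Z}$; (b) for each $\theta_0$, $\limsup_{\theta\to\theta_0^+}R(\theta)=R(\theta_0)=\limsup_{\theta\to\theta_0^-}R(\theta)$. A Cantor bouquet is a subset of the plane ambiently homeomorphic (i.e. mapped by a homeomorphism of the plane) to a set $\{re^{2\pi i\theta}:0\le\theta\le1,\ 0\le r\le R(\theta)\}$ for such an $R$. A one-sided hairy Jordan curve is a subset of the plane ambiently homeomorphic to a set $\{re^{2\pi i\theta}:0\le\theta\le1,\ 1\le r\le1+R(\theta)\}$ for such an $R$. *)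

theory Defs
  imports "HOL-Analysis.Analysis"
begin

lemma infdist_Ints_eq_round: "infdist (x::real) \<int> = \<bar>x - of_int (round x)\<bar>"
proof (rule antisym)
  show "infdist x \<int> \<le> \<bar>x - of_int (round x)\<bar>"
    by (metis Ints_of_int dist_real_def infdist_le)
  have "\<bar>x - of_int (round x)\<bar> \<le> dist x k" if "k \<in> \<int>" for k
    using that by (auto elim!: Ints_cases simp: dist_real_def round_diff_minimal)
  then show "\<bar>x - of_int (round x)\<bar> \<le> infdist x \<int>"
    by (auto simp: infdist_def intro!: cINF_greatest)
qed

definition nearest_decomp :: "real \<Rightarrow> int \<times> int" where
  "nearest_decomp x = (THE (a, \<epsilon>). \<epsilon> \<in> {1, -1} \<and> x = of_int a + of_int \<epsilon> * infdist x \<int>)"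

lemma nearest_decomp_ex1:
  assumes "x \<notin> \<rat>"
  shows "\<exists>!(a, \<epsilon>). \<epsilon> \<in> {1, -1} \<and> x = of_int a + of_int \<epsilon> * infdist x \<int>"
proof -
  define d where "d = infdist x \<int>"
  have irr: "x \<noteq> of_int n / 2" for n :: int
    using assms by (metis Rats_divide Rats_number_of Rats_of_int)
  have "\<exists>a \<epsilon>::int. \<epsilon> \<in> {1, -1} \<and> x = of_int a + of_int \<epsilon> * d"
  proof (cases "x \<ge> of_int (round x)")
    case True
    then show ?thesis
      by (intro exI[of _ "round x"] exI[of _ 1]) (simp add: d_def infdist_Ints_eq_round)
  next
    case False
    then show ?thesis
      by (intro exI[of _ "round x"] exI[of _ "-1"]) (simp add: d_def infdist_Ints_eq_round)
  qed
  moreover have "a = b \<and> \<epsilon> = \<delta>"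
    if "\<epsilon> \<in> {1, -1}" "x = of_int a + of_int \<epsilon> * d"
       "\<delta> \<in> {1, -1}" "x = of_int b + of_int \<delta> * d" for a b \<epsilon> \<delta> :: int
  proof -
    have "\<epsilon> = \<delta>"
    proof (rule ccontr)
      assume "\<epsilon> \<noteq> \<delta>"
      with that have "2 * x = of_int (a + b)" by auto
      with irr[of "a + b"] show False by (simp add: field_simps)
    qed
    with that show ?thesis by simp
  qed
  ultimately show ?thesis unfolding d_def by (auto simp del: insert_iff)
qed

text \<open>
  \<open>cf_arg \<alpha> n\<close> is the number expanded at stage \<open>n\<close>: \<open>\<alpha>\<close> for \<open>n = 0\<close> and \<open>1 / \<alpha>\<^sub>n\<^sub>-\<^sub>1\<close> for \<open>n > 0\<close>,
  so that \<open>cf_arg \<alpha> n = a\<^sub>n\<^sub>-\<^sub>1 + \<epsilon>\<^sub>n \<alpha>\<^sub>n\<close>.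
\<close>
primrec cf_arg :: "real \<Rightarrow> nat \<Rightarrow> real" where
  "cf_arg \<alpha> 0 = \<alpha>"
| "cf_arg \<alpha> (Suc n) = 1 / infdist (cf_arg \<alpha> n) \<int>"

definition cf_alpha :: "real \<Rightarrow> nat \<Rightarrow> real" where
  "cf_alpha \<alpha> n = infdist (cf_arg \<alpha> n) \<int>"

definition cf_eps :: "real \<Rightarrow> nat \<Rightarrow> int" where
  "cf_eps \<alpha> n = snd (nearest_decomp (cf_arg \<alpha> n))"

definition cf_a :: "real \<Rightarrow> nat \<Rightarrow> int" where
  "cf_a \<alpha> n = fst (nearest_decomp (cf_arg \<alpha> (Suc n)))"

definition Hprime :: "complex set" where
  "Hprime = {w. Im w > -1}"

text \<open>The intended domain of \<open>Ymap r\<close> is \<open>closure Hprime\<close>, where the logarithm has positive argument.\<close>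
definition Ymap :: "real \<Rightarrow> complex \<Rightarrow> complex" where
  "Ymap r w = of_real (r * Re w) + \<i> / (2 * of_real pi) *
     of_real (ln (cmod ((exp (- 3 * of_real pi * of_real r)
                          - exp (- of_real pi * of_real r * \<i>) * exp (- 2 * of_real pi * of_real r * \<i> * w))
                        / (exp (- 3 * of_real pi * of_real r) - exp (of_real pi * of_real r * \<i>)))))"

definition Yn :: "real \<Rightarrow> nat \<Rightarrow> complex \<Rightarrow> complex" where
  "Yn \<alpha> n w = (if cf_eps \<alpha> n = -1 then Ymap (cf_alpha \<alpha> n) w else - cnj (Ymap (cf_alpha \<alpha> n) w))"

definition Jpart :: "real \<Rightarrow> nat \<Rightarrow> complex set \<Rightarrow> complex set" where
  "Jpart \<alpha> n S = {w \<in> S. Re w \<in> {1 / cf_alpha \<alpha> n - 1 .. 1 / cf_alpha \<alpha> n}}"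

definition Kpart :: "real \<Rightarrow> nat \<Rightarrow> complex set \<Rightarrow> complex set" where
  "Kpart \<alpha> n S = {w \<in> S. Re w \<in> {0 .. 1 / cf_alpha \<alpha> n - 1}}"

abbreviation translate :: "complex \<Rightarrow> complex set \<Rightarrow> complex set" where
  "translate c S \<equiv> (\<lambda>z. z + c) ` S"

text \<open>\<open>I_set \<alpha> j n\<close> is \<open>I\<^sub>n\<^sup>j\<close>; \<open>J\<^sub>n\<^sup>j\<close> and \<open>K\<^sub>n\<^sup>j\<close> are its images under \<open>Jpart \<alpha> n\<close> and \<open>Kpart \<alpha> n\<close>.\<close>
primrec I_set :: "real \<Rightarrow> nat \<Rightarrow> nat \<Rightarrow> complex set" where
  "I_set \<alpha> 0 = (\<lambda>n. {w \<in> closure Hprime. Re w \<in> {0 .. 1 / cf_alpha \<alpha> n}})"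
| "I_set \<alpha> (Suc j) = (\<lambda>n.
     if cf_eps \<alpha> (Suc n) = -1 then
       (\<Union>l\<in>{0 .. cf_a \<alpha> n - 2}. translate (of_int l) (Yn \<alpha> (Suc n) ` I_set \<alpha> j (Suc n)))
       \<union> translate (of_int (cf_a \<alpha> n - 1)) (Yn \<alpha> (Suc n) ` Kpart \<alpha> (Suc n) (I_set \<alpha> j (Suc n)))
     else
       (\<Union>l\<in>{1 .. cf_a \<alpha> n}. translate (of_int l) (Yn \<alpha> (Suc n) ` I_set \<alpha> j (Suc n)))
       \<union> translate (of_int (cf_a \<alpha> n + 1)) (Yn \<alpha> (Suc n) ` Jpart \<alpha> (Suc n) (I_set \<alpha> j (Suc n))))"

text \<open>\<open>I\<^sub>-\<^sub>1\<^sup>j\<close>, meant for \<open>j \<ge> 1\<close>.\<close>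
definition I_minus_set :: "real \<Rightarrow> nat \<Rightarrow> complex set" where
  "I_minus_set \<alpha> j = translate ((of_int (cf_eps \<alpha> 0) + 1) / 2) (Yn \<alpha> 0 ` I_set \<alpha> (j - 1) 0)"

definition I_minus :: "real \<Rightarrow> complex set" where
  "I_minus \<alpha> = (\<Inter>j\<in>{1..}. I_minus_set \<alpha> j)"

definition M_set :: "real \<Rightarrow> complex set" where
  "M_set \<alpha> = {cnj (exp (2 * of_real pi * \<i> * w)) | w. w \<in> I_minus \<alpha>} \<union> {0}"

definition A_set :: "real \<Rightarrow> complex set" where
  "A_set \<alpha> = frontier (M_set \<alpha>)"

primrec gauss_alpha :: "real \<Rightarrow> nat \<Rightarrow> real" where
  "gauss_alpha \<alpha> 0 = frac \<alpha>"
| "gauss_alpha \<alpha> (Suc n) = frac (1 / gauss_alpha \<alpha> n)"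

text \<open>The summation index is shifted by one: term \<open>n\<close> is \<open>\<beta>\<^sub>n\<^sub>-\<^sub>1 log (1 / \<alpha>\<^sub>n)\<close> for the
  Gauss continued fraction. All terms are positive for irrational \<open>\<alpha>\<close>.\<close>
definition brjuno_sum :: "real \<Rightarrow> ereal" where
  "brjuno_sum \<alpha> = (\<Sum>n. ereal ((\<Prod>i<n. gauss_alpha \<alpha> i) * ln (1 / gauss_alpha \<alpha> n)))"

definition brjuno_number :: "real \<Rightarrow> bool" where
  "brjuno_number \<alpha> \<longleftrightarrow> \<alpha> \<notin> \<rat> \<and> brjuno_sum \<alpha> < \<infinity>"

definition herman_h :: "real \<Rightarrow> real \<Rightarrow> real" where
  "herman_h r y = (if y \<ge> ln (1 / r) then (1 / r) * (y - ln (1 / r) + 1) else exp y)"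

text \<open>The \<open>fold\<close> is \<open>h\<^bsub>\<alpha>(m-1)\<^esub> \<circ> \<dots> \<circ> h\<^bsub>\<alpha>(n)\<^esub>\<close>, the innermost map being the one of index \<open>n\<close>.\<close>
definition herman_number :: "real \<Rightarrow> bool" where
  "herman_number \<alpha> \<longleftrightarrow> \<alpha> \<notin> \<rat> \<and>
     (\<forall>n. \<exists>m\<ge>n. ereal (fold (\<lambda>i. herman_h (gauss_alpha \<alpha> i)) [n..<m] 0)
                  \<ge> brjuno_sum (gauss_alpha \<alpha> m))"

text \<open>Functions on \<open>\<real>/\<int>\<close> are represented by 1-periodic functions on \<open>\<real>\<close>. The one-sided
  upper limits are over punctured one-sided neighbourhoods.\<close>
definition hair_function :: "(real \<Rightarrow> real) \<Rightarrow> bool" where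
  "hair_function R \<longleftrightarrow>
     (\<forall>\<theta>. R (\<theta> + 1) = R \<theta>) \<and>
     (\<forall>\<theta>. R \<theta> \<in> {0..1}) \<and>
     closure {\<theta>. R \<theta> = 0} = UNIV \<and>
     closure {\<theta>. R \<theta> > 0} = UNIV \<and>
     (\<forall>\<theta>\<^sub>0. Limsup (at_right \<theta>\<^sub>0) (\<lambda>\<theta>. ereal (R \<theta>)) = ereal (R \<theta>\<^sub>0) \<and>
          Limsup (at_left \<theta>\<^sub>0) (\<lambda>\<theta>. ereal (R \<theta>)) = ereal (R \<theta>\<^sub>0))"

definition ambiently_homeomorphic :: "complex set \<Rightarrow> complex set \<Rightarrow> bool" where
  "ambiently_homeomorphic S T \<longleftrightarrow> (\<exists>f g. homeomorphism UNIV UNIV f g \<and> f ` S = T)"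

definition cantor_bouquet :: "complex set \<Rightarrow> bool" where
  "cantor_bouquet S \<longleftrightarrow> (\<exists>R. hair_function R \<and>
     ambiently_homeomorphic S
       {of_real r * exp (2 * of_real pi * \<i> * of_real \<theta>) | r \<theta>.
          0 \<le> \<theta> \<and> \<theta> \<le> 1 \<and> 0 \<le> r \<and> r \<le> R \<theta>})"

definition one_sided_hairy_jordan_curve :: "complex set \<Rightarrow> bool" where
  "one_sided_hairy_jordan_curve S \<longleftrightarrow> (\<exists>R. hair_function R \<and>
     ambiently_homeomorphic S
       {of_real r * exp (2 * of_real pi * \<i> * of_real \<theta>) | r \<theta>.
          0 \<le> \<theta> \<and> \<theta> \<le> 1 \<and> 1 \<le> r \<and> r \<le> 1 + R \<theta>})"

definition jordan_curve :: "complex set \<Rightarrow> bool" where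
  "jordan_curve S \<longleftrightarrow> (\<exists>\<gamma>. simple_path \<gamma> \<and> pathfinish \<gamma> = pathstart \<gamma> \<and> path_image \<gamma> = S)"

end

theory Submission
  imports Defs
begin

text \<open>
  The map \<open>Y\<^sub>r\<close> sends vertical lines to vertical lines, so every \<open>I\<^sub>n\<^sup>j\<close> is the set above the graph of
  a function, and these functions are obtained from the constant \<open>-1\<close> by repeatedly applying a pull-back
  operator that contracts heights by \<open>5/6\<close>. Hence $\mathbb{M}_\alpha$ is the star-shaped set
  $|z| \le Q(\arg z)$ with \<open>Q = exp (- 2 \<pi> b)\<close>, where \<open>b\<close> is the supremum of the functions of level \<open>-1\<close>.

  The return maps of the rotation by \<open>\<alpha>\<close> change \<open>b\<close> by a uniformly bounded amount, and the
  \<open>k\<close>-th one by at most \<open>2 (5/6)\<^sup>k\<close>. This gives the one-sided limits required of a hair function, and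
  the density of each of \<open>{b = \<infinity>}\<close> and \<open>{b < \<infinity>}\<close> once it is nonempty. Along an orbit that stays in the middle
  of the fundamental intervals the heights add up to the Brjuno sum, so \<open>b\<close> takes the value
  \<open>\<infinity>\<close> exactly if \<open>\<alpha>\<close> is not a Brjuno number.

  For a Brjuno number, pulling back constants comparable to the tails of the Brjuno sum gives a decreasing
  sequence with limit \<open>p \<ge> b\<close>. Up to bounded errors the height map at a point is the maximum of the height map
  at the origin and of a quantity independent of the height; therefore \<open>p\<close> is continuous,
  and \<open>p = b\<close> if and only if the values of \<open>p\<close> at the origin are bounded over all levels. The height map at the origin
  is, up to a bounded error, the inverse of the function \<open>h\<^sub>r\<close>, so this is the Herman condition. Finally
  \<open>{p = b}\<close> and its complement are invariant under the rotation, so they are dense or empty, and $\mathbb{A}_\alpha$ is the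
  closed region between the graphs of \<open>exp (- 2 \<pi> p)\<close> and \<open>exp (- 2 \<pi> b)\<close>.
\<close>

section \<open>The height of the change of coordinates\<close>

text \<open>Two identifications compete at every level: functions of level \<open>n\<close> are
  1-periodic, but live on an interval whose length is not an integer. Whatever is pulled back must
  agree at both ends of that interval, and a small translation may cross the seam; this shapes
  \<open>admissible\<close> and \<open>wrap_bound\<close>. The factor 5/6 is \<open>r + 1/3\<close>
  at \<open>r = 1/2\<close>: the bottom height -1 keeps the height derivative below
  \<open>r + 1/3\<close>, and nearest-integer remainders are below 1/2. The horizontal derivative is
  at most 1/6, so 1/6 + 5/6 = 1 makes the bound 1 on a translation reproduce itself; the uniform
  constants 1/2, 13/2 and 138 are fixed points of similar recursions. Uniform contraction alone does
  not identify \<open>p\<close> with \<open>b\<close>, since the initial gap at level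
  \<open>n\<close> comes from a Brjuno sum and may outgrow the contraction. The function
  \<open>p\<close> is introduced because \<open>b\<close>, a supremum of continuous functions, is
  only known to be lower semicontinuous and does not itself show where the inner boundary curve
  lies.\<close>

lemma sinh_ge_self:
  fixes x :: real assumes "0 \<le> x" shows "x \<le> sinh x"
proof -
  have "sinh 0 - 0 \<le> sinh x - x"
    by (rule DERIV_nonneg_imp_nondecreasing[OF assms])
      (auto intro!: derivative_eq_intros exI simp: cosh_real_ge_1)
  then show ?thesis by simp
qed

text \<open>Half-angle formulas split the quantity under the logarithm into a part depending on the
  height only and a part depending on the horizontal coordinate only; \<open>hgt_le_max\<close>
  rests on this splitting.\<close>

lemma cosh_minus_cos:
  fixes u v :: real
  shows "cosh u - cos v = 2 * ((sinh (u/2))\<^sup>2 + (sin (v/2))\<^sup>2)"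
proof -
  have "cosh u = cosh (2 * (u/2))" "cos v = cos (2 * (v/2))" by simp_all
  then show ?thesis
    unfolding cosh_double cos_double_sin using cosh_square_eq[of "u/2"] by (simp add: algebra_simps)
qed

lemma cosh_ge_quadratic:
  fixes u :: real shows "1 + u\<^sup>2 / 2 \<le> cosh u"
proof -
  have *: "1 + w\<^sup>2 / 2 \<le> cosh w" if "0 \<le> w" for w :: real
  proof -
    have "w/2 \<le> sinh (w/2)" using that by (intro sinh_ge_self) auto
    then have "(w/2)\<^sup>2 \<le> (sinh (w/2))\<^sup>2" using that by (intro power_mono) auto
    then show ?thesis using cosh_minus_cos[of w 0] by (simp add: power_divide)
  qed
  show ?thesis
  proof (cases "0 \<le> u")
    case True then show ?thesis by (rule *)
  next
    case False then show ?thesis using *[of "-u"] by simp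
  qed
qed

lemma cosh_gt_cos:
  fixes u :: real assumes "0 < u" shows "cos v < cosh u"
proof -
  have "cos v \<le> 1" by simp
  also have "1 < 1 + u\<^sup>2 / 2" using assms by simp
  also have "\<dots> \<le> cosh u" by (rule cosh_ge_quadratic)
  finally show ?thesis .
qed

text \<open>Cauchy-Schwarz: \<open>u * \<bar>sin v\<bar> + cos v\<close> is the inner product of (u,
  1) with a unit vector, hence at most sqrt (u^2 + 1), which is at most \<open>cosh u\<close>. It
  controls the horizontal derivative of the height.\<close>

lemma abs_sin_le_cosh_minus_cos:
  fixes u :: real assumes "0 < u" shows "u * \<bar>sin v\<bar> \<le> cosh u - cos v"
proof -
  have "\<bar>sin v\<bar>\<^sup>2 + (cos v)\<^sup>2 = 1" by simp
  then have "(u * \<bar>sin v\<bar> + cos v)\<^sup>2 + (u * cos v - \<bar>sin v\<bar>)\<^sup>2 = u\<^sup>2 + 1" by algebra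
  then have "(u * \<bar>sin v\<bar> + cos v)\<^sup>2 \<le> u\<^sup>2 + 1"
    using zero_le_power2[of "u * cos v - \<bar>sin v\<bar>"] by linarith
  also have "\<dots> \<le> (1 + u\<^sup>2 / 2)\<^sup>2"
    using zero_le_power2[of "u\<^sup>2"] by (simp add: power2_sum power_divide del: zero_le_power2)
  finally have "u * \<bar>sin v\<bar> + cos v \<le> 1 + u\<^sup>2 / 2"
    by (rule power2_le_imp_le) (use assms in auto)
  with cosh_ge_quadratic[of u] show ?thesis by linarith
qed

text \<open>The worst case is \<open>cos v = 1\<close>, where the quotient is coth (u/2); the factor
  is the elementary bound coth w \<le> 1 + 1/w at w = u/2.\<close>

lemma sinh_le_cosh_minus_cos:
  fixes u :: real assumes "0 < u" shows "sinh u \<le> (1 + 2 / u) * (cosh u - cos v)"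
proof -
  define w where "w = u / 2"
  have w: "0 < w" "u = 2 * w" using assms by (auto simp: w_def)
  have s: "w \<le> sinh w" using w by (intro sinh_ge_self) auto
  have "w * exp (- w) \<le> w * 1" using w by (intro mult_left_mono) auto
  with s have "w * (cosh w - sinh w) \<le> sinh w" by (simp add: cosh_minus_sinh)
  then have c: "cosh w \<le> (1 + 1 / w) * sinh w" using w by (simp add: field_simps)
  have "sinh u = 2 * sinh w * cosh w" unfolding w(2) by (simp add: sinh_double)
  also have "\<dots> \<le> 2 * sinh w * ((1 + 1 / w) * sinh w)"
    using c s w by (intro mult_left_mono) auto
  also have "\<dots> = (1 + 2 / u) * (2 * (sinh w)\<^sup>2)" using w by (simp add: power2_eq_square)
  also have "\<dots> \<le> (1 + 2 / u) * (cosh u - cos v)"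
    unfolding cosh_minus_cos w_def using assms by (intro mult_left_mono) auto
  finally show ?thesis .
qed

text \<open>\<open>hgt r x t\<close> is the imaginary part of \<open>Y\<^sub>r (x + i t)\<close>, rewritten with
  $|c - \varrho e^{i\varphi}|^2 = 2 c \varrho (\cosh \log (\varrho / c) - \cos \varphi)$.\<close>
definition hgt :: "real \<Rightarrow> real \<Rightarrow> real \<Rightarrow> real" where
  "hgt r x t = r * t / 2 + ln ((cosh (pi * r * (3 + 2 * t)) - cos (pi * r * (1 + 2 * x)))
      / (cosh (3 * pi * r) - cos (pi * r))) / (4 * pi)"

lemma hgt_arg_pos:
  assumes "0 < r" "-1 \<le> t"
  shows "0 < cosh (pi * r * (3 + 2 * t)) - cos v" "0 < cosh (3 * pi * r) - cos (pi * r)"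
  using cosh_gt_cos[of "pi * r * (3 + 2 * t)"] cosh_gt_cos[of "3 * pi * r"] assms by auto

lemma hgt_alt:
  assumes "0 < r" "-1 \<le> t"
  shows "hgt r x t = r * t / 2 + (ln (cosh (pi * r * (3 + 2 * t)) - cos (pi * r * (1 + 2 * x)))
      - ln (cosh (3 * pi * r) - cos (pi * r))) / (4 * pi)"
proof -
  have "cosh (pi * r * (3 + 2 * t)) - cos (pi * r * (1 + 2 * x)) \<noteq> 0"
    "cosh (3 * pi * r) - cos (pi * r) \<noteq> 0"
    using hgt_arg_pos[OF assms] by (metis less_irrefl)+
  then show ?thesis unfolding hgt_def by (simp only: ln_div) simp
qed

lemma has_derivative_add_ln:
  fixes f g :: "real \<Rightarrow> real"
  assumes g: "(g has_real_derivative g') (at t)" and f: "(f has_real_derivative f') (at t)"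
    and pos: "0 < g t" "0 < D"
  shows "((\<lambda>t. f t + ln (g t / D) / (4 * pi)) has_real_derivative f' + g' / (4 * pi * g t)) (at t)"
  using pos by (auto intro!: derivative_eq_intros g f simp: field_simps)

section \<open>Derivatives and Lipschitz constants of the height\<close>

lemma hgt_deriv_height:
  assumes "0 < r" "-1 \<le> t"
  shows "((\<lambda>t. hgt r x t) has_real_derivative
     (r / 2 * (1 + sinh (pi * r * (3 + 2 * t)) / (cosh (pi * r * (3 + 2 * t)) - cos (pi * r * (1 + 2 * x)))))) (at t)"
proof -
  let ?N = "\<lambda>t. cosh (pi * r * (3 + 2 * t)) - cos (pi * r * (1 + 2 * x))"
  have "(?N has_real_derivative (2 * pi * r * sinh (pi * r * (3 + 2 * t)))) (at t)"
    by (auto intro!: derivative_eq_intros simp: algebra_simps)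
  moreover have "((\<lambda>t. r * t / 2) has_real_derivative r / 2) (at t)"
    by (auto intro!: derivative_eq_intros)
  ultimately have "((\<lambda>t. hgt r x t) has_real_derivative
      r / 2 + 2 * pi * r * sinh (pi * r * (3 + 2 * t)) / (4 * pi * ?N t)) (at t)"
    unfolding hgt_def using hgt_arg_pos[OF assms] by (intro has_derivative_add_ln)
  then show ?thesis
    by (rule DERIV_cong) (use hgt_arg_pos(1)[OF assms, of "pi * r * (1 + 2 * x)"] in
      \<open>simp add: divide_simps; simp add: algebra_simps\<close>)
qed

lemma hgt_deriv_horizontal:
  assumes "0 < r" "-1 \<le> t"
  shows "((\<lambda>x. hgt r x t) has_real_derivative
     (r / 2 * (sin (pi * r * (1 + 2 * x)) / (cosh (pi * r * (3 + 2 * t)) - cos (pi * r * (1 + 2 * x)))))) (at x)"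
proof -
  let ?N = "\<lambda>x. cosh (pi * r * (3 + 2 * t)) - cos (pi * r * (1 + 2 * x))"
  have "(?N has_real_derivative (2 * pi * r * sin (pi * r * (1 + 2 * x)))) (at x)"
    by (auto intro!: derivative_eq_intros simp: algebra_simps)
  moreover have "((\<lambda>x. r * t / 2) has_real_derivative 0) (at x)"
    by (auto intro!: derivative_eq_intros)
  ultimately have "((\<lambda>x. hgt r x t) has_real_derivative
      0 + 2 * pi * r * sin (pi * r * (1 + 2 * x)) / (4 * pi * ?N x)) (at x)"
    unfolding hgt_def using hgt_arg_pos[OF assms] by (intro has_derivative_add_ln)
  then show ?thesis
    by (rule DERIV_cong) (use hgt_arg_pos(1)[OF assms, of "pi * r * (1 + 2 * x)"] in \<open>simp add: divide_simps\<close>)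
qed

lemma hgt_strict_mono:
  assumes "0 < r" "-1 \<le> s" "s < t"
  shows "hgt r x s < hgt r x t"
proof (rule DERIV_pos_imp_increasing[OF assms(3)])
  fix u assume "s \<le> u" "u \<le> t"
  then have u: "-1 \<le> u" using assms by auto
  have "0 < sinh (pi * r * (3 + 2 * u))" using u assms by simp
  then have "0 < r / 2 * (1 + sinh (pi * r * (3 + 2 * u)) / (cosh (pi * r * (3 + 2 * u)) - cos (pi * r * (1 + 2 * x))))"
    using hgt_arg_pos[OF assms(1) u] assms(1) by (intro mult_pos_pos add_pos_pos divide_pos_pos) auto
  then show "\<exists>y. ((\<lambda>t. hgt r x t) has_real_derivative y) (at u) \<and> 0 < y"
    using hgt_deriv_height[OF assms(1) u] by blast
qed

lemma hgt_mono:
  assumes "0 < r" "-1 \<le> s" "s \<le> t" shows "hgt r x s \<le> hgt r x t"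
  using hgt_strict_mono[of r s t x] assms by (cases "s = t") auto

lemma hgt_height_bound:
  assumes "0 < r" "-1 \<le> s" "s \<le> t"
    and d: "\<And>u. s \<le> u \<Longrightarrow> u \<le> t \<Longrightarrow>
      1 + sinh (pi * r * (3 + 2 * u)) / (cosh (pi * r * (3 + 2 * u)) - cos (pi * r * (1 + 2 * x))) \<le> 2 * B / r"
  shows "hgt r x t - hgt r x s \<le> B * (t - s)"
proof -
  have "B * s - hgt r x s \<le> B * t - hgt r x t"
  proof (rule DERIV_nonneg_imp_nondecreasing[OF assms(3)])
    fix u assume u: "s \<le> u" "u \<le> t"
    then have u': "-1 \<le> u" using assms by auto
    let ?d = "r / 2 * (1 + sinh (pi * r * (3 + 2 * u)) / (cosh (pi * r * (3 + 2 * u)) - cos (pi * r * (1 + 2 * x))))"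
    have "?d \<le> r / 2 * (2 * B / r)" using d[OF u] assms(1) by (intro mult_left_mono) auto
    then have "0 \<le> B - ?d" using assms(1) by simp
    moreover have "((\<lambda>u. B * u - hgt r x u) has_real_derivative (B - ?d)) (at u)"
      using hgt_deriv_height[OF assms(1) u'] by (auto intro!: derivative_eq_intros)
    ultimately show "\<exists>y. ((\<lambda>u. B * u - hgt r x u) has_real_derivative y) (at u) \<and> 0 \<le> y" by blast
  qed
  then show ?thesis by (simp add: algebra_simps)
qed

text \<open>At heights at least -1 the argument of cosh is at least \<open>3 * r\<close>, so the
  quotient in the derivative is at most \<open>1 + 2 / (3 * r)\<close> and the derivative at most
  \<open>r + 1/3\<close>.\<close>

lemma hgt_contraction:
  assumes "0 < r" "r \<le> 1/2" "-1 \<le> s" "s \<le> t"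
  shows "hgt r x t - hgt r x s \<le> 5/6 * (t - s)"
proof (rule hgt_height_bound[OF assms(1,3,4)])
  fix u assume "s \<le> u" "u \<le> t"
  then have u: "-1 \<le> u" using assms by auto
  let ?U = "pi * r * (3 + 2 * u)"
  have "3 * r \<le> pi * r" using pi_gt3 assms by simp
  also have "\<dots> \<le> ?U" using assms u by simp
  finally have U: "3 * r \<le> ?U" .
  have "0 < ?U" using U assms by linarith
  with U have "2 / ?U \<le> 2 / (3 * r)" using assms by (intro divide_left_mono mult_pos_pos[of ?U "3 * r"]) auto
  then have "sinh ?U / (cosh ?U - cos (pi * r * (1 + 2 * x))) \<le> 1 + 2 / ?U"
    using sinh_le_cosh_minus_cos[OF \<open>0 < ?U\<close>, of "pi * r * (1 + 2 * x)"]
      hgt_arg_pos(1)[OF assms(1) u, of "pi * r * (1 + 2 * x)"]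
    by (simp only: pos_divide_le_eq)
  also have "\<dots> \<le> 1 + 2 / (3 * r)" using \<open>2 / ?U \<le> 2 / (3 * r)\<close> by simp
  finally show "1 + sinh ?U / (cosh ?U - cos (pi * r * (1 + 2 * x))) \<le> 2 * (5/6) / r"
    using assms by (simp add: field_simps)
qed

text \<open>Where the cosine is nonpositive, sinh is at most the denominator and the factor improves
  from 5/6 to \<open>r\<close>. Along an orbit confined to such places the factors multiply to the
  weights of the Brjuno sum.\<close>

lemma hgt_contraction_centre:
  assumes "0 < r" "-1 \<le> s" "s \<le> t" and c: "cos (pi * r * (1 + 2 * x)) \<le> 0"
  shows "hgt r x t - hgt r x s \<le> r * (t - s)"
proof (rule hgt_height_bound[OF assms(1-3)])
  fix u assume "s \<le> u" "u \<le> t"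
  then have u: "-1 \<le> u" using assms by auto
  let ?U = "pi * r * (3 + 2 * u)"
  have "sinh ?U \<le> cosh ?U - cos (pi * r * (1 + 2 * x))"
    using sinh_le_cosh_real[of ?U] c by linarith
  then have "sinh ?U / (cosh ?U - cos (pi * r * (1 + 2 * x))) \<le> 1"
    using hgt_arg_pos[OF assms(1) u] by (simp add: pos_divide_le_eq)
  then show "1 + sinh ?U / (cosh ?U - cos (pi * r * (1 + 2 * x))) \<le> 2 * r / r"
    using assms by simp
qed

lemma hgt_lipschitz_height:
  assumes "0 < r" "r \<le> 1/2" "-1 \<le> s" "-1 \<le> t"
  shows "\<bar>hgt r x t - hgt r x s\<bar> \<le> 5/6 * \<bar>t - s\<bar>"
proof (cases "s \<le> t")
  case True
  then show ?thesis using hgt_contraction[of r s t x] hgt_mono[of r s t x] assms by simp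
next
  case False
  then show ?thesis using hgt_contraction[of r t s x] hgt_mono[of r t s x] assms by simp
qed

text \<open>\<open>3 * r * \<bar>sin v\<bar>\<close> is at most the denominator by
  \<open>abs_sin_le_cosh_minus_cos\<close>, and the derivative carries the further factor
  1/2.\<close>

lemma hgt_lipschitz_horizontal:
  assumes "0 < r" "-1 \<le> t"
  shows "\<bar>hgt r x t - hgt r y t\<bar> \<le> \<bar>x - y\<bar> / 6"
proof -
  have "norm (hgt r x t - hgt r y t) \<le> 1/6 * norm (x - y)"
  proof (rule field_differentiable_bound[where S = UNIV and
        f' = "\<lambda>z. r / 2 * (sin (pi * r * (1 + 2 * z)) / (cosh (pi * r * (3 + 2 * t)) - cos (pi * r * (1 + 2 * z))))"])
    fix z :: real
    let ?U = "pi * r * (3 + 2 * t)" and ?v = "pi * r * (1 + 2 * z)"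
    show "((\<lambda>x. hgt r x t) has_real_derivative (r / 2 * (sin ?v / (cosh ?U - cos ?v)))) (at z within UNIV)"
      by (rule hgt_deriv_horizontal[OF assms])
    have "3 * r \<le> pi * r" using pi_gt3 assms by simp
    also have "\<dots> \<le> ?U" using assms by simp
    finally have U: "3 * r \<le> ?U" .
    have "3 * r * \<bar>sin ?v\<bar> \<le> ?U * \<bar>sin ?v\<bar>" using U by (intro mult_right_mono) auto
    also have "\<dots> \<le> cosh ?U - cos ?v" using U assms by (intro abs_sin_le_cosh_minus_cos) auto
    finally have "r * \<bar>sin ?v\<bar> / (cosh ?U - cos ?v) \<le> 1 / 3"
      using hgt_arg_pos[OF assms] by (simp add: pos_divide_le_eq)
    then show "norm (r / 2 * (sin ?v / (cosh ?U - cos ?v))) \<le> 1/6"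
      using hgt_arg_pos(1)[OF assms, of ?v] assms by (simp add: abs_mult)
  qed auto
  then show ?thesis by simp
qed

lemma hgt_lipschitz:
  assumes "0 < r" "r \<le> 1/2" "-1 \<le> s" "-1 \<le> t"
  shows "\<bar>hgt r x s - hgt r y t\<bar> \<le> \<bar>x - y\<bar> / 6 + 5/6 * \<bar>s - t\<bar>"
  using hgt_lipschitz_height[OF assms(1,2,4,3), of x] hgt_lipschitz_horizontal[OF assms(1,4), of x y]
  by linarith

section \<open>Symmetries and reference values of the height\<close>

lemma hgt_periodic: assumes "r \<noteq> 0" shows "hgt r (x + 1 / r) t = hgt r x t"
proof -
  have "pi * r * (1 + 2 * (x + 1 / r)) = pi * r * (1 + 2 * x) + 2 * pi"
    using assms by (simp add: field_simps)
  then show ?thesis unfolding hgt_def by (simp add: cos_add)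
qed

text \<open>The height depends on \<open>x\<close> through
  \<open>cos (pi * r * (1 + 2 * x))\<close>, which is symmetric about \<open>x = -1/2\<close>; there
  the cosine is 1 and the height smallest.\<close>

lemma hgt_reflect: "hgt r (- 1 - x) t = hgt r x t"
proof -
  have "pi * r * (1 + 2 * (- 1 - x)) = - (pi * r * (1 + 2 * x))" by (simp add: algebra_simps)
  then show ?thesis unfolding hgt_def by (simp only: cos_minus)
qed

lemma hgt_0_0: "hgt r 0 0 = 0"
proof -
  have "pi * r * (3 + 2 * 0) = 3 * pi * r" "pi * r * (1 + 2 * 0) = pi * r" by simp_all
  then show ?thesis unfolding hgt_def by (simp only:) (simp add: divide_self_if)
qed

lemma hgt_ge_min:
  assumes "0 < r" "-1 \<le> t" shows "hgt r (-1/2) t \<le> hgt r x t"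
  using hgt_arg_pos[OF assms] hgt_arg_pos(1)[OF assms, of 0] by (simp add: hgt_alt[OF assms] divide_right_mono)

text \<open>The origin is at distance 1/2 from the lowest abscissa -1/2, and 1/2 * 1/6 =
  1/12.\<close>

lemma hgt_ge_origin:
  assumes "0 < r" "-1 \<le> t" shows "hgt r 0 t - 1/12 \<le> hgt r x t"
proof -
  have "\<bar>hgt r 0 t - hgt r (-1/2) t\<bar> \<le> 1/12"
    using hgt_lipschitz_horizontal[OF assms, of 0 "-1/2"] by simp
  with hgt_ge_min[OF assms, of x] show ?thesis by linarith
qed

text \<open>From the value 0 at the origin, going down to height -1 loses at most 5/6 and leaving
  the origin at most 1/12, together 11/12.\<close>

lemma hgt_gt_minus_one:
  assumes "0 < r" "r \<le> 1/2" "-1 \<le> t" shows "-1 < hgt r x t"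
  using hgt_mono[of r "-1" t x] hgt_ge_origin[of r "-1" x] hgt_contraction[of r "-1" 0 0] hgt_0_0[of r] assms
  by simp

text \<open>The logarithm of \<open>A + B\<close> is that of the larger summand up to ln 2. If the
  height part \<open>A\<close> dominates, the value at the origin is comparable. If the horizontal
  part \<open>B\<close> dominates, then \<open>sinh (U/2) < 1\<close>, so \<open>r * (t + 1)\<close>
  is small and replacing the height by -1 costs little.\<close>

lemma hgt_le_max:
  assumes "0 < r" "r \<le> 1/2" "-1 \<le> t"
  shows "hgt r x t \<le> max (hgt r 0 t) (hgt r x (-1)) + 1"
proof -
  let ?U = "pi * r * (3 + 2 * t)" and ?v = "pi * r * (1 + 2 * x)"
  define A where "A = (sinh (?U/2))\<^sup>2"
  define B where "B = (sin (?v/2))\<^sup>2"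
  define L where "L = ln (cosh (3 * pi * r) - cos (pi * r))"
  have U: "0 < ?U" using assms by (intro mult_pos_pos) auto
  have A: "0 < A" using U unfolding A_def by (intro zero_less_power) simp
  have B: "0 \<le> B" unfolding B_def by simp
  have e: "hgt r x t = r * t / 2 + (ln (2 * (A + B)) - L) / (4 * pi)"
    unfolding hgt_alt[OF assms(1,3)] cosh_minus_cos[of ?U] A_def B_def L_def by simp
  have pi3: "ln 4 / (4 * pi) \<le> 1/4" 
  proof -
    have "ln 4 \<le> (3::real)" using ln_le_minus_one[of "4::real"] by simp
    also have "\<dots> \<le> pi" using pi_gt3 by simp
    finally show ?thesis by (simp add: field_simps)
  qed
  show ?thesis
  proof (cases "B \<le> A")
    case True
    have "ln (2 * (A + B)) \<le> ln (4 * A)" using A B True by simp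
    also have "\<dots> = ln 4 + ln A" using A by (simp add: ln_mult)
    also have "ln A \<le> ln (cosh ?U - cos (pi * r * (1 + 2 * 0)))"
    proof -
      have "A \<le> cosh ?U - cos (pi * r * (1 + 2 * 0))"
        unfolding cosh_minus_cos A_def by simp
      then show ?thesis using A by simp
    qed
    finally have "hgt r x t \<le> r * t / 2 + (ln 4 + ln (cosh ?U - cos (pi * r * (1 + 2 * 0))) - L) / (4 * pi)"
      unfolding e by (intro add_left_mono divide_right_mono) auto
    also have "\<dots> = hgt r 0 t + ln 4 / (4 * pi)"
      unfolding hgt_alt[OF assms(1,3)] L_def by (simp add: field_simps)
    finally show ?thesis using pi3 by linarith
  next
    case False
    then have "A < B" by simp
    have Bpos: "0 < B" using False A by simp
    have "ln (2 * (A + B)) \<le> ln (4 * B)" using A B False by simp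
    also have "\<dots> = ln 4 + ln B" using Bpos by (simp add: ln_mult)
    also have "ln B \<le> ln (cosh (pi * r * (3 + 2 * (-1))) - cos ?v)"
    proof -
      have "B \<le> cosh (pi * r * (3 + 2 * (-1))) - cos ?v"
        unfolding cosh_minus_cos B_def by simp
      then show ?thesis using Bpos by simp
    qed
    finally have "hgt r x t \<le> r * t / 2 + (ln 4 + ln (cosh (pi * r * (3 + 2 * (-1))) - cos ?v) - L) / (4 * pi)"
      unfolding e by (intro add_left_mono divide_right_mono) auto
    also have "\<dots> = hgt r x (-1) + r * (t + 1) / 2 + ln 4 / (4 * pi)"
      using assms by (simp add: hgt_alt L_def field_simps)
    finally have 1: "hgt r x t \<le> hgt r x (-1) + r * (t + 1) / 2 + ln 4 / (4 * pi)" .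
    have "sinh (?U/2) < 1"
    proof (rule power2_less_imp_less)
      show "(sinh (?U/2))\<^sup>2 < 1\<^sup>2"
        using \<open>A < B\<close> abs_square_le_1[of "sin (?v/2)"] unfolding A_def B_def by auto
    qed simp
    with sinh_ge_self[of "?U/2"] U have "?U < 2" by linarith
    moreover have "3 * (r * (t + 1)) \<le> pi * (r * (t + 1))"
      using pi_gt3 assms by (intro mult_right_mono) auto
    moreover have "pi * (r * (t + 1)) * 2 \<le> ?U" using assms by (simp add: algebra_simps)
    ultimately have "r * (t + 1) / 2 \<le> 1/2" by linarith
    with 1 pi3 show ?thesis by linarith
  qed
qed

text \<open>Intercept of an affine upper bound of slope \<open>r\<close>. The exact asymptotic
  intercept is smaller by \<open>2 * ln 2 / (4 * pi)\<close>, the loss that appears in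
  \<open>hgt_lower_centre\<close>.\<close>

definition hgt_rise :: "real \<Rightarrow> real" where
  "hgt_rise r = 3 * r / 4 + (ln 2 - ln (cosh (3 * pi * r) - cos (pi * r))) / (4 * pi)"

lemma hgt_upper:
  assumes "0 < r" "-1 \<le> t"
  shows "hgt r x t \<le> r * t + hgt_rise r"
proof -
  let ?U = "pi * r * (3 + 2 * t)" and ?v = "pi * r * (1 + 2 * x)"
  have U: "0 < ?U" using assms by (intro mult_pos_pos) auto
  have "1 \<le> exp ?U" by (rule one_le_exp_iff[THEN iffD2, OF less_imp_le[OF U]])
  moreover have "cosh ?U \<le> exp ?U"
    using U cosh_plus_sinh[of ?U] sinh_real_nonneg_iff[of ?U] by linarith
  ultimately
  have "cosh ?U - cos ?v \<le> 2 * exp ?U" using cos_ge_minus_one[of ?v] by linarith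
  then have "ln (cosh ?U - cos ?v) \<le> ln (2 * exp ?U)" using hgt_arg_pos(1)[OF assms, of ?v] by simp
  also have "\<dots> = ln 2 + ?U" by (simp add: ln_mult)
  finally have "hgt r x t \<le> r * t / 2 + (ln 2 + ?U - ln (cosh (3 * pi * r) - cos (pi * r))) / (4 * pi)"
    unfolding hgt_alt[OF assms] by (intro add_left_mono divide_right_mono) auto
  also have "\<dots> = r * t + hgt_rise r" unfolding hgt_rise_def by (simp add: field_simps)
  finally show ?thesis .
qed

lemma hgt_lower_centre:
  assumes "0 < r" "-1 \<le> t" and c: "cos (pi * r * (1 + 2 * x)) \<le> 0"
  shows "r * t + hgt_rise r - 1/4 \<le> hgt r x t"
proof -
  let ?U = "pi * r * (3 + 2 * t)" and ?v = "pi * r * (1 + 2 * x)"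
  have "exp ?U / 2 \<le> cosh ?U" by (simp add: cosh_field_def)
  then have "exp ?U / 2 \<le> cosh ?U - cos ?v" using c by linarith
  then have "ln (exp ?U / 2) \<le> ln (cosh ?U - cos ?v)" by (intro ln_mono) auto
  then have "?U - ln 2 \<le> ln (cosh ?U - cos ?v)" by (simp add: ln_div)
  then have "r * t / 2 + (?U - ln 2 - ln (cosh (3 * pi * r) - cos (pi * r))) / (4 * pi) \<le> hgt r x t"
    unfolding hgt_alt[OF assms(1,2)] by (intro add_left_mono divide_right_mono) auto
  moreover have "r * t / 2 + (?U - ln 2 - ln (cosh (3 * pi * r) - cos (pi * r))) / (4 * pi)
      = r * t + hgt_rise r - 2 * ln 2 / (4 * pi)"
    unfolding hgt_rise_def by (simp add: field_simps)
  moreover have "2 * ln 2 / (4 * pi) \<le> 1/4"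
  proof -
    have "2 * ln 2 \<le> (2::real)" using ln_le_minus_one[of "2::real"] by simp
    also have "\<dots> \<le> pi" using pi_gt3 by simp
    finally show ?thesis by (simp add: field_simps)
  qed
  ultimately show ?thesis by linarith
qed

text \<open>The denominator is of order \<open>r\<^sup>2\<close>, so minus its logarithm over
  \<open>4 * pi\<close> is \<open>ln (1 / r) / (2 * pi)\<close> up to a bounded error. This is where
  the logarithms of the Brjuno sum come from.\<close>

lemma cosh_minus_cos_asymp:
  assumes "0 < r" "r \<le> 1/2"
  shows "r\<^sup>2 \<le> cosh (3 * pi * r) - cos (pi * r)"
    "cosh (3 * pi * r) - cos (pi * r) \<le> exp 16 * r\<^sup>2"
proof -
  have "cosh (3 * pi * r) \<ge> 1 + (3 * pi * r)\<^sup>2 / 2" by (rule cosh_ge_quadratic)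
  note quadratic = this
  have "(9::real) \<le> pi\<^sup>2" using power_mono[of 3 pi 2] pi_gt3 by simp
  then have "9 * r\<^sup>2 \<le> pi\<^sup>2 * r\<^sup>2" by (intro mult_right_mono) auto
  moreover have "(3 * pi * r)\<^sup>2 / 2 = 9 / 2 * (pi\<^sup>2 * r\<^sup>2)" by (simp add: power_mult_distrib)
  ultimately have "r\<^sup>2 \<le> (3 * pi * r)\<^sup>2 / 2" using zero_le_power2[of r] by linarith
  moreover have "cos (pi * r) \<le> 1" by simp
  ultimately show "r\<^sup>2 \<le> cosh (3 * pi * r) - cos (pi * r)" using quadratic by linarith
next
  let ?w = "3 * pi * r / 2"
  have "pi * r \<le> 4 * r" using assms pi_less_4 by (intro mult_right_mono) auto
  moreover have "pi * r \<le> 4 * (1/2)" using assms pi_less_4 by (intro mult_mono) auto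
  ultimately have w: "0 \<le> ?w" "?w \<le> 6 * r" "?w \<le> 3" using assms by auto
  have sinh_le: "sinh v \<le> exp 3 * v" if "0 \<le> v" "v \<le> 3" for v :: real
  proof -
    have "exp 3 * 0 - sinh 0 \<le> exp 3 * v - sinh v"
    proof (rule DERIV_nonneg_imp_nondecreasing[OF that(1)])
      fix u assume u: "0 \<le> u" "u \<le> v"
      have "cosh u \<le> exp u" using u cosh_plus_sinh[of u] sinh_real_nonneg_iff[of u] by linarith
      also have "\<dots> \<le> exp 3" using u that by simp
      finally have "0 \<le> exp 3 - cosh u" by simp
      moreover have "((\<lambda>v. exp 3 * v - sinh v) has_real_derivative (exp 3 - cosh u)) (at u)"
        by (auto intro!: derivative_eq_intros)
      ultimately show "\<exists>y. ((\<lambda>v. exp 3 * v - sinh v) has_real_derivative y) (at u) \<and> 0 \<le> y" by blast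
    qed
    then show ?thesis by simp
  qed
  have "sinh ?w \<le> exp 3 * ?w" using w by (intro sinh_le)
  also have "\<dots> \<le> exp 3 * (6 * r)" using w by (intro mult_left_mono) auto
  finally have 1: "(sinh ?w)\<^sup>2 \<le> (exp 3 * (6 * r))\<^sup>2" using w by (intro power_mono) auto
  have "\<bar>sin (pi * r / 2)\<bar> \<le> \<bar>pi * r / 2\<bar>" by (rule abs_sin_x_le_abs_x)
  also have "\<dots> \<le> 2 * r" using assms pi_less_4 by simp
  finally have "\<bar>sin (pi * r / 2)\<bar>\<^sup>2 \<le> (2 * r)\<^sup>2" by (intro power_mono) auto
  with 1 have "cosh (3 * pi * r) - cos (pi * r) \<le> 2 * ((exp 3 * (6 * r))\<^sup>2 + (2 * r)\<^sup>2)"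
    unfolding cosh_minus_cos[of "3 * pi * r"] by simp
  also have "\<dots> = (72 * (exp 3)\<^sup>2 + 8) * r\<^sup>2" by (simp add: power_mult_distrib algebra_simps)
  also have "\<dots> \<le> exp 16 * r\<^sup>2"
  proof (rule mult_right_mono)
    have "72 * (exp 3)\<^sup>2 + 8 \<le> (80::real) * (exp 3)\<^sup>2" using one_le_power[of "exp (3::real)" 2] by simp
    also have "\<dots> \<le> 2 ^ 10 * (exp 3)\<^sup>2" by (intro mult_right_mono) auto
    also have "\<dots> \<le> exp 1 ^ 10 * (exp 3)\<^sup>2"
      using exp_ge_add_one_self[of "1::real"] by (intro mult_right_mono power_mono) auto
    also have "\<dots> = exp 16" by (simp flip: exp_of_nat_mult exp_add)
    finally show "72 * (exp 3)\<^sup>2 + 8 \<le> exp (16::real)" .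
  qed simp
  finally show "cosh (3 * pi * r) - cos (pi * r) \<le> exp 16 * r\<^sup>2" .
qed

lemma hgt_rise_approx:
  assumes "0 < r" "r \<le> 1/2"
  shows "\<bar>2 * pi * hgt_rise r - ln (1 / r)\<bar> \<le> 20"
proof -
  let ?D = "cosh (3 * pi * r) - cos (pi * r)"
  note D = cosh_minus_cos_asymp[OF assms]
  have r2: "0 < r\<^sup>2" using assms by simp
  then have "ln (r\<^sup>2) \<le> ln ?D" using D by (intro ln_mono)
  then have 1: "2 * ln r \<le> ln ?D" using assms by (simp add: ln_realpow)
  have "ln ?D \<le> ln (exp 16 * r\<^sup>2)" using D r2 by (intro ln_mono) linarith+
  then have 2: "ln ?D \<le> 16 + 2 * ln r" using assms by (simp add: ln_mult ln_realpow)
  have e: "2 * pi * hgt_rise r = 3 * (pi * r) / 2 + (ln 2 - ln ?D) / 2"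
    unfolding hgt_rise_def by (simp add: field_simps)
  have "pi * r \<le> 4 * (1/2)" using assms pi_less_4 by (intro mult_mono) auto
  moreover have "0 \<le> pi * r" using assms by simp
  moreover have "ln 2 \<le> (1::real)" "0 \<le> ln (2::real)" using ln_le_minus_one[of "2::real"] by auto
  moreover have "ln (1 / r) = - ln r" using assms by (simp add: ln_div)
  moreover have "\<bar>3 * X / 2 + (l - K) / 2 - m\<bar> \<le> 20"
    if "X \<le> 2" "0 \<le> X" "l \<le> 1" "0 \<le> l" "m = - R" "2 * R \<le> K" "K \<le> 16 + 2 * R" for X l m K R :: real
    by (rule abs_leI) (use that in \<open>simp_all add: field_simps\<close>)
  ultimately show ?thesis unfolding e using 1 2 by simp
qed

section \<open>Pull-backs along the nearest-integer continued fraction\<close>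

lemma continuous_on_hgt:
  fixes f g :: "'a::t2_space \<Rightarrow> real"
  assumes "0 < r" "continuous_on S f" "continuous_on S g" "\<And>z. z \<in> S \<Longrightarrow> -1 \<le> g z"
  shows "continuous_on S (\<lambda>z. hgt r (f z) (g z))"
proof -
  have "cosh (pi * r * (3 + 2 * g z)) - cos v \<noteq> 0" if "z \<in> S" for z v
    using hgt_arg_pos(1)[OF assms(1) assms(4)[OF that], of v] by linarith
  moreover have "cosh (3 * pi * r) - cos (pi * r) \<noteq> 0"
    using hgt_arg_pos(2)[OF assms(1), of 0] by linarith
  ultimately show ?thesis unfolding hgt_def
    by (intro continuous_intros assms(2,3) ballI) auto
qed

lemma hgt_lipschitz_le:
  assumes "0 < r" "r \<le> 1/2" "-1 \<le> s" "-1 \<le> t" and "\<bar>x - y\<bar> \<le> \<delta>" "\<bar>s - t\<bar> \<le> d"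
  shows "\<bar>hgt r x s - hgt r y t\<bar> \<le> \<delta> / 6 + 5/6 * d"
  using order.trans[OF hgt_lipschitz[OF assms(1-4)]] assms(5,6) by auto

text \<open>\<open>frac\<close> jumps at the integers, so continuity of a pull-back is checked on
  closed unit intervals and glued there.\<close>

lemma continuous_on_unit_intervals:
  fixes g :: "real \<Rightarrow> 'a::topological_space"
  assumes "\<And>j::int. continuous_on {of_int j..of_int j + 1} g"
  shows "continuous_on UNIV g"
proof -
  have "isCont g x" for x
  proof -
    let ?j = "\<lfloor>x\<rfloor>"
    have "continuous_on ({of_int (?j - 1)..of_int (?j - 1) + 1} \<union> {of_int ?j..of_int ?j + 1}) g"
      by (intro continuous_on_closed_Un assms) auto
    then have "continuous_on {of_int ?j - 1<..<of_int ?j + 1} g"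
      by (rule continuous_on_subset) auto
    moreover have "x \<in> {of_int ?j - 1<..<of_int ?j + 1}"
      unfolding greaterThanLessThan_iff by (intro conjI; linarith)
    ultimately show ?thesis
      by (metis continuous_on_eq_continuous_at open_greaterThanLessThan)
  qed
  then show ?thesis by (simp add: continuous_at_imp_continuous_on)
qed

lemma frac_eq_if_diff_Int:
  assumes "x - y \<in> \<int>" shows "frac x = frac (y::real)"
proof -
  obtain m where "x - y = of_int m" using assms by (rule Ints_cases)
  then have "x = y + of_int m" by simp
  then show ?thesis by (simp add: frac_def)
qed

text \<open>\<open>r n\<close> and \<open>e n\<close> stand for alpha_n and epsilon_n. The integers
  a_n enter through the congruence of \<open>1 / r n\<close> modulo 1, which is what 1-periodic
  functions see.\<close>

locale nearest_cf =
  fixes r e :: "nat \<Rightarrow> real"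
  assumes r_pos: "0 < r n" and r_less: "r n < 1/2"
    and e_cases: "e n = 1 \<or> e n = -1"
    and r_step: "1 / r n - e (Suc n) * r (Suc n) \<in> \<int>"
begin

text \<open>The real part of Y_n is \<open>- e n * r n * y\<close>, where \<open>y\<close> is the
  real part of the argument; \<open>nxt n x\<close> is the \<open>y\<close> in [0, 1 / r n) for
  which this is congruent to \<open>x\<close> modulo 1.\<close>

definition nxt :: "nat \<Rightarrow> real \<Rightarrow> real" where
  "nxt n x = frac (- e n * x) / r n"

definition lift :: "nat \<Rightarrow> (real \<Rightarrow> real) \<Rightarrow> real \<Rightarrow> real" where
  "lift n g x = hgt (r n) (nxt n x) (g (nxt n x))"

primrec pull :: "nat \<Rightarrow> nat \<Rightarrow> (real \<Rightarrow> real) \<Rightarrow> real \<Rightarrow> real" where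
  "pull 0 n g = g"
| "pull (Suc k) n g = lift n (pull k (Suc n) g)"

text \<open>The condition on \<open>e n * r n\<close> says that \<open>g\<close> takes the same value at both ends of the
  interval \<open>[0, 1 / \<alpha>\<^sub>n\<^sub>-\<^sub>1]\<close>, because \<open>1 / \<alpha>\<^sub>n\<^sub>-\<^sub>1\<close> is congruent to \<open>e n * r n\<close> modulo 1.\<close>
definition admissible :: "nat \<Rightarrow> (real \<Rightarrow> real) \<Rightarrow> bool" where
  "admissible n g \<longleftrightarrow> (\<forall>x. -1 \<le> g x) \<and> (\<forall>x y. x - y \<in> \<int> \<longrightarrow> g x = g y) \<and> g (e n * r n) = g 0"

lemma r_le: "r n \<le> 1/2" using r_less[of n] by simp
lemma r_nz: "r n \<noteq> 0" using r_pos[of n] by simp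
lemma inv_r_gt: "2 < 1 / r n" using r_less[of n] r_pos[of n] by (simp add: field_simps)
lemma e_Int: "e n \<in> \<int>" using e_cases[of n] by auto
lemma e_sq: "e n * e n = 1" "e n * (e n * z) = z" using e_cases[of n] by auto

lemma admissibleD:
  assumes "admissible n g"
  shows "-1 \<le> g x" "x - y \<in> \<int> \<Longrightarrow> g x = g y" "g (e n * r n) = g 0"
  using assms unfolding admissible_def by auto

lemma admissible_const: "-1 \<le> c \<Longrightarrow> admissible n (\<lambda>_. c)"
  unfolding admissible_def by auto

lemma admissible_end:
  assumes "admissible (Suc n) g"
  shows "g (1 / r n) = g 0" "g (1 / r n + v) = g (e (Suc n) * r (Suc n) + v)"
proof -
  have *: "g (1 / r n + v) = g (e (Suc n) * r (Suc n) + v)" for v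
    using r_step[of n] by (intro admissibleD(2)[OF assms]) simp
  then show "g (1 / r n + v) = g (e (Suc n) * r (Suc n) + v)" .
  show "g (1 / r n) = g 0" using *[of 0] admissibleD(3)[OF assms] by simp
qed

lemma nxt_bounds: "0 \<le> nxt n x" "nxt n x < 1 / r n" "r n * nxt n x = frac (- e n * x)"
  using r_pos[of n] frac_lt_1[of "- e n * x"] unfolding nxt_def by (auto simp: divide_strict_right_mono)

lemma nxt_0 [simp]: "nxt n 0 = 0" by (simp add: nxt_def)

lemma frac_eqI: "0 \<le> u \<Longrightarrow> u < 1 \<Longrightarrow> x - u \<in> \<int> \<Longrightarrow> frac x = (u::real)"
  by (metis frac_unique_iff)

text \<open>\<open>nxt\<close> chooses the left end 0 when \<open>x\<close> is an integer. The right
  end \<open>y = 1 / r n\<close> gives the same value, since \<open>g\<close> agrees at both ends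
  and the height has period \<open>1 / r n\<close>. So the formula holds on closed intervals, as
  gluing requires.\<close>

lemma lift_eq:
  assumes g: "admissible (Suc n) g" and y: "0 \<le> y" "y \<le> 1 / r n" and x: "- e n * x - r n * y \<in> \<int>"
  shows "lift n g x = hgt (r n) y (g y)"
proof (cases "y = 1 / r n")
  case False
  then have "r n * y < 1" using y r_pos[of n] by (simp add: field_simps)
  then have "frac (- e n * x) = r n * y" using y r_pos[of n] x by (intro frac_eqI) auto
  then show ?thesis using r_nz by (simp add: lift_def nxt_def)
next
  case True
  then have "- e n * x - 1 \<in> \<int>" using x r_nz[of n] by simp
  then have "- e n * x \<in> \<int>" using Ints_add[OF _ Ints_1] by fastforce
  then have "nxt n x = 0" by (simp add: nxt_def)
  then have "lift n g x = hgt (r n) 0 (g 0)" by (simp add: lift_def)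
  then show ?thesis using True admissible_end(1)[OF g] hgt_periodic[OF r_nz, of n 0] by simp
qed

lemma hgt_end: "hgt (r n) (1 / r n - 1) t = hgt (r n) 0 t"
  using hgt_reflect[of "r n" "- (1 / r n)" t] hgt_periodic[OF r_nz, of n "- (1 / r n)" t] by simp

text \<open>For the last clause: \<open>e n * r n\<close> corresponds to
  \<open>y = 1 / r n - 1\<close>, where by reflection the height map is that of the origin; the
  value of \<open>g\<close> there is the one at \<open>1 / r n\<close> by periodicity, hence
  \<open>g 0\<close>.\<close>

lemma admissible_lift:
  assumes "admissible (Suc n) g" shows "admissible n (lift n g)"
  unfolding admissible_def
proof (intro conjI allI impI)
  fix x
  show "-1 \<le> lift n g x"
    unfolding lift_def using hgt_gt_minus_one[OF r_pos r_le admissibleD(1)[OF assms]] by (simp add: less_imp_le)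
next
  fix x y :: real assume "x - y \<in> \<int>"
  then have "- e n * x - - e n * y \<in> \<int>"
    using Ints_minus[OF Ints_mult[OF e_Int[of n], of "x - y"]] by (simp add: algebra_simps)
  then have "frac (- e n * x) = frac (- e n * y)" by (rule frac_eq_if_diff_Int)
  then show "lift n g x = lift n g y" by (simp add: lift_def nxt_def)
next
  have "lift n g (e n * r n) = hgt (r n) (1 / r n - 1) (g (1 / r n - 1))"
    using inv_r_gt[of n] r_nz[of n] by (intro lift_eq assms) (auto simp: e_sq algebra_simps)
  also have "g (1 / r n - 1) = g (1 / r n)" using assms by (intro admissibleD(2)[OF assms]) auto
  finally show "lift n g (e n * r n) = lift n g 0"
    using admissible_end(1)[OF assms] by (simp add: hgt_end lift_def)
qed

lemma admissible_pull: "admissible (n + k) g \<Longrightarrow> admissible n (pull k n g)"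
  by (induction k arbitrary: n) (auto intro!: admissible_lift)

lemma continuous_lift:
  assumes g: "admissible (Suc n) g" and c: "continuous_on UNIV g"
  shows "continuous_on UNIV (lift n g)"
proof -
  have "continuous_on UNIV (\<lambda>u. lift n g (- e n * u))"
  proof (rule continuous_on_unit_intervals)
    fix j :: int
    have "continuous_on {of_int j..of_int j + 1} (\<lambda>u. hgt (r n) ((u - of_int j) / r n) (g ((u - of_int j) / r n)))"
      by (intro continuous_on_hgt[OF r_pos] continuous_intros continuous_on_compose2[OF c] admissibleD(1)[OF g])
         (auto simp: r_nz)
    then show "continuous_on {of_int j..of_int j + 1} (\<lambda>u. lift n g (- e n * u))"
    proof (rule continuous_on_eq)
      fix u assume "u \<in> {of_int j..of_int j + 1 :: real}"
      then show "hgt (r n) ((u - of_int j) / r n) (g ((u - of_int j) / r n)) = lift n g (- e n * u)"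
        using r_pos[of n] by (intro lift_eq[OF g, symmetric]) (auto simp: e_sq divide_right_mono)
    qed
  qed
  from continuous_on_compose2[OF this, of UNIV "\<lambda>u. - e n * u"]
  show ?thesis by (simp add: e_sq continuous_intros)
qed

lemma continuous_pull:
  "admissible (n + k) g \<Longrightarrow> continuous_on UNIV g \<Longrightarrow> continuous_on UNIV (pull k n g)"
  by (induction k arbitrary: n) (auto intro!: continuous_lift admissible_pull)

lemma pull_add: "pull (k + m) n g = pull k n (pull m (n + k) g)"
  by (induction k arbitrary: n) auto

lemma lift_mono:
  assumes "admissible (Suc n) g" "g (nxt n x) \<le> h (nxt n x)"
  shows "lift n g x \<le> lift n h x"
  unfolding lift_def using hgt_mono[OF r_pos admissibleD(1)[OF assms(1)] assms(2)] .

lemma pull_mono: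
  assumes "admissible (n + k) g" "\<And>x. g x \<le> h x"
  shows "pull k n g x \<le> pull k n h x"
  using assms
proof (induction k arbitrary: n x)
  case (Suc k)
  then show ?case by (auto intro!: lift_mono admissible_pull)
qed auto

lemma lift_contraction:
  assumes "admissible (Suc n) g" "admissible (Suc n) h"
  shows "\<bar>lift n g x - lift n h x\<bar> \<le> 5/6 * \<bar>g (nxt n x) - h (nxt n x)\<bar>"
  unfolding lift_def
  by (intro hgt_lipschitz_height r_pos r_le admissibleD(1)[OF assms(1)] admissibleD(1)[OF assms(2)])

lemma pull_contraction:
  assumes "admissible (n + k) g" "admissible (n + k) h" "\<And>x. \<bar>g x - h x\<bar> \<le> B"
  shows "\<bar>pull k n g x - pull k n h x\<bar> \<le> (5/6) ^ k * B"
  using assms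
proof (induction k arbitrary: n x)
  case (Suc k)
  have "\<bar>pull (Suc k) n g x - pull (Suc k) n h x\<bar>
      \<le> 5/6 * \<bar>pull k (Suc n) g (nxt n x) - pull k (Suc n) h (nxt n x)\<bar>"
    using Suc.prems by (simp only: pull.simps) (intro lift_contraction admissible_pull; simp)
  also have "\<dots> \<le> 5/6 * ((5/6) ^ k * B)"
    using Suc.IH[of "Suc n" "nxt n x"] Suc.prems by (intro mult_left_mono) auto
  finally show ?case by simp
qed auto

section \<open>Behaviour under the return maps of the rotation\<close>

definition shift_bound :: "(real \<Rightarrow> real) \<Rightarrow> real \<Rightarrow> real \<Rightarrow> bool" where
  "shift_bound g \<delta> d \<longleftrightarrow> (\<forall>x. \<bar>g (x + \<delta>) - g x\<bar> \<le> d)"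

text \<open>In the variable \<open>u = - e n * x\<close>, \<open>nxt\<close> is
  \<open>frac u / r n\<close> for either sign; the sign decides which of the two compared points
  comes first.\<close>

lemma shift_boundI:
  assumes "\<And>u. \<bar>g (- e n * (u + \<delta>)) - g (- e n * u)\<bar> \<le> d"
  shows "shift_bound g \<delta> d"
  unfolding shift_bound_def
proof
  fix x
  show "\<bar>g (x + \<delta>) - g x\<bar> \<le> d"
  proof (cases "e n = -1")
    case True then show ?thesis using assms[of x] by simp
  next
    case False
    then have "e n = 1" using e_cases by blast
    then show ?thesis using assms[of "- x - \<delta>"] by (simp add: abs_minus_commute add.commute)
  qed
qed

text \<open>When the translate by \<open>r n\<close> leaves the fundamental interval, the comparison at level \<open>Suc n\<close>
  is again between two points at distance \<open>r (Suc n)\<close>.\<close>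
lemma shift_bound_lift:
  assumes g: "admissible (Suc n) g" and s: "shift_bound g (r (Suc n)) 1"
  shows "shift_bound (lift n g) (r n) 1"
proof (rule shift_boundI[where n = n])
  fix u
  define y where "y = frac u / r n"
  have y: "0 \<le> y" "y < 1 / r n" "r n * y = frac u"
    using r_pos[of n] frac_lt_1[of u] unfolding y_def by (auto simp: divide_strict_right_mono)
  have uy: "u - r n * y \<in> \<int>" unfolding y by (simp add: frac_def)
  have 1: "lift n g (- e n * u) = hgt (r n) y (g y)"
    using y uy by (intro lift_eq g) (auto simp: e_sq)
  show "\<bar>lift n g (- e n * (u + r n)) - lift n g (- e n * u)\<bar> \<le> 1"
  proof (cases "y + 1 \<le> 1 / r n")
    case True
    have "lift n g (- e n * (u + r n)) = hgt (r n) (y + 1) (g (y + 1))"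
      using y True uy by (intro lift_eq g) (auto simp: e_sq algebra_simps)
    also have "g (y + 1) = g y" by (intro admissibleD(2)[OF g]) auto
    finally show ?thesis
      using 1 hgt_lipschitz_horizontal[OF r_pos admissibleD(1)[OF g], of n "y + 1" y y] by simp
  next
    case False
    define y' where "y' = y + 1 - 1 / r n"
    have y': "0 \<le> y'" "y' \<le> 1 / r n" using False y inv_r_gt[of n] unfolding y'_def by linarith+
    have "u + r n - r n * y' = (u - r n * y) + 1" unfolding y'_def using r_nz[of n] by (simp add: field_simps)
    then have "u + r n - r n * y' \<in> \<int>" by (simp only: Ints_add[OF uy Ints_1])
    then have "lift n g (- e n * (u + r n)) = hgt (r n) y' (g y')"
      using y' by (intro lift_eq g) (auto simp: e_sq add.commute)
    also have "\<dots> = hgt (r n) (y + 1) (g y')"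
      using hgt_periodic[OF r_nz, of n y'] unfolding y'_def by simp
    also have "g y' = g (y - e (Suc n) * r (Suc n))"
      unfolding y'_def using Ints_minus[OF Ints_diff[OF r_step[of n] Ints_1]]
      by (intro admissibleD(2)[OF g]) (simp add: algebra_simps)
    finally have 2: "lift n g (- e n * (u + r n)) = hgt (r n) (y + 1) (g (y - e (Suc n) * r (Suc n)))" .
    have "\<bar>g (y - e (Suc n) * r (Suc n)) - g y\<bar> \<le> 1"
      using e_cases[of "Suc n"] s[unfolded shift_bound_def, rule_format, of y]
        s[unfolded shift_bound_def, rule_format, of "y - r (Suc n)"] by auto
    \<comment> \<open>Horizontal distance 1 and height difference at most 1: the bound 1/6 + 5/6 = 1
      closes the recursion exactly.\<close>
    then show ?thesis unfolding 1 2
      using hgt_lipschitz[OF r_pos r_le admissibleD(1)[OF g] admissibleD(1)[OF g], of n "y + 1" "y - e (Suc n) * r (Suc n)" y y]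
      by simp
  qed
qed

lemma shift_bound_pull:
  assumes "admissible (n + k) g" "shift_bound g (r (n + k)) 1"
  shows "shift_bound (pull k n g) (r n) 1"
  using assms by (induction k arbitrary: n) (auto intro!: shift_bound_lift admissible_pull)

text \<open>Crossing the seam: \<open>e n * r n\<close> represents the right end of the interval, so
  a point at distance \<open>v\<close> before the right end is compared with the point
  \<open>\<delta> - v\<close> after the left end, its translate by \<open>\<delta>\<close> on the
  interval closed up to a circle.\<close>

definition wrap_bound :: "nat \<Rightarrow> (real \<Rightarrow> real) \<Rightarrow> real \<Rightarrow> real \<Rightarrow> bool" where
  "wrap_bound n g \<delta> d \<longleftrightarrow> (\<forall>v\<in>{0..\<delta>}. \<bar>g (e n * r n - v) - g (\<delta> - v)\<bar> \<le> d)"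

text \<open>A translation by \<open>r n * \<delta>\<close> becomes one by \<open>\<delta>\<close> at
  level \<open>Suc n\<close>, unless it crosses the seam, which is what \<open>wrap_bound\<close>
  measures.\<close>

lemma small_shift_lift:
  assumes g: "admissible (Suc n) g" and \<delta>: "0 \<le> \<delta>" "\<delta> \<le> 1"
    and s: "shift_bound g \<delta> d" and w: "wrap_bound (Suc n) g \<delta> d"
  shows "shift_bound (lift n g) (r n * \<delta>) (\<delta> / 6 + 5/6 * d)"
proof (rule shift_boundI[where n = n])
  fix u
  define y where "y = frac u / r n"
  have y: "0 \<le> y" "y < 1 / r n" "r n * y = frac u"
    using r_pos[of n] frac_lt_1[of u] unfolding y_def by (auto simp: divide_strict_right_mono)
  have uy: "u - r n * y \<in> \<int>" unfolding y by (simp add: frac_def)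
  have 1: "lift n g (- e n * u) = hgt (r n) y (g y)"
    using y uy by (intro lift_eq g) (auto simp: e_sq)
  show "\<bar>lift n g (- e n * (u + r n * \<delta>)) - lift n g (- e n * u)\<bar> \<le> \<delta> / 6 + 5/6 * d"
  proof (cases "y + \<delta> \<le> 1 / r n")
    case True
    have 2: "lift n g (- e n * (u + r n * \<delta>)) = hgt (r n) (y + \<delta>) (g (y + \<delta>))"
      using y True uy \<delta> by (intro lift_eq g) (auto simp: e_sq algebra_simps)
    have "\<bar>g (y + \<delta>) - g y\<bar> \<le> d" using s unfolding shift_bound_def by blast
    then show ?thesis unfolding 1 2
      using hgt_lipschitz[OF r_pos r_le admissibleD(1)[OF g] admissibleD(1)[OF g], of n "y + \<delta>" "y + \<delta>" y y] \<delta>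
      by simp
  next
    case False
    define v where "v = 1 / r n - y"
    have v: "0 \<le> v" "v \<le> \<delta>" "\<delta> - v \<le> 1 / r n" using False y \<delta> inv_r_gt[of n] unfolding v_def by linarith+
    have "u + r n * \<delta> - r n * (\<delta> - v) = (u - r n * y) + 1"
      unfolding v_def using r_nz[of n] by (simp add: field_simps)
    then have "u + r n * \<delta> - r n * (\<delta> - v) \<in> \<int>" by (simp only: Ints_add[OF uy Ints_1])
    then have 2: "lift n g (- e n * (u + r n * \<delta>)) = hgt (r n) (\<delta> - v) (g (\<delta> - v))"
      using v by (intro lift_eq g) (auto simp: e_sq add.commute)
    have "hgt (r n) y (g y) = hgt (r n) (- v) (g y)"
      using hgt_periodic[OF r_nz, of n "- v"] unfolding v_def by simp
    moreover have "g y = g (e (Suc n) * r (Suc n) - v)"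
      using admissible_end(2)[OF g, of "- v"] unfolding v_def by (simp add: algebra_simps)
    moreover have "\<bar>g (e (Suc n) * r (Suc n) - v) - g (\<delta> - v)\<bar> \<le> d"
      using w v unfolding wrap_bound_def by auto
    ultimately show ?thesis unfolding 1 2
      using hgt_lipschitz[OF r_pos r_le admissibleD(1)[OF g] admissibleD(1)[OF g], of n "\<delta> - v" "\<delta> - v" "- v" y] \<delta>
      by (simp add: abs_minus_commute)
  qed
qed

text \<open>The right end of level \<open>n\<close> sits at \<open>1 / r n - 1\<close> in level
  \<open>Suc n\<close>, and reflection makes the height maps there and at the origin comparable. For
  \<open>e n = -1\<close> the two points again face each other across a seam; for
  \<open>e n = 1\<close> they differ by an ordinary translation. Hence both bounds are carried along
  together.\<close>

lemma small_wrap_lift: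
  assumes g: "admissible (Suc n) g" and \<delta>: "0 \<le> \<delta>" "\<delta> \<le> 1"
    and s: "shift_bound g \<delta> d" and w: "wrap_bound (Suc n) g \<delta> d"
  shows "wrap_bound n (lift n g) (r n * \<delta>) (\<delta> / 6 + 5/6 * d)"
  unfolding wrap_bound_def
proof
  fix v assume v: "v \<in> {0..r n * \<delta>}"
  define v' where "v' = v / r n"
  have v': "0 \<le> v'" "v' \<le> \<delta>" "v = r n * v'" using v r_pos[of n] by (auto simp: v'_def field_simps)
  note inv = inv_r_gt[of n]
  note lip = hgt_lipschitz_le[OF r_pos r_le admissibleD(1)[OF g] admissibleD(1)[OF g]]
  show "\<bar>lift n g (e n * r n - v) - lift n g (r n * \<delta> - v)\<bar> \<le> \<delta> / 6 + 5/6 * d"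
  proof (cases "e n = -1")
    case True
    define y where "y = 1 / r n - 1 - v'"
    have "lift n g (e n * r n - v) = hgt (r n) y (g y)"
      unfolding y_def using v' \<delta> inv True r_nz[of n] by (intro lift_eq g) (auto simp: algebra_simps)
    also have "hgt (r n) y (g y) = hgt (r n) v' (g y)"
      using hgt_periodic[OF r_nz, of n "- 1 - v'"] hgt_reflect[of "r n" v'] unfolding y_def
      by (simp add: algebra_simps)
    also have "g y = g (e (Suc n) * r (Suc n) - v')"
      unfolding admissible_end(2)[OF g, of "- v'", simplified, symmetric] y_def
      by (intro admissibleD(2)[OF g]) auto
    finally have 1: "lift n g (e n * r n - v) = hgt (r n) v' (g (e (Suc n) * r (Suc n) - v'))" .
    have 2: "lift n g (r n * \<delta> - v) = hgt (r n) (\<delta> - v') (g (\<delta> - v'))"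
      using v' \<delta> inv True by (intro lift_eq g) (auto simp: algebra_simps)
    have "\<bar>g (e (Suc n) * r (Suc n) - v') - g (\<delta> - v')\<bar> \<le> d"
      using w v' unfolding wrap_bound_def by auto
    moreover have "\<bar>v' - (\<delta> - v')\<bar> \<le> \<delta>" using v' by linarith
    ultimately show ?thesis unfolding 1 2
      by (intro lip) auto
  next
    case False
    then have e: "e n = 1" using e_cases by blast
    define y where "y = 1 / r n - \<delta> + v'"
    have "lift n g (e n * r n - v) = hgt (r n) (1 / r n - 1 + v') (g (1 / r n - 1 + v'))"
      using v' \<delta> inv e r_nz[of n] by (intro lift_eq g) (auto simp: algebra_simps)
    also have "hgt (r n) (1 / r n - 1 + v') (g (1 / r n - 1 + v')) = hgt (r n) (- v') (g (1 / r n - 1 + v'))"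
      using hgt_periodic[OF r_nz, of n "- 1 + v'"] hgt_reflect[of "r n" "- v'"]
      by (simp add: algebra_simps)
    also have "g (1 / r n - 1 + v') = g (y + \<delta>)"
      unfolding y_def by (intro admissibleD(2)[OF g]) auto
    finally have 1: "lift n g (e n * r n - v) = hgt (r n) (- v') (g (y + \<delta>))" .
    have "lift n g (r n * \<delta> - v) = hgt (r n) y (g y)"
      unfolding y_def using v' \<delta> inv e r_nz[of n] by (intro lift_eq g) (auto simp: algebra_simps)
    also have "\<dots> = hgt (r n) (- \<delta> + v') (g y)"
      using hgt_periodic[OF r_nz, of n "- \<delta> + v'"] unfolding y_def by (simp add: algebra_simps)
    finally have 2: "lift n g (r n * \<delta> - v) = hgt (r n) (- \<delta> + v') (g y)" .
    have "\<bar>g (y + \<delta>) - g y\<bar> \<le> d" using s unfolding shift_bound_def by blast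
    moreover have "\<bar>- v' - (- \<delta> + v')\<bar> \<le> \<delta>" using v' by linarith
    ultimately show ?thesis unfolding 1 2
      by (intro lip) auto
  qed
qed

text \<open>The weight beta_(k-1) of the expansion started at level \<open>n\<close>; a translation
  by it becomes, \<open>k\<close> levels further on, a translation by the period 1.\<close>

definition rprod :: "nat \<Rightarrow> nat \<Rightarrow> real" where
  "rprod n k = (\<Prod>i<k. r (n + i))"

lemma rprod_0 [simp]: "rprod n 0 = 1"
  and rprod_Suc: "rprod n (Suc k) = r n * rprod (Suc n) k"
  by (simp_all add: rprod_def prod.lessThan_Suc_shift del: prod.lessThan_Suc)

lemma rprod_pos: "0 < rprod n k"
  unfolding rprod_def by (intro prod_pos) (auto simp: r_pos)

lemma rprod_le: "rprod n k \<le> (1/2) ^ k"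
proof -
  have "rprod n k \<le> (\<Prod>i<k. 1/2)" unfolding rprod_def
    by (intro prod_mono conjI less_imp_le[OF r_pos] r_le)
  then show ?thesis by simp
qed

text \<open>The bound solves the recursion m' = (1/2)^k / 6 + 5/6 * m with initial value 1, where
  (1/2)^k bounds \<open>rprod\<close>. At \<open>k = 0\<close> the translation is by a period, and
  the seam term reduces to the assumed bound for \<open>r n\<close>.\<close>

lemma small_shift_pull_aux:
  assumes "admissible (n + k) g" "shift_bound g (r (n + k)) 1"
  shows "shift_bound (pull k n g) (rprod n k) (3/2 * (5/6) ^ k - 1/2 * (1/2) ^ k) \<and>
         wrap_bound n (pull k n g) (rprod n k) (3/2 * (5/6) ^ k - 1/2 * (1/2) ^ k)"
  using assms
proof (induction k arbitrary: n)
  case 0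
  have per: "g (x + 1) = g x" "g (1 + x) = g x" for x
    using 0 by (auto intro!: admissibleD(2)[of n g])
  have "\<bar>g (e n * r n - v) - g (1 - v)\<bar> \<le> 1" for v
  proof -
    have "g (1 - v) = g (- v)" using per(2)[of "- v"] by simp
    then show ?thesis
      using e_cases[of n] 0(2)[unfolded shift_bound_def, rule_format, of "- v"]
        0(2)[unfolded shift_bound_def, rule_format, of "- r n - v"] by (auto simp: algebra_simps abs_minus_commute)
  qed
  then show ?case by (auto simp: shift_bound_def wrap_bound_def per)
next
  case (Suc k)
  define m where "m = 3/2 * (5/6) ^ k - 1/2 * (1/2::real) ^ k"
  have a: "admissible (Suc n) (pull k (Suc n) g)" using Suc.prems by (intro admissible_pull) simp
  have IH: "shift_bound (pull k (Suc n) g) (rprod (Suc n) k) m"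
    "wrap_bound (Suc n) (pull k (Suc n) g) (rprod (Suc n) k) m"
    using Suc.IH[of "Suc n"] Suc.prems unfolding m_def by auto
  have rp: "0 \<le> rprod (Suc n) k" "rprod (Suc n) k \<le> 1"
    using rprod_pos[of "Suc n" k] rprod_le[of "Suc n" k] power_le_one[of "1/2::real" k] by auto
  have "rprod (Suc n) k / 6 + 5/6 * m \<le> 3/2 * (5/6) ^ Suc k - 1/2 * (1/2) ^ Suc k"
    unfolding m_def using rprod_le[of "Suc n" k] by (simp add: algebra_simps)
  then show ?case
    using small_shift_lift[OF a rp IH] small_wrap_lift[OF a rp IH]
    by (auto simp: rprod_Suc shift_bound_def wrap_bound_def intro: order.trans)
qed

lemma small_shift_pull:
  assumes "admissible (n + k) g" "shift_bound g (r (n + k)) 1"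
  shows "\<bar>pull k n g (x + rprod n k) - pull k n g x\<bar> \<le> 2 * (5/6) ^ k"
proof -
  have "\<bar>pull k n g (x + rprod n k) - pull k n g x\<bar> \<le> 3/2 * (5/6) ^ k - 1/2 * (1/2) ^ k"
    using small_shift_pull_aux[OF assms] unfolding shift_bound_def by blast
  also have "\<dots> \<le> 2 * (5/6) ^ k" by (simp add: algebra_simps add_increasing)
  finally show ?thesis .
qed

text \<open>13/2 solves C = 5/6 * C + 1 + 1/12: the contracted old error, the loss of
  \<open>hgt_le_max\<close>, and the loss of \<open>hgt_ge_origin\<close>. The function
  \<open>f\<close> absorbs the parts that do not depend on the height.\<close>

lemma lift_le_max:
  assumes a: "admissible (Suc n) g" "admissible (Suc n) f" and m: "\<And>x. g x \<le> max (g 0) (f x) + 13/2"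
  shows "lift n g x \<le> max (lift n g 0) (lift n f x) + 13/2"
proof -
  let ?y = "nxt n x"
  note ge = admissibleD(1)[OF a(1)] admissibleD(1)[OF a(2)]
  have 1: "lift n g x \<le> max (hgt (r n) 0 (g ?y)) (hgt (r n) ?y (-1)) + 1"
    unfolding lift_def by (rule hgt_le_max[OF r_pos r_le ge(1)])
  have 2: "hgt (r n) ?y (-1) \<le> lift n f x"
    unfolding lift_def using ge by (intro hgt_mono r_pos) auto
  have "hgt (r n) 0 (g ?y) \<le> hgt (r n) 0 (max (g 0) (f ?y) + 13/2)"
    using m ge by (intro hgt_mono r_pos) auto
  also have "\<dots> \<le> hgt (r n) 0 (max (g 0) (f ?y)) + 65/12"
    using hgt_contraction[OF r_pos r_le, of "max (g 0) (f ?y)" "max (g 0) (f ?y) + 13/2" n 0] ge[of 0]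
    by (auto simp: le_max_iff_disj)
  finally have 3: "hgt (r n) 0 (g ?y) \<le> hgt (r n) 0 (max (g 0) (f ?y)) + 65/12" .
  have 4: "hgt (r n) 0 (max (g 0) (f ?y)) \<le> max (lift n g 0) (lift n f x + 1/12)"
    using hgt_ge_origin[OF r_pos, of "f ?y" n ?y] ge by (auto simp: max_def lift_def)
  show ?thesis using 1 2 3 4 by (auto simp: max_def split: if_splits)
qed

lemma pull_le_max:
  assumes "admissible (n + k) g" "admissible (n + k) f" "\<And>x. g x \<le> max (g 0) (f x) + 13/2"
  shows "pull k n g x \<le> max (pull k n g 0) (pull k n f x) + 13/2"
  using assms
proof (induction k arbitrary: n x)
  case (Suc k)
  then show ?case by (simp only: pull.simps) (intro lift_le_max admissible_pull; simp)
qed auto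

text \<open>Again a fixed point: 1/2 = 5/6 * 1/2 + 1/12.\<close>

lemma lift_ge_origin:
  assumes a: "admissible (Suc n) g" and m: "\<And>x. g 0 - 1/2 \<le> g x"
  shows "lift n g 0 - 1/2 \<le> lift n g x"
proof -
  let ?y = "nxt n x"
  note ge = admissibleD(1)[OF a]
  have "hgt (r n) 0 (g 0) - 5/12 \<le> hgt (r n) 0 (g ?y)"
  proof (cases "g 0 \<le> g ?y")
    case True
    then show ?thesis using hgt_mono[OF r_pos ge True, of n 0] by simp
  next
    case False
    then show ?thesis using hgt_contraction[OF r_pos r_le ge, of ?y "g 0" n 0] m[of ?y] by simp
  qed
  with hgt_ge_origin[OF r_pos ge, of n ?y ?y] show ?thesis by (simp add: lift_def)
qed

lemma pull_ge_origin:
  assumes "admissible (n + k) g" "\<And>x. g 0 - 1/2 \<le> g x"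
  shows "pull k n g 0 - 1/2 \<le> pull k n g x"
  using assms
proof (induction k arbitrary: n x)
  case (Suc k)
  then show ?case by (simp only: pull.simps) (intro lift_ge_origin admissible_pull; simp)
qed auto

end

section \<open>Centred orbits and the floor functions\<close>

text \<open>The error 20 of \<open>hgt_rise_approx\<close> over \<open>2 * pi\<close> is at most
  10/3; with the loss 1/4 at a centre it stays below 4.\<close>

lemma hgt_bounds:
  assumes "0 < r" "r \<le> 1/2" "-1 \<le> t"
  shows "hgt r x t \<le> r * t + (ln (1 / r) / (2 * pi) + 4)"
    and "cos (pi * r * (1 + 2 * x)) \<le> 0 \<Longrightarrow> r * t + (ln (1 / r) / (2 * pi) - 4) \<le> hgt r x t"
proof -
  have "\<bar>hgt_rise r - ln (1 / r) / (2 * pi)\<bar> = \<bar>2 * pi * hgt_rise r - ln (1 / r)\<bar> / (2 * pi)"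
    by (simp add: field_simps flip: abs_mult)
  also have "\<dots> \<le> 20 / (2 * 3)"
    using hgt_rise_approx[OF assms(1,2)] pi_gt3 by (intro frac_le) auto
  finally have *: "\<bar>hgt_rise r - ln (1 / r) / (2 * pi)\<bar> \<le> 10/3" by simp
  show "hgt r x t \<le> r * t + (ln (1 / r) / (2 * pi) + 4)"
    using hgt_upper[OF assms(1,3), of x] * by linarith
  show "r * t + (ln (1 / r) / (2 * pi) - 4) \<le> hgt r x t" if "cos (pi * r * (1 + 2 * x)) \<le> 0"
    using hgt_lower_centre[OF assms(1,3) that] * by linarith
qed

context nearest_cf
begin

primrec orbit :: "real \<Rightarrow> nat \<Rightarrow> real" where
  "orbit x 0 = x"
| "orbit x (Suc n) = nxt n (orbit x n)"

lemma orbit_0 [simp]: "orbit 0 n = 0"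
  by (induction n) auto

text \<open>In the variable \<open>u = r n * y\<close>, this is where
  \<open>pi * r n * (1 + 2 * y)\<close> lies between pi/2 and 3 pi/2. The corresponding interval of
  \<open>y\<close> has length \<open>1 / (2 * r n) > 1\<close>, so it meets every residue class
  modulo 1.\<close>

definition window :: "nat \<Rightarrow> real set" where
  "window n = {1/4 - r n / 2 .. 3/4 - r n / 2}"

primrec centred :: "nat \<Rightarrow> nat \<Rightarrow> real set" where
  "centred 0 n = window n"
| "centred (Suc k) n = {u \<in> window n. \<exists>w\<in>centred k (Suc n). - e (Suc n) * (u / r n) - w \<in> \<int>}"

lemma window_bounds: "u \<in> window n \<Longrightarrow> 0 < u \<and> u < 1"
  using r_pos[of n] r_less[of n] by (auto simp: window_def)

lemma window_cos:
  assumes "r n * y \<in> window n" shows "cos (pi * r n * (1 + 2 * y)) \<le> 0"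
proof -
  let ?t = "r n * (1 + 2 * y)"
  have "1/2 \<le> ?t" "?t \<le> 3/2" using assms by (auto simp: window_def algebra_simps)
  then have "\<bar>?t - 1\<bar> \<le> 1/2" by (intro abs_leI) auto
  then have "pi * \<bar>?t - 1\<bar> \<le> pi * (1/2)" by (intro mult_left_mono) auto
  then have "\<bar>pi * (?t - 1)\<bar> \<le> pi / 2" by (simp add: abs_mult)
  then have "0 \<le> cos \<bar>pi * (?t - 1)\<bar>"
    by (intro cos_ge_zero) (auto intro: order.trans[OF _ abs_ge_zero])
  then have "0 \<le> cos (pi * (?t - 1))" by (simp only: cos_abs_real)
  also have "pi * (?t - 1) = pi * r n * (1 + 2 * y) - pi" by (simp add: algebra_simps)
  finally show ?thesis by (simp add: cos_diff)
qed

lemma centred_window: "centred k n \<subseteq> window n"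
  by (cases k) auto

text \<open>Orbits are built backwards: given a good point \<open>w\<close> of the next level, the
  window contains some \<open>y\<close> with the residue modulo 1 that leads to
  \<open>w\<close>.\<close>

lemma centred_nonempty: "centred k n \<noteq> {}"
proof (induction k arbitrary: n)
  case 0 show ?case by (simp add: window_def)
next
  case (Suc k)
  obtain w where w: "w \<in> centred k (Suc n)" using Suc.IH[of "Suc n"] by blast
  define a where "a = (1/4 - r n / 2) / r n"
  define y where "y = a + frac (- e (Suc n) * w - a)"
  have "a \<le> y" "y \<le> a + 1"
    using frac_lt_1[of "- e (Suc n) * w - a"] frac_ge_0[of "- e (Suc n) * w - a"] unfolding y_def by linarith+
  moreover have "a + 1 \<le> (3/4 - r n / 2) / r n"
    using r_pos[of n] r_less[of n] unfolding a_def by (simp add: field_simps)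
  ultimately have "r n * y \<in> window n"
    using r_pos[of n] unfolding window_def a_def by (auto simp: field_simps)
  moreover have "- e (Suc n) * (r n * y / r n) - w \<in> \<int>"
  proof -
    have "y + e (Suc n) * w \<in> \<int>" unfolding y_def by (simp add: frac_def)
    then have "- (e (Suc n) * (y + e (Suc n) * w)) \<in> \<int>" by (intro Ints_minus Ints_mult e_Int)
    moreover have "- e (Suc n) * (r n * y / r n) - w = - (e (Suc n) * (y + e (Suc n) * w))"
      using r_nz[of n] by (simp add: distrib_left e_sq)
    ultimately show ?thesis by simp
  qed
  ultimately have "r n * y \<in> centred (Suc k) n" using w unfolding centred.simps by blast
  then show ?case by blast
qed

lemma compact_centred: "compact (centred k n)"
proof (induction k arbitrary: n)
  case 0 show ?case by (simp add: window_def)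
next
  case (Suc k)
  let ?S = "\<Union>w\<in>centred k (Suc n). \<Union>z\<in>\<int>. {w + z}"
  have "closed ?S" by (rule compact_closed_sums[OF Suc.IH closed_Ints])
  then have "closed ((\<lambda>u. - e (Suc n) * (u / r n)) -` ?S)"
    by (rule closed_vimage) (intro continuous_intros; simp add: r_nz)
  moreover have "centred (Suc k) n = window n \<inter> (\<lambda>u. - e (Suc n) * (u / r n)) -` ?S"
  proof (intro set_eqI iffI)
    fix u assume "u \<in> centred (Suc k) n"
    then obtain w where "u \<in> window n" "w \<in> centred k (Suc n)" "- e (Suc n) * (u / r n) - w \<in> \<int>" by auto
    then show "u \<in> window n \<inter> (\<lambda>u. - e (Suc n) * (u / r n)) -` ?S"
    proof (intro IntI vimageI2 UN_I)
      show "- e (Suc n) * (u / r n) \<in> {w + (- e (Suc n) * (u / r n) - w)}" by simp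
    qed
  next
    fix u assume "u \<in> window n \<inter> (\<lambda>u. - e (Suc n) * (u / r n)) -` ?S"
    then obtain w z where "u \<in> window n" "w \<in> centred k (Suc n)" "z \<in> \<int>" "- e (Suc n) * (u / r n) = w + z" by auto
    then show "u \<in> centred (Suc k) n" by (auto intro!: bexI[of _ w])
  qed
  moreover have "compact (window n)" by (simp add: window_def)
  ultimately show ?case by (simp only: compact_Int_closed)
qed

lemma centred_antimono: "centred (Suc k) n \<subseteq> centred k n"
proof (induction k arbitrary: n)
  case (Suc k)
  show ?case unfolding centred.simps(2)[of "Suc k"] centred.simps(2)[of k n]
    using Suc.IH[of "Suc n"] by blast
qed auto

text \<open>Nested nonempty compact sets have a common point, good for all finite \<open>k\<close>
  at once. Windows lie in (0, 1), so a point prescribed modulo 1 at the next level is the actual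
  fractional part, and the finite itineraries fit into one orbit.\<close>

lemma exists_centred_orbit: "\<exists>x. \<forall>n. cos (pi * r n * (1 + 2 * orbit x (Suc n))) \<le> 0"
proof -
  have "\<Inter>(range (\<lambda>k. centred k 0)) \<noteq> {}"
    by (rule compact_nest[OF compact_centred centred_nonempty])
       (rule lift_Suc_antimono_le[of "\<lambda>k. centred k 0"], rule centred_antimono)
  then obtain u where u: "\<And>k. u \<in> centred k 0" by auto
  define x where "x = - e 0 * u"
  have *: "r n * orbit x (Suc n) \<in> (\<Inter>k. centred k n)" for n
  proof (induction n)
    case 0
    have "frac u = u" using window_bounds[of u 0] u[of 0] by (simp add: frac_eq)
    then show ?case using u by (simp add: x_def nxt_bounds e_sq)
  next
    case (Suc n)
    let ?u = "r n * orbit x (Suc n)" and ?v = "r (Suc n) * orbit x (Suc (Suc n))"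
    have "?v \<in> centred k (Suc n)" for k
    proof -
      have "?u \<in> centred (Suc k) n" using Suc by blast
      then obtain w where w: "w \<in> centred k (Suc n)" "- e (Suc n) * (?u / r n) - w \<in> \<int>"
        by (simp only: centred.simps) blast
      have "frac (- e (Suc n) * orbit x (Suc n)) = w"
        using w window_bounds[of w "Suc n"] centred_window[of k "Suc n"] r_nz[of n]
        by (intro frac_eqI) auto
      then show ?thesis using w by (simp only: orbit.simps(2)[of x "Suc n"] nxt_bounds)
    qed
    then show ?case by blast
  qed
  have "cos (pi * r n * (1 + 2 * orbit x (Suc n))) \<le> 0" for n
    using *[of n] centred_window[of 0 n] by (intro window_cos) blast
  then show ?thesis by blast
qed

text \<open>Levels are shifted by one: \<open>floor_fun n j\<close> bounds the set $I_{n-1}^j$ from below.\<close>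
definition floor_fun :: "nat \<Rightarrow> nat \<Rightarrow> real \<Rightarrow> real" where
  "floor_fun n j = pull j n (\<lambda>_. -1)"

lemma admissible_floor: "admissible n (floor_fun n j)"
  unfolding floor_fun_def by (intro admissible_pull admissible_const) simp

lemma continuous_floor: "continuous_on UNIV (floor_fun n j)"
  unfolding floor_fun_def by (intro continuous_pull admissible_const) auto

lemma floor_Suc: "floor_fun n (Suc j) = lift n (floor_fun (Suc n) j)"
  by (simp add: floor_fun_def)

lemma floor_mono: "i \<le> j \<Longrightarrow> floor_fun n i x \<le> floor_fun n j x"
proof (rule lift_Suc_mono_le[of "\<lambda>j. floor_fun n j x"])
  fix j
  have "pull j n (\<lambda>_. -1) x \<le> pull j n (lift (n + j) (\<lambda>_. -1)) x"
    by (intro pull_mono admissible_const admissibleD(1)[OF admissible_lift]) auto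
  also have "pull j n (lift (n + j) (\<lambda>_. -1)) = pull (Suc j) n (\<lambda>_. -1)"
    using pull_add[of j 1 n "\<lambda>_. -1"] by simp
  finally show "floor_fun n j x \<le> floor_fun n (Suc j) x" unfolding floor_fun_def .
qed

lemma shift_bound_floor: "\<bar>floor_fun n j (x + r n) - floor_fun n j x\<bar> \<le> 1"
  using shift_bound_pull[of n j "\<lambda>_. -1"] admissible_const[of "-1"]
  unfolding floor_fun_def shift_bound_def by simp

lemma small_shift_floor:
  assumes "k \<le> j"
  shows "\<bar>floor_fun n j (x + rprod n k) - floor_fun n j x\<bar> \<le> 2 * (5/6) ^ k"
proof -
  have "floor_fun n j = pull k n (floor_fun (n + k) (j - k))"
    unfolding floor_fun_def using pull_add[of k "j - k" n "\<lambda>_. -1"] assms by simp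
  moreover have "shift_bound (floor_fun (n + k) (j - k)) (r (n + k)) 1"
    using shift_bound_floor unfolding shift_bound_def by blast
  ultimately show ?thesis using small_shift_pull[OF admissible_floor, of n k] by simp
qed

text \<open>The height map at the origin fixes 0, and the floors start below it.\<close>

lemma floor_origin: "floor_fun n j 0 \<le> 0"
proof (induction j arbitrary: n)
  case (Suc j)
  have "lift n (floor_fun (Suc n) j) 0 \<le> hgt (r n) 0 0"
    unfolding lift_def using Suc admissibleD(1)[OF admissible_floor]
    by (simp add: hgt_mono[OF r_pos])
  then show ?case by (simp add: floor_Suc hgt_0_0)
qed (simp add: floor_fun_def)

abbreviation brjuno_term :: "nat \<Rightarrow> nat \<Rightarrow> real" where
  "brjuno_term n k \<equiv> rprod n k * ln (1 / r (n + k))"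

lemma ln_r_pos: "0 < ln (1 / r n)"
  using inv_r_gt[of n] by (intro ln_gt_zero) linarith

lemma brjuno_term_pos: "0 < brjuno_term n k"
  using rprod_pos ln_r_pos by simp

text \<open>Iterates the affine lower bound valid at centres; the subtracted
  \<open>rprod n k\<close> is the weight of the starting height -1.\<close>

lemma floor_lower_centre:
  assumes x: "\<And>n. cos (pi * r n * (1 + 2 * orbit x (Suc n))) \<le> 0"
  shows "(\<Sum>i<k. rprod n i * (ln (1 / r (n + i)) / (2 * pi) - 4)) - rprod n k \<le> floor_fun n k (orbit x n)"
proof (induction k arbitrary: n)
  case (Suc k)
  let ?c = "\<lambda>i. ln (1 / r i) / (2 * pi) - 4"
  have "(\<Sum>i<Suc k. rprod n i * ?c (n + i)) - rprod n (Suc k)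
      = r n * ((\<Sum>i<k. rprod (Suc n) i * ?c (Suc n + i)) - rprod (Suc n) k) + ?c n"
    unfolding sum.lessThan_Suc_shift by (simp add: rprod_Suc sum_distrib_left algebra_simps)
  also have "\<dots> \<le> r n * floor_fun (Suc n) k (orbit x (Suc n)) + ?c n"
    using Suc.IH[of "Suc n"] less_imp_le[OF r_pos] by (intro add_mono mult_left_mono) auto
  also have "\<dots> \<le> hgt (r n) (orbit x (Suc n)) (floor_fun (Suc n) k (orbit x (Suc n)))"
    by (intro hgt_bounds(2) r_pos r_le x admissibleD(1)[OF admissible_floor])
  finally show ?case by (simp add: floor_Suc lift_def)
qed (simp add: floor_fun_def)

lemma sum_rprod_le: "(\<Sum>i<k. rprod n i) \<le> 2"
proof -
  have "(\<Sum>i<k. rprod n i) \<le> (\<Sum>i<k. (1/2) ^ i)" by (intro sum_mono rprod_le)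
  also have "\<dots> \<le> (\<Sum>i. (1/2) ^ i)" by (intro sum_le_suminf summable_geometric) auto
  also have "\<dots> = 2" by (subst suminf_geometric) auto
  finally show ?thesis .
qed

lemma floor_unbounded:
  assumes "\<not> summable (brjuno_term 0)"
  shows "\<exists>x. \<forall>B. \<exists>j. B < floor_fun 0 j x"
proof -
  obtain x where x: "\<And>n. cos (pi * r n * (1 + 2 * orbit x (Suc n))) \<le> 0"
    using exists_centred_orbit by blast
  have "\<exists>j. B < floor_fun 0 j x" for B
  proof (rule ccontr)
    assume "\<nexists>j. B < floor_fun 0 j x"
    then have B: "floor_fun 0 j x \<le> B" for j by (simp add: not_less)
    \<comment> \<open>The errors 4 per level add up, with weights, to at most 4 * 2, and the
      starting height contributes at most 1.\<close>
    have "(\<Sum>i<k. brjuno_term 0 i) \<le> 2 * pi * (B + 9)" for k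
    proof -
      have "(\<Sum>i<k. rprod 0 i * (ln (1 / r i) / (2 * pi) - 4)) - rprod 0 k \<le> B"
        using floor_lower_centre[OF x, of 0 k] B[of k] by simp
      moreover have "(\<Sum>i<k. rprod 0 i * (ln (1 / r i) / (2 * pi) - 4))
          = (\<Sum>i<k. brjuno_term 0 i) / (2 * pi) - 4 * (\<Sum>i<k. rprod 0 i)"
        by (simp add: right_diff_distrib sum_subtractf sum_divide_distrib sum_distrib_left mult.commute)
      moreover have "rprod 0 k \<le> 1" using rprod_le[of 0 k] power_le_one[of "1/2::real" k] by simp
      ultimately have "(\<Sum>i<k. brjuno_term 0 i) / (2 * pi) \<le> B + 9"
        using sum_rprod_le[of 0 k] by simp
      then show ?thesis by (simp add: pos_divide_le_eq mult.commute)
    qed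
    then have "summable (brjuno_term 0)"
      by (intro summableI_nonneg_bounded[of _ "2 * pi * (B + 9)"] less_imp_le[OF brjuno_term_pos])
    with assms show False by contradiction
  qed
  then show ?thesis by blast
qed

end

section \<open>Base and peak functions under the Brjuno condition\<close>

context nearest_cf
begin

lemma shift_bound_const: "shift_bound (\<lambda>_. c) \<delta> 1"
  by (simp add: shift_bound_def)

text \<open>\<open>nxt\<close> fixes 0, so values at the origin depend on values at the origin only;
  functions that are far apart elsewhere can thus be compared.\<close>

lemma pull_origin_contraction:
  assumes "admissible (n + k) g" "admissible (n + k) h"
  shows "\<bar>pull k n g 0 - pull k n h 0\<bar> \<le> \<bar>g 0 - h 0\<bar>"
  using assms
proof (induction k arbitrary: n)
  case (Suc k)
  have "\<bar>pull (Suc k) n g 0 - pull (Suc k) n h 0\<bar> \<le> 5/6 * \<bar>pull k (Suc n) g 0 - pull k (Suc n) h 0\<bar>"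
    using lift_contraction[OF admissible_pull admissible_pull, of n k g k h 0] Suc.prems by simp
  also have "\<dots> \<le> \<bar>pull k (Suc n) g 0 - pull k (Suc n) h 0\<bar>" by simp
  also have "\<dots> \<le> \<bar>g 0 - h 0\<bar>" using Suc by simp
  finally show ?case .
qed simp

lemma lift_tendsto:
  assumes "\<And>j. admissible (Suc n) (g j)" "-1 \<le> h (nxt n x)" "(\<lambda>j. g j (nxt n x)) \<longlonglongrightarrow> h (nxt n x)"
  shows "(\<lambda>j. lift n (g j) x) \<longlonglongrightarrow> lift n h x"
proof -
  have lim: "(\<lambda>j. 5/6 * \<bar>g j (nxt n x) - h (nxt n x)\<bar>) \<longlonglongrightarrow> 0"
    using tendsto_mult_right_zero[OF tendsto_rabs_zero[OF LIM_zero[OF assms(3)]]] .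
  have "norm (lift n (g j) x - lift n h x) \<le> 5/6 * \<bar>g j (nxt n x) - h (nxt n x)\<bar>" for j
    unfolding lift_def real_norm_def
    by (intro hgt_lipschitz_height r_pos r_le admissibleD(1)[OF assms(1)] assms(2))
  then have "(\<lambda>j. lift n (g j) x - lift n h x) \<longlonglongrightarrow> 0"
    by (intro Lim_null_comparison[OF _ lim] always_eventually allI)
  then show ?thesis by (rule LIM_zero_cancel)
qed

lemma admissible_tendsto:
  assumes "\<And>j. admissible n (g j)" "\<And>x. (\<lambda>j. g j x) \<longlonglongrightarrow> h x"
  shows "admissible n h"
  unfolding admissible_def
proof (intro conjI allI impI)
  show "-1 \<le> h x" for x
    by (rule LIMSEQ_le_const[OF assms(2)]) (use admissibleD(1)[OF assms(1)] in blast)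
  show "h x = h y" if "x - y \<in> \<int>" for x y
    using LIMSEQ_unique[OF assms(2)[of x]] assms(2)[of y] admissibleD(2)[OF assms(1) that] by simp
  show "h (e n * r n) = h 0"
    using LIMSEQ_unique[OF assms(2)[of "e n * r n"]] assms(2)[of 0] admissibleD(3)[OF assms(1)] by simp
qed

lemma shift_bound_tendsto:
  assumes "\<And>j. shift_bound (g j) \<delta> d" "\<And>x. (\<lambda>j. g j x) \<longlonglongrightarrow> h x"
  shows "shift_bound h \<delta> d"
  unfolding shift_bound_def
proof
  fix x
  have "(\<lambda>j. \<bar>g j (x + \<delta>) - g j x\<bar>) \<longlonglongrightarrow> \<bar>h (x + \<delta>) - h x\<bar>" by (intro tendsto_intros assms)
  then show "\<bar>h (x + \<delta>) - h x\<bar> \<le> d"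
    by (rule LIMSEQ_le_const2) (use assms(1) in \<open>auto simp: shift_bound_def\<close>)
qed

end

locale nearest_cf_brjuno = nearest_cf +
  assumes brjuno: "summable (brjuno_term 0)"
begin

section \<open>Super-solutions from the tails of the Brjuno sum\<close>

lemma rprod_add: "rprod n (k + m) = rprod n k * rprod (n + k) m"
  by (induction k arbitrary: n) (auto simp: rprod_Suc)

lemma summable_brjuno: "summable (brjuno_term n)"
proof -
  have "summable (\<lambda>k. brjuno_term 0 (k + n) / rprod 0 n)"
    by (intro summable_divide summable_ignore_initial_segment brjuno)
  moreover have "rprod 0 (k + n) * ln (1 / r (0 + (k + n))) / rprod 0 n = brjuno_term n k" for k
    using rprod_add[of 0 n k] rprod_pos[of 0 n] by (simp add: add.commute)
  ultimately show ?thesis by (simp only: add_0)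
qed

text \<open>The 4 is the error of the upper bound in \<open>hgt_bounds\<close>; it makes the
  constants \<open>ceil_sum\<close> decrease under pull-back (\<open>lift_ceil_sum\<close>).\<close>

definition ceil_term :: "nat \<Rightarrow> nat \<Rightarrow> real" where
  "ceil_term n k = rprod n k * (ln (1 / r (n + k)) / (2 * pi) + 4)"

definition ceil_sum :: "nat \<Rightarrow> real" where
  "ceil_sum n = (\<Sum>k. ceil_term n k)"

lemma summable_rprod: "summable (rprod n)"
  by (rule summable_comparison_test'[OF summable_geometric[of "1/2"]])
     (use rprod_le rprod_pos in \<open>auto simp: less_imp_le\<close>)

lemma summable_ceil_term: "summable (ceil_term n)"
proof -
  have "summable (\<lambda>k. brjuno_term n k / (2 * pi) + rprod n k * 4)"
    by (intro summable_add summable_divide summable_mult2 summable_brjuno summable_rprod)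
  then show ?thesis unfolding ceil_term_def by (simp add: distrib_left)
qed

lemma ceil_term_nonneg: "0 \<le> ceil_term n k"
  unfolding ceil_term_def using less_imp_le[OF rprod_pos] less_imp_le[OF ln_r_pos] by simp

lemma ceil_sum_rec: "ceil_sum n = ln (1 / r n) / (2 * pi) + 4 + r n * ceil_sum (Suc n)"
proof -
  have "ceil_sum n = ceil_term n 0 + (\<Sum>k. ceil_term n (Suc k))"
    unfolding ceil_sum_def using suminf_split_head[OF summable_ceil_term, of n] by simp
  also have "(\<Sum>k. ceil_term n (Suc k)) = (\<Sum>k. r n * ceil_term (Suc n) k)"
    by (simp add: ceil_term_def rprod_Suc mult.assoc)
  also have "\<dots> = r n * ceil_sum (Suc n)"
    unfolding ceil_sum_def by (rule suminf_mult[OF summable_ceil_term])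
  finally show ?thesis by (simp add: ceil_term_def)
qed

lemma ceil_sum_nonneg: "0 \<le> ceil_sum n"
  unfolding ceil_sum_def by (intro suminf_nonneg summable_ceil_term ceil_term_nonneg)

text \<open>Scaled back to level 0, \<open>ceil_sum k\<close> is the tail of
  \<open>ceil_sum 0\<close> from index \<open>k\<close> on.\<close>

lemma rprod_ceil_sum: "(\<lambda>k. rprod 0 k * ceil_sum k) \<longlonglongrightarrow> 0"
proof -
  have "rprod 0 k * ceil_sum k = (\<Sum>i. ceil_term 0 (i + k))" for k
  proof -
    have "rprod 0 k * ceil_sum k = (\<Sum>i. rprod 0 k * ceil_term k i)"
      unfolding ceil_sum_def by (rule suminf_mult[OF summable_ceil_term, symmetric])
    also have "(\<lambda>i. rprod 0 k * ceil_term k i) = (\<lambda>i. ceil_term 0 (i + k))"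
      using rprod_add[of 0 k] by (auto simp: ceil_term_def add.commute fun_eq_iff)
    finally show ?thesis .
  qed
  moreover have "(\<lambda>k. \<Sum>i. ceil_term 0 (i + k)) \<longlonglongrightarrow> 0"
    using suminf_exist_split[OF _ summable_ceil_term] unfolding LIMSEQ_def by auto
  ultimately show ?thesis by simp
qed

definition ceil_fun :: "nat \<Rightarrow> nat \<Rightarrow> real \<Rightarrow> real" where
  "ceil_fun n j = pull j n (\<lambda>_. ceil_sum (n + j))"

lemma admissible_ceil_sum: "admissible m (\<lambda>_. ceil_sum k)"
  using ceil_sum_nonneg[of k] by (intro admissible_const) simp

lemma admissible_ceil: "admissible n (ceil_fun n j)"
  unfolding ceil_fun_def by (intro admissible_pull admissible_ceil_sum)

lemma continuous_ceil: "continuous_on UNIV (ceil_fun n j)"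
  unfolding ceil_fun_def by (intro continuous_pull admissible_ceil_sum) auto

lemma ceil_Suc: "ceil_fun n (Suc j) = lift n (ceil_fun (Suc n) j)"
  by (simp add: ceil_fun_def)

lemma lift_ceil_sum: "lift n (\<lambda>_. ceil_sum (Suc n)) x \<le> ceil_sum n"
  unfolding lift_def ceil_sum_rec[of n]
  using hgt_bounds(1)[OF r_pos r_le, of "ceil_sum (Suc n)" n "nxt n x"] ceil_sum_nonneg[of "Suc n"] by simp

lemma ceil_antimono: "i \<le> j \<Longrightarrow> ceil_fun n j x \<le> ceil_fun n i x"
proof (rule lift_Suc_antimono_le[of "\<lambda>j. ceil_fun n j x"])
  fix j
  have "pull j n (lift (n + j) (\<lambda>_. ceil_sum (Suc (n + j)))) x \<le> pull j n (\<lambda>_. ceil_sum (n + j)) x"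
    by (intro pull_mono admissible_lift admissible_ceil_sum lift_ceil_sum)
  moreover have "pull j n (lift (n + j) (\<lambda>_. ceil_sum (Suc (n + j)))) = ceil_fun n (Suc j)"
    using pull_add[of j 1 n "\<lambda>_. ceil_sum (Suc (n + j))"] by (simp add: ceil_fun_def)
  ultimately show "ceil_fun n (Suc j) x \<le> ceil_fun n j x" by (simp add: ceil_fun_def)
qed

lemma floor_le_ceil: "floor_fun n i x \<le> ceil_fun n j x"
proof -
  have "floor_fun n (max i j) x \<le> ceil_fun n (max i j) x"
    unfolding floor_fun_def ceil_fun_def using ceil_sum_nonneg[of "n + max i j"]
    by (intro pull_mono admissible_const) auto
  with floor_mono[of i "max i j" n x] ceil_antimono[of j "max i j" n x] show ?thesis by simp
qed

text \<open>\<open>base 0\<close> is \<open>b\<close> and \<open>peak 0\<close> is \<open>p\<close>;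
  both are real-valued because every floor lies below every ceiling.\<close>

definition base :: "nat \<Rightarrow> real \<Rightarrow> real" where
  "base n x = (SUP j. floor_fun n j x)"

definition peak :: "nat \<Rightarrow> real \<Rightarrow> real" where
  "peak n x = (INF j. ceil_fun n j x)"

lemma bdd_floor: "bdd_above (range (\<lambda>j. floor_fun n j x))"
  using floor_le_ceil[of n _ x 0] by (intro bdd_aboveI2)

lemma bdd_ceil: "bdd_below (range (\<lambda>j. ceil_fun n j x))"
  using floor_le_ceil[of n 0 x] by (intro bdd_belowI2)

lemma peak_le_ceil: "peak n x \<le> ceil_fun n j x"
  unfolding peak_def by (intro cINF_lower bdd_ceil) auto

lemma floor_tendsto: "(\<lambda>j. floor_fun n j x) \<longlonglongrightarrow> base n x"
  unfolding base_def by (intro LIMSEQ_incseq_SUP bdd_floor) (auto simp: incseq_def floor_mono)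

lemma ceil_tendsto: "(\<lambda>j. ceil_fun n j x) \<longlonglongrightarrow> peak n x"
  unfolding peak_def by (intro LIMSEQ_decseq_INF bdd_ceil) (auto simp: decseq_def ceil_antimono)

lemma base_le_peak: "base n x \<le> peak n x"
  unfolding base_def peak_def by (intro cSUP_least cINF_greatest floor_le_ceil) auto

lemma admissible_base: "admissible n (base n)"
  by (rule admissible_tendsto[OF admissible_floor floor_tendsto])

lemma admissible_peak: "admissible n (peak n)"
  by (rule admissible_tendsto[OF admissible_ceil ceil_tendsto])

lemma base_rec: "base n = lift n (base (Suc n))"
proof
  fix x
  have "(\<lambda>j. floor_fun n (Suc j) x) \<longlonglongrightarrow> lift n (base (Suc n)) x"
    unfolding floor_Suc
    by (intro lift_tendsto admissible_floor floor_tendsto admissibleD(1)[OF admissible_base])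
  with LIMSEQ_Suc[OF floor_tendsto[of n x]] show "base n x = lift n (base (Suc n)) x"
    by (rule LIMSEQ_unique)
qed

lemma peak_rec: "peak n = lift n (peak (Suc n))"
proof
  fix x
  have "(\<lambda>j. ceil_fun n (Suc j) x) \<longlonglongrightarrow> lift n (peak (Suc n)) x"
    unfolding ceil_Suc
    by (intro lift_tendsto admissible_ceil ceil_tendsto admissibleD(1)[OF admissible_peak])
  with LIMSEQ_Suc[OF ceil_tendsto[of n x]] show "peak n x = lift n (peak (Suc n)) x"
    by (rule LIMSEQ_unique)
qed

lemma base_pull: "base n = pull k n (base (n + k))"
proof (induction k arbitrary: n)
  case (Suc k)
  show ?case unfolding pull.simps add_Suc_right
    using base_rec[of n] Suc[of "Suc n"] by (simp only: add_Suc)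
qed simp

lemma peak_pull: "peak n = pull k n (peak (n + k))"
proof (induction k arbitrary: n)
  case (Suc k)
  show ?case unfolding pull.simps add_Suc_right
    using peak_rec[of n] Suc[of "Suc n"] by (simp only: add_Suc)
qed simp

lemma shift_bound_base: "shift_bound (base n) (r n) 1"
  by (rule shift_bound_tendsto[OF _ floor_tendsto]) (auto simp: shift_bound_def shift_bound_floor)

lemma shift_bound_peak: "shift_bound (peak n) (r n) 1"
  by (rule shift_bound_tendsto[OF _ ceil_tendsto])
     (unfold ceil_fun_def, intro shift_bound_pull admissible_ceil_sum shift_bound_const)

lemma peak_le_max: "peak n x \<le> max (peak n 0) (base n x) + 13/2"
proof (rule LIMSEQ_le)
  show "(\<lambda>j. ceil_fun n j x) \<longlonglongrightarrow> peak n x" by (rule ceil_tendsto)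
  show "(\<lambda>j. max (ceil_fun n j 0) (floor_fun n j x) + 13/2) \<longlonglongrightarrow> max (peak n 0) (base n x) + 13/2"
    by (intro tendsto_intros tendsto_max ceil_tendsto floor_tendsto)
  show "\<exists>N. \<forall>j\<ge>N. ceil_fun n j x \<le> max (ceil_fun n j 0) (floor_fun n j x) + 13/2"
    unfolding ceil_fun_def floor_fun_def
    by (intro exI allI impI pull_le_max admissible_ceil_sum admissible_const) auto
qed

lemma peak_ge_origin: "peak n 0 - 1/2 \<le> peak n x"
proof (rule LIMSEQ_le)
  show "(\<lambda>j. ceil_fun n j 0 - 1/2) \<longlonglongrightarrow> peak n 0 - 1/2" by (intro tendsto_intros ceil_tendsto)
  show "(\<lambda>j. ceil_fun n j x) \<longlonglongrightarrow> peak n x" by (rule ceil_tendsto)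
  show "\<exists>N. \<forall>j\<ge>N. ceil_fun n j 0 - 1/2 \<le> ceil_fun n j x"
    unfolding ceil_fun_def by (intro exI allI impI pull_ge_origin admissible_ceil_sum) auto
qed

text \<open>The peak at a point exceeds the peak at the origin only by what the base contributes, so the
  truncated ceilings are close to the peak as soon as they are close at the origin.\<close>
lemma ceil_near_peak: "\<exists>k. \<forall>x. ceil_fun m k x \<le> peak m x + 9"
proof -
  have "\<forall>\<^sub>F k in sequentially. ceil_fun m k 0 < peak m 0 + 1"
    by (rule order_tendstoD(2)[OF ceil_tendsto]) simp
  then obtain k where k: "ceil_fun m k 0 < peak m 0 + 1" by (auto simp: eventually_sequentially)
  \<comment> \<open>A constant below the peak of level \<open>m + k\<close> and within 1/2 of its
    value at the origin; \<open>pull_ge_origin\<close> applies to it at once.\<close>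
  define c where "c = max (-1) (peak (m + k) 0 - 1/2)"
  have ac: "admissible (m + k) (\<lambda>_. c)" unfolding c_def by (intro admissible_const) simp
  have am: "admissible (m + k) (\<lambda>_. -1)" by (intro admissible_const) simp
  have c_le: "c \<le> peak (m + k) y" for y
    unfolding c_def using peak_ge_origin[of "m + k" y] admissibleD(1)[OF admissible_peak] by simp
  have "ceil_fun m k x \<le> peak m x + 9" for x
  proof -
    have "pull k m (\<lambda>_. c) x \<le> pull k m (peak (m + k)) x" by (intro pull_mono ac c_le)
    then have 1: "pull k m (\<lambda>_. c) x \<le> peak m x" by (simp flip: peak_pull)
    have "pull k m (\<lambda>_. -1) x \<le> pull k m (\<lambda>_. c) x" by (intro pull_mono am) (simp add: c_def)
    then have 2: "floor_fun m k x \<le> pull k m (\<lambda>_. c) x" by (simp add: floor_fun_def)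
    have 3: "pull k m (\<lambda>_. c) 0 - 1/2 \<le> pull k m (\<lambda>_. c) x" by (intro pull_ge_origin ac) simp
    have "\<bar>pull k m (\<lambda>_. c) 0 - pull k m (peak (m + k)) 0\<bar> \<le> \<bar>c - peak (m + k) 0\<bar>"
      using pull_origin_contraction[OF ac admissible_peak] by simp
    also have "\<dots> \<le> 1/2" using c_le[of 0] unfolding c_def by (auto simp: max_def)
    finally have "\<bar>pull k m (\<lambda>_. c) 0 - peak m 0\<bar> \<le> 1/2" by (simp flip: peak_pull)
    then have 4: "peak m 0 - 1/2 \<le> pull k m (\<lambda>_. c) 0" by linarith
    have 5: "ceil_fun m k x \<le> max (ceil_fun m k 0) (floor_fun m k x) + 13/2"
      unfolding ceil_fun_def floor_fun_def by (intro pull_le_max admissible_ceil_sum am) auto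
    \<comment> \<open>13/2 from fact 5, 1 from the choice of \<open>k\<close>, 1/2 each from facts 3
      and 4: 17/2 in all.\<close>
    show ?thesis using 1 2 3 4 5 k by (auto simp: max_def split: if_splits)
  qed
  then show ?thesis by blast
qed

text \<open>How many further levels a ceiling of level \<open>m\<close> needs to come within 9 of
  the peak is not controlled, but the error 9 does not depend on \<open>m\<close> and is contracted
  to 9 * (5/6)^m at level 0. So the peak is a uniform limit.\<close>

lemma continuous_peak: "continuous_on UNIV (peak 0)"
proof -
  obtain k where k: "\<And>m x. ceil_fun m (k m) x \<le> peak m x + 9" using ceil_near_peak by metis
  define h where "h m = ceil_fun 0 (m + k m)" for m
  have h: "\<bar>h m x - peak 0 x\<bar> \<le> (5/6) ^ m * 9" for m x
  proof -
    have "h m = pull m 0 (ceil_fun m (k m))"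
      unfolding h_def ceil_fun_def using pull_add[of m "k m" 0] by simp
    moreover have "peak 0 = pull m 0 (peak m)" using peak_pull[of 0 m] by simp
    moreover have "\<bar>ceil_fun m (k m) y - peak m y\<bar> \<le> 9" for y
      using k[of m y] peak_le_ceil[of m y "k m"] by simp
    ultimately show ?thesis
      by (simp only:) (intro pull_contraction; simp add: admissible_ceil admissible_peak)
  qed
  have lim: "(\<lambda>m. (5/6) ^ m * 9) \<longlonglongrightarrow> (0::real)"
    using tendsto_mult_left_zero[OF LIMSEQ_power_zero[of "5/6::real"], of 9] by simp
  show ?thesis
  proof (rule uniform_limit_theorem[OF always_eventually])
    show "\<forall>m. continuous_on UNIV (h m)" unfolding h_def by (simp add: continuous_ceil)
    show "uniform_limit UNIV h (peak 0) sequentially"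
    proof (rule uniform_limitI)
      fix \<epsilon> :: real assume "0 < \<epsilon>"
      from order_tendstoD(2)[OF lim this]
      show "\<forall>\<^sub>F m in sequentially. \<forall>x\<in>UNIV. dist (h m x) (peak 0 x) < \<epsilon>"
        by (rule eventually_mono) (use h in \<open>auto simp: dist_real_def intro: le_less_trans\<close>)
    qed
  qed simp
qed

lemma base_origin_le: "base n 0 \<le> 0"
  by (rule LIMSEQ_le_const2[OF floor_tendsto]) (auto simp: floor_origin)

text \<open>\<open>peak_le_max\<close> and the lower bound -1 of the base turn the bound at the
  origin into a gap of at most \<open>\<bar>C\<bar> + 8\<close> everywhere and at all levels; a
  bounded gap does not survive the contraction.\<close>

lemma base_eq_peak_if_origin_bounded:
  assumes "\<And>n. peak n 0 \<le> C"
  shows "base 0 x = peak 0 x"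
proof -
  have "\<bar>peak n y - base n y\<bar> \<le> \<bar>C\<bar> + 8" for n y
    using peak_le_max[of n y] assms[of n] base_le_peak[of n y] admissibleD(1)[OF admissible_base, of n y]
    by (auto simp: max_def split: if_splits)
  then have "\<bar>pull k 0 (peak k) x - pull k 0 (base k) x\<bar> \<le> (5/6) ^ k * (\<bar>C\<bar> + 8)" for k
    by (intro pull_contraction) (auto intro: admissible_peak admissible_base)
  then have *: "\<bar>peak 0 x - base 0 x\<bar> \<le> (5/6) ^ k * (\<bar>C\<bar> + 8)" for k
    using peak_pull[of 0 k] base_pull[of 0 k] by simp
  have "(\<lambda>k. (5/6) ^ k * (\<bar>C\<bar> + 8)) \<longlonglongrightarrow> 0"
    using tendsto_mult_left_zero[OF LIMSEQ_power_zero[of "5/6::real"]] by simp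
  then have "\<bar>peak 0 x - base 0 x\<bar> \<le> 0" by (rule LIMSEQ_le_const) (use * in auto)
  then show ?thesis by simp
qed

text \<open>Strict monotonicity of the height map carries equality at the origin from each level to
  the next, and the base there is at most 0.\<close>

lemma peak_origin_le:
  assumes "base 0 0 = peak 0 0" shows "peak n 0 \<le> 0"
proof -
  have "base n 0 = peak n 0"
  proof (induction n)
    case (Suc n)
    have "hgt (r n) 0 (base (Suc n) 0) = hgt (r n) 0 (peak (Suc n) 0)"
      using Suc base_rec[of n] peak_rec[of n] by (simp add: lift_def)
    then show ?case
      using hgt_strict_mono[OF r_pos admissibleD(1)[OF admissible_base], of "Suc n" 0 "peak (Suc n) 0" n 0]
        base_le_peak[of "Suc n" 0] by (cases "base (Suc n) 0 < peak (Suc n) 0") auto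
  qed (rule assms)
  then show ?thesis using base_origin_le[of n] by simp
qed

lemma lift_base_eq_iff: "lift n (base (Suc n)) x = lift n (peak (Suc n)) x \<longleftrightarrow> base (Suc n) (nxt n x) = peak (Suc n) (nxt n x)"
proof -
  have "lift n (base (Suc n)) x < lift n (peak (Suc n)) x" if "base (Suc n) (nxt n x) < peak (Suc n) (nxt n x)"
    unfolding lift_def using that by (intro hgt_strict_mono r_pos admissibleD(1)[OF admissible_base])
  then show ?thesis
    using base_le_peak[of "Suc n" "nxt n x"] by (cases "base (Suc n) (nxt n x) = peak (Suc n) (nxt n x)")
      (auto simp: lift_def)
qed

text \<open>On a centred orbit the gap contracts by \<open>r n\<close> instead of 5/6. Seen from
  level 0 the initial gap is then essentially a tail of a convergent sum, however large it is at its
  own level.\<close>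

lemma base_peak_centre: "\<exists>x. base 0 x = peak 0 x"
proof -
  obtain x where x: "\<And>n. cos (pi * r n * (1 + 2 * orbit x (Suc n))) \<le> 0"
    using exists_centred_orbit by blast
  have *: "ceil_fun n k (orbit x n) - floor_fun n k (orbit x n) \<le> rprod n k * (ceil_sum (n + k) + 1)" for n k
  proof (induction k arbitrary: n)
    case (Suc k)
    let ?y = "orbit x (Suc n)"
    have "ceil_fun n (Suc k) (orbit x n) - floor_fun n (Suc k) (orbit x n)
        = hgt (r n) ?y (ceil_fun (Suc n) k ?y) - hgt (r n) ?y (floor_fun (Suc n) k ?y)"
      by (simp add: ceil_Suc floor_Suc lift_def)
    also have "\<dots> \<le> r n * (ceil_fun (Suc n) k ?y - floor_fun (Suc n) k ?y)"
      by (intro hgt_contraction_centre r_pos x floor_le_ceil admissibleD(1)[OF admissible_floor])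
    also have "\<dots> \<le> r n * (rprod (Suc n) k * (ceil_sum (Suc n + k) + 1))"
      using Suc.IH[of "Suc n"] less_imp_le[OF r_pos] by (intro mult_left_mono)
    finally show ?case by (simp add: rprod_Suc mult.assoc)
  qed (simp add: ceil_fun_def floor_fun_def)
  have "peak 0 x - base 0 x \<le> 0 + 0"
  proof (rule LIMSEQ_le)
    show "(\<lambda>k. ceil_fun 0 k x - floor_fun 0 k x) \<longlonglongrightarrow> peak 0 x - base 0 x"
      by (intro tendsto_intros ceil_tendsto floor_tendsto)
    show "(\<lambda>k. rprod 0 k * ceil_sum k + rprod 0 k) \<longlonglongrightarrow> 0 + 0"
      by (intro tendsto_add rprod_ceil_sum summable_LIMSEQ_zero summable_rprod)
    show "\<exists>N. \<forall>k\<ge>N. ceil_fun 0 k x - floor_fun 0 k x \<le> rprod 0 k * ceil_sum k + rprod 0 k"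
      using *[of 0] by (auto simp: distrib_left)
  qed
  then show ?thesis using base_le_peak[of 0 x] by (intro exI[of _ x]) simp
qed

end

context nearest_cf_brjuno
begin

text \<open>Either the translation stays inside the fundamental interval at some level, and then the two gaps
  vanish together, or it wraps at every level, and then the gap is contracted infinitely often.\<close>
lemma gap_shift_aux:
  assumes "base n x = peak n x" "\<bar>s\<bar> = 1"
  shows "peak n (x + s * r n) - base n (x + s * r n) \<le> 2 * (5/6) ^ k"
  using assms
proof (induction k arbitrary: n x s)
  case 0
  \<comment> \<open>Base and peak agree at \<open>x\<close> and change by at most 1 each: hence the
    2.\<close>
  have "\<bar>g (x + s * r n) - g x\<bar> \<le> 1" if "shift_bound g (r n) 1" for g
  proof -
    have "s = 1 \<or> s = -1" using 0 by auto
    then show ?thesis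
      using that[unfolded shift_bound_def, rule_format, of x]
        that[unfolded shift_bound_def, rule_format, of "x - r n"] by auto
  qed
  from this[OF shift_bound_base] this[OF shift_bound_peak] show ?case using 0 by simp
next
  case (Suc k)
  define w where "w = nxt n x"
  define \<sigma> where "\<sigma> = - e n * s"
  have s: "\<sigma> = 1 \<or> \<sigma> = -1" using Suc.prems(2) e_cases[of n] unfolding \<sigma>_def by auto
  have w: "0 \<le> w" "w < 1 / r n" "- e n * x - r n * w \<in> \<int>"
    unfolding w_def using nxt_bounds[of n x] by (auto simp: frac_def)
  have eq: "base (Suc n) w = peak (Suc n) w"
    using Suc.prems(1) lift_base_eq_iff[of n x] by (simp add: w_def flip: base_rec peak_rec)
  have step: "peak n (x + s * r n) - base n (x + s * r n) \<le> 2 * (5/6) ^ Suc k"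
    if w': "0 \<le> w'" "w' \<le> 1 / r n" "- e n * (x + s * r n) - r n * w' \<in> \<int>"
      and gap: "peak (Suc n) w' - base (Suc n) w' \<le> 2 * (5/6) ^ k" for w'
  proof -
    have "peak n (x + s * r n) - base n (x + s * r n)
        = hgt (r n) w' (peak (Suc n) w') - hgt (r n) w' (base (Suc n) w')"
      unfolding base_rec[of n] peak_rec[of n]
      using lift_eq[OF admissible_base w'] lift_eq[OF admissible_peak w'] by simp
    also have "\<dots> \<le> 5/6 * (peak (Suc n) w' - base (Suc n) w')"
      by (intro hgt_contraction r_pos r_le base_le_peak admissibleD(1)[OF admissible_base])
    also have "\<dots> \<le> 2 * (5/6) ^ Suc k" using gap by simp
    finally show ?thesis .
  qed
  have int: "- e n * (x + s * r n) - r n * (w + \<sigma>) \<in> \<int>"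
    using w(3) by (simp add: \<sigma>_def algebra_simps)
  show ?case
  proof (cases "0 \<le> w + \<sigma> \<and> w + \<sigma> \<le> 1 / r n")
    case True
    \<comment> \<open>Inside the interval the translation at the next level is by a period, so the
      gap remains 0.\<close>
    have "w + \<sigma> - w \<in> \<int>" using s by auto
    then have "peak (Suc n) (w + \<sigma>) = peak (Suc n) w" "base (Suc n) (w + \<sigma>) = base (Suc n) w"
      by (auto intro: admissibleD(2)[OF admissible_peak] admissibleD(2)[OF admissible_base])
    with True int eq show ?thesis by (intro step[of "w + \<sigma>"]) auto
  next
    case False
    define w' where "w' = w + \<sigma> - \<sigma> * (1 / r n)"
    have w': "0 \<le> w'" "w' \<le> 1 / r n" using False w s inv_r_gt[of n] unfolding w'_def by auto
    have "- e n * (x + s * r n) - r n * w' = (- e n * (x + s * r n) - r n * (w + \<sigma>)) + \<sigma>"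
      unfolding w'_def using r_nz[of n] by (simp add: algebra_simps)
    moreover have "\<sigma> \<in> \<int>" using s by auto
    ultimately have "- e n * (x + s * r n) - r n * w' \<in> \<int>" by (simp only: Ints_add[OF int])
    moreover have "peak (Suc n) w' - base (Suc n) w' \<le> 2 * (5/6) ^ k"
    proof -
      \<comment> \<open>Wrapping subtracts \<open>\<sigma> / r n\<close>, which modulo 1 is a
        translation by the rotation number of the next level, with sign \<open>s'\<close>; so the
        induction hypothesis applies.\<close>
      define s' where "s' = - \<sigma> * e (Suc n)"
      have "w' - (w + s' * r (Suc n)) = \<sigma> - \<sigma> * (1 / r n - e (Suc n) * r (Suc n))"
        unfolding w'_def s'_def by (simp add: algebra_simps)
      moreover have "\<sigma> \<in> \<int>" using s by auto
      ultimately have "w' - (w + s' * r (Suc n)) \<in> \<int>"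
        using Ints_diff[OF _ Ints_mult[OF _ r_step[of n]]] by (simp only:)
      then have "peak (Suc n) w' = peak (Suc n) (w + s' * r (Suc n))"
        "base (Suc n) w' = base (Suc n) (w + s' * r (Suc n))"
        by (auto intro: admissibleD(2)[OF admissible_peak] admissibleD(2)[OF admissible_base])
      moreover have "\<bar>s'\<bar> = 1" using s e_cases[of "Suc n"] unfolding s'_def by auto
      ultimately show ?thesis using Suc.IH[OF eq] by simp
    qed
    ultimately show ?thesis by (rule step[OF w'])
  qed
qed

lemma base_eq_peak_shift: "base 0 (x + r 0) = peak 0 (x + r 0) \<longleftrightarrow> base 0 x = peak 0 x"
proof -
  have *: "base 0 (y + s * r 0) = peak 0 (y + s * r 0)" if "base 0 y = peak 0 y" "\<bar>s\<bar> = 1" for y s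
  proof -
    have "(\<lambda>k. 2 * (5/6) ^ k) \<longlonglongrightarrow> (0::real)"
      using tendsto_mult_right_zero[OF LIMSEQ_power_zero[of "5/6::real"], of 2] by simp
    then have "peak 0 (y + s * r 0) - base 0 (y + s * r 0) \<le> 0"
      by (rule LIMSEQ_le_const) (use gap_shift_aux[OF that] in blast)
    then show ?thesis using base_le_peak[of 0 "y + s * r 0"] by simp
  qed
  show ?thesis using *[of x 1] *[of "x + r 0" "-1"] by auto
qed

section \<open>Ceilings at the origin\<close>

lemma ceil_origin_Suc: "ceil_fun n (Suc j) 0 = hgt (r n) 0 (ceil_fun (Suc n) j 0)"
  by (simp add: ceil_Suc lift_def)

lemma ceil_origin_0: "ceil_fun n 0 x = ceil_sum n"
  by (simp add: ceil_fun_def)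

text \<open>The difference is \<open>8 * pi\<close> times the sum of the weights, which is at most
  2; 64 comes from \<open>pi < 4\<close>.\<close>

lemma ceil_sum_approx: "\<bar>2 * pi * ceil_sum n - suminf (brjuno_term n)\<bar> \<le> 64"
proof -
  have "ceil_sum n = (\<Sum>k. brjuno_term n k / (2 * pi) + rprod n k * 4)"
    unfolding ceil_sum_def ceil_term_def by (simp add: distrib_left)
  also have "\<dots> = suminf (brjuno_term n) / (2 * pi) + suminf (rprod n) * 4"
    using suminf_add[OF summable_divide[OF summable_brjuno] summable_mult2[OF summable_rprod], of n "2*pi" n 4]
    by (simp add: suminf_divide[OF summable_brjuno] suminf_mult2[OF summable_rprod])
  finally have "2 * pi * ceil_sum n - suminf (brjuno_term n) = pi * (8 * suminf (rprod n))"
    by (simp add: field_simps)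
  moreover have "suminf (rprod n) \<le> 2"
    by (intro suminf_le_const summable_rprod sum_rprod_le)
  moreover have "0 \<le> suminf (rprod n)"
    by (intro suminf_nonneg summable_rprod less_imp_le[OF rprod_pos])
  ultimately show ?thesis
    using mult_mono[of pi 4 "8 * suminf (rprod n)" 16] pi_less_4 by simp
qed

lemma peak_origin_bounded_iff: "(\<exists>C. \<forall>n. peak n 0 \<le> C) \<longleftrightarrow> (\<forall>x. base 0 x = peak 0 x)"
  using base_eq_peak_if_origin_bounded peak_origin_le by blast

end

text \<open>The inverse of \<open>h\<^sub>r\<close> on \<open>[1, \<infinity>)\<close>, extended by \<open>0\<close> to smaller arguments.\<close>
definition herman_inv :: "real \<Rightarrow> real \<Rightarrow> real" where
  "herman_inv r t = (if max t 1 \<le> 1 / r then ln (max t 1) else r * max t 1 + ln (1 / r) - 1)"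

section \<open>Inverses of the Herman maps\<close>

lemma herman_inv_nonneg:
  assumes "0 < r" "r < 1" shows "0 \<le> herman_inv r t"
proof (cases "max t 1 \<le> 1 / r")
  case False
  then have "1 / r < max t 1" by (simp only: not_le)
  then have "1 \<le> r * max t 1" using assms by (simp only: pos_divide_less_eq mult.commute less_imp_le)
  moreover have "0 \<le> ln (1 / r)" using assms by simp
  ultimately have "0 \<le> r * max t 1 + ln (1 / r) - 1" by linarith
  then show ?thesis using False unfolding herman_inv_def by (simp only: if_False)
qed (auto simp: herman_inv_def)

text \<open>A gain of at least 1 per step: bounded errors can be absorbed by starting a bounded
  number of steps earlier.\<close>

lemma herman_h_ge: 
  assumes "0 < r" "r < 1" "0 \<le> y" shows "y + 1 \<le> herman_h r y"
proof (cases "ln (1 / r) \<le> y")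
  case True
  have "1 + ln (1 / r) \<le> 1 / r" using exp_ge_add_one_self[of "ln (1 / r)"] assms by simp
  moreover have "y - ln (1 / r) \<le> (1 / r) * (y - ln (1 / r))"
    using mult_right_mono[of 1 "1 / r" "y - ln (1 / r)"] assms True by simp
  ultimately have "y + 1 \<le> (1 / r) * (y - ln (1 / r)) + 1 / r" by linarith
  also have "\<dots> = (1 / r) * (y - ln (1 / r) + 1)" by (simp only: distrib_left mult_1_right)
  finally show ?thesis using True by (simp add: herman_h_def)
next
  case False
  then show ?thesis using exp_ge_add_one_self[of y] by (simp add: herman_h_def add.commute)
qed

text \<open>A Galois connection, which turns iterates of \<open>h\<close> into nested inverses. For
  \<open>y \<ge> 0\<close> the values of \<open>h\<close> are at least 1, which justifies the
  cut-off \<open>max t 1\<close>.\<close>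

lemma herman_h_ge_iff:
  assumes "0 < r" "r < 1" "0 \<le> y" shows "t \<le> herman_h r y \<longleftrightarrow> herman_inv r t \<le> y"
proof (cases "max t 1 \<le> 1 / r")
  case small: True
  have inv: "herman_inv r t = ln (max t 1)" using small by (simp add: herman_inv_def)
  have ly: "(ln (max t 1) \<le> y) = (max t 1 \<le> exp y)"
    by (metis exp_le_cancel_iff exp_ln less_le_trans max.cobounded2 zero_less_one)
  show ?thesis
  proof (cases "ln (1 / r) \<le> y")
    case True
    have "1 / r \<le> herman_h r y" using True assms by (simp add: herman_h_def divide_right_mono)
    moreover have "ln (max t 1) \<le> ln (1 / r)" using small by (intro ln_mono) auto
    ultimately show ?thesis using small True inv by simp
  next
    case False
    then show ?thesis using assms inv ly by (simp add: herman_h_def)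
  qed
next
  case large: False
  have "1 < 1 / r" using assms by simp
  with large have t: "1 / r < t" "max t 1 = t" by auto
  have rt: "1 < r * t" using t assms by (simp add: field_simps)
  have inv: "herman_inv r t = r * t + ln (1 / r) - 1" using large t by (simp add: herman_inv_def)
  show ?thesis
  proof (cases "ln (1 / r) \<le> y")
    case True
    have "(t \<le> (1 / r) * (y - ln (1 / r) + 1)) = (r * t \<le> y - ln (1 / r) + 1)"
      using assms by (simp add: pos_le_divide_eq mult.commute)
    then show ?thesis using True inv by (auto simp: herman_h_def)
  next
    case False
    then have "exp y < exp (ln (1 / r))" by (subst exp_less_cancel_iff) simp
    then have "exp y < 1 / r" using assms by simp
    then show ?thesis using False t rt inv by (simp add: herman_h_def)
  qed
qed

text \<open>Meant for the first of two merged Gauss steps, whose remainder \<open>q\<close> exceeds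
  1/2: that step is almost the identity when \<open>q\<close> is near 1.\<close>

lemma herman_inv_near_id:
  assumes "1/2 \<le> q" "q < 1" "0 \<le> v" shows "\<bar>herman_inv q v - v\<bar> \<le> (1 - q) * v + 2"
proof -
  have q: "1 \<le> 1 / q" "1 / q \<le> 2" using assms by (auto simp: field_simps)
  have pos: "0 \<le> (1 - q) * v" using assms by simp
  show ?thesis
  proof (cases "max v 1 \<le> 1 / q")
    case True
    define L where "L = ln (max v 1)"
    have "0 \<le> L" "L \<le> max v 1 - 1" unfolding L_def by (auto intro: ln_le_minus_one)
    moreover have "herman_inv q v = L" using True by (simp add: herman_inv_def L_def)
    ultimately have "\<bar>herman_inv q v - v\<bar> \<le> 2" using True q assms by (auto simp: max_def split: if_splits)
    then show ?thesis using pos by linarith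
  next
    case False
    then have v: "max v 1 = v" using q by auto
    define m where "m = ln (1 / q)"
    have "0 \<le> m" unfolding m_def using q by simp
    moreover have "m \<le> 1 / q - 1" unfolding m_def using assms by (intro ln_le_minus_one) auto
    moreover have "herman_inv q v - v = m - 1 - (1 - q) * v"
      using False v by (simp add: herman_inv_def m_def algebra_simps)
    ultimately show ?thesis using pos q by (simp add: abs_le_iff)
  qed
qed

lemma mult_ln_inverse_le:
  fixes s :: real
  assumes "0 < s" "s < 1" shows "0 < ln (1 / s)" "s * ln (1 / s) \<le> 1"
proof -
  show "0 < ln (1 / s)" using assms by (intro ln_gt_zero) simp
  have "ln (1 / s) \<le> 1 / s" using ln_le_minus_one[of "1 / s"] assms by simp
  then have "s * ln (1 / s) \<le> s * (1 / s)" using assms by (intro mult_left_mono) auto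
  then show "s * ln (1 / s) \<le> 1" using assms by simp
qed

text \<open>The dangerous term is \<open>(1 - q) * ln (1 / s)\<close>; it equals
  \<open>q * (s * ln (1 / s))\<close> and is at most 1. The cases are the positions of
  \<open>max t 1\<close> relative to the thresholds \<open>1 / s\<close> and
  \<open>1 / (q * s)\<close> of the two inverses.\<close>

lemma herman_inv_two_steps:
  assumes q: "1/2 \<le> q" "q < 1" and s: "0 < s" "s < 1" and qs: "q * s = 1 - q"
  shows "\<bar>herman_inv q (herman_inv s t) - herman_inv (q * s) t\<bar> \<le> 6"
proof -
  define v where "v = herman_inv s t"
  define l where "l = ln (1 / s)"
  define m where "m = ln (1 / q)"
  note sl = mult_ln_inverse_le[OF s]
  have v: "0 \<le> v" unfolding v_def using s by (rule herman_inv_nonneg)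
  have q2: "1 \<le> 1 / q" "1 / q \<le> 2" using q by (auto simp: field_simps)
  have m: "0 \<le> m" "m \<le> 1"
  proof -
    show "0 \<le> m" unfolding m_def using q2 by simp
    have "m \<le> 1 / q - 1" unfolding m_def using q by (intro ln_le_minus_one) auto
    with q2 show "m \<le> 1" by simp
  qed
  have "(1 - q) * l = q * (s * l)" by (simp flip: qs)
  also have "\<dots> \<le> 1 * 1" using q sl s unfolding l_def by (intro mult_mono) auto
  finally have ql: "(1 - q) * l \<le> 1" by simp
  have ql0: "0 \<le> (1 - q) * l" using q sl unfolding l_def by simp
  have inv_qs: "1 / (q * s) = (1 / q) * (1 / s)" by simp
  have "1 / s \<le> 1 / (q * s)" unfolding inv_qs using q2 s mult_right_mono[of 1 "1/q" "1/s"] by simp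
  have ln_qs: "ln (1 / (q * s)) = m + l"
    unfolding inv_qs m_def l_def using q s by (intro ln_mult_pos) auto
  consider (a) "max t 1 \<le> 1 / s" | (b) "1 / s < max t 1" "max t 1 \<le> 1 / (q * s)" | (c) "1 / (q * s) < max t 1"
    by linarith
  then show ?thesis
  proof cases
    case a
    have "v = ln (max t 1)" using a by (simp add: v_def herman_inv_def)
    moreover have "herman_inv (q * s) t = ln (max t 1)"
      using a \<open>1 / s \<le> 1 / (q * s)\<close> by (simp add: herman_inv_def)
    moreover have "ln (max t 1) \<le> l" unfolding l_def using a by (intro ln_mono) auto
    then have "(1 - q) * ln (max t 1) \<le> (1 - q) * l" using q by (intro mult_left_mono) auto
    ultimately show ?thesis using herman_inv_near_id[OF q v] ql unfolding v_def by simp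
  next
    case b
    have "1 < 1 / s" using s by simp
    with b have t: "max t 1 = t" "1 / s < t" by auto
    have veq: "v = s * t + l - 1" using b t by (simp add: v_def herman_inv_def l_def)
    have st: "1 < s * t" "s * t \<le> 2"
    proof -
      show "1 < s * t" using t s by (simp add: field_simps)
      have "s * t \<le> s * (1 / (q * s))" using b t s by (intro mult_left_mono) auto
      also have "\<dots> = 1 / q" using s by simp
      finally show "s * t \<le> 2" using q2 by simp
    qed
    have tpos: "0 < t" using t \<open>1 < 1 / s\<close> by linarith
    have lt: "l \<le> ln t" "ln t \<le> m + l"
      unfolding ln_qs[symmetric] unfolding l_def using t b s q tpos by (auto intro!: ln_mono)
    have "herman_inv (q * s) t = ln t" using b t by (simp add: herman_inv_def)
    moreover have "(1 - q) * v \<le> (1 - q) * (l + 1)" using q st veq by (intro mult_left_mono) auto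
    then have "(1 - q) * v \<le> 2" using ql q by (simp add: distrib_left)
    ultimately show ?thesis using herman_inv_near_id[OF q v] lt st veq m unfolding v_def by (simp add: abs_le_iff)
  next
    case c
    have "1 < 1 / s" using s by simp
    with c \<open>1 / s \<le> 1 / (q * s)\<close> have t: "max t 1 = t" "1 / s < t" by auto
    have veq: "v = s * t + l - 1" using t by (simp add: v_def herman_inv_def l_def)
    have tar: "herman_inv (q * s) t = q * s * t + (m + l) - 1"
      using c t by (simp add: herman_inv_def ln_qs)
    show ?thesis
    proof (cases "max v 1 \<le> 1 / q")
      case False
      then have "max v 1 = v" using q2 by auto
      then have "herman_inv q v = q * v + m - 1" using False by (simp add: herman_inv_def m_def)
      then have "herman_inv (q * s) t - herman_inv q v = (1 - q) * l + q"
        unfolding tar veq by (simp add: algebra_simps)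
      then show ?thesis using ql ql0 q unfolding v_def by (simp add: abs_minus_commute)
    next
      case True
      define L where "L = ln (max v 1)"
      have "herman_inv q v = L" using True by (simp add: herman_inv_def L_def)
      moreover have "0 \<le> L" "L \<le> max v 1 - 1" unfolding L_def by (auto intro: ln_le_minus_one)
      moreover have "max v 1 \<le> 2" using True q2 by simp
      moreover have "herman_inv (q * s) t = q * v + q + (1 - q) * l + m - 1"
        unfolding tar veq by (simp add: algebra_simps)
      moreover have "v \<le> 2" using True q2 by simp
      then have "q * v \<le> 1 * 2" using q v by (intro mult_mono) auto
      moreover have "0 \<le> q * v" using q v by simp
      ultimately show ?thesis using ql ql0 q m unfolding v_def[symmetric] by (simp add: abs_le_iff)
    qed
  qed
qed

lemma sinh_le_mult_exp: assumes "0 \<le> w" shows "sinh w \<le> w * exp (w::real)"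
proof -
  have "1 - 2 * w \<le> exp (- 2 * w)" using exp_ge_add_one_self[of "- 2 * w"] by simp
  then have "exp w * (1 - 2 * w) \<le> exp w * exp (- 2 * w)" by (intro mult_left_mono) auto
  also have "\<dots> = exp (- w)" by (simp flip: exp_add)
  finally show ?thesis by (simp add: sinh_field_def algebra_simps)
qed

text \<open>Heights are rescaled by \<open>2 * pi\<close>, and \<open>D\<close> is of order
  \<open>r\<^sup>2\<close>. For \<open>r * t \<le> 1\<close> the numerator \<open>N\<close> is of
  order \<open>U\<^sup>2\<close> with \<open>U = r * (3 * pi + t)\<close>, which leaves
  \<open>ln (max t 1)\<close>; for \<open>r * t > 1\<close> it is of order \<open>exp U\<close>,
  which leaves \<open>r * t + ln (1 / r)\<close>. These are the two branches of
  \<open>herman_inv\<close>.\<close>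

lemma hgt_origin_approx:
  assumes r: "0 < r" "r \<le> 1/2" and t: "0 \<le> t"
  shows "\<bar>2 * pi * hgt r 0 (t / (2 * pi)) - herman_inv r t\<bar> \<le> 17"
proof -
  define U where "U = 3 * pi * r + r * t"
  define N where "N = cosh U - cos (pi * r)"
  define D where "D = cosh (3 * pi * r) - cos (pi * r)"
  have Ueq: "pi * r * (3 + 2 * (t / (2 * pi))) = U" by (simp add: U_def field_simps)
  have U: "0 < U" "pi * r \<le> U" using r t unfolding U_def by (auto intro!: add_pos_nonneg add_increasing2)
  have tpi: "-1 \<le> t / (2 * pi)" using t by (simp add: order.trans[of _ 0])
  have e: "2 * pi * hgt r 0 (t / (2 * pi)) = r * t / 2 + (ln N - ln D) / 2"
    unfolding hgt_alt[OF r(1) tpi] Ueq N_def D_def by (simp add: field_simps)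
  have pr: "0 \<le> pi * r" "pi * r \<le> 2"
    using r mult_mono[of pi 4 r "1/2"] pi_less_4 by auto
  have "0 < r\<^sup>2" using r by simp
  note DD = cosh_minus_cos_asymp[OF r, folded D_def]
  have "ln (r\<^sup>2) \<le> ln D" by (rule ln_mono[OF DD(1) \<open>0 < r\<^sup>2\<close>])
  then have D1: "2 * ln r \<le> ln D" using r by (simp add: ln_realpow)
  have "ln D \<le> ln (exp 16 * r\<^sup>2)" using DD \<open>0 < r\<^sup>2\<close> by (intro ln_mono) linarith+
  then have D2: "ln D \<le> 16 + 2 * ln r" using r by (simp add: ln_mult ln_realpow)
  have ln_inv: "ln (1 / r) = - ln r" using r by (simp add: ln_div)
  have Npos: "0 < N" unfolding N_def using cosh_gt_cos[OF U(1)] by simp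
  have "cos (pi * r) \<le> 1" by simp
  note b = cosh_ge_quadratic[of U]
  have ln2: "ln 2 \<le> (1::real)" using ln_le_minus_one[of "2::real"] by simp
  show ?thesis
  proof (cases "r * t \<le> 1")
    case True
    define s where "s = max t 1"
    have s: "1 \<le> s" "t \<le> s" "r * s \<le> 1" using True r unfolding s_def by (auto simp: max_def)
    then have "s \<le> 1 / r" using r by (simp add: field_simps)
    then have inv: "herman_inv r t = ln s" by (simp add: herman_inv_def s_def)
    have U7: "U \<le> 7" unfolding U_def using True pr by linarith
    have "U\<^sup>2 / 2 \<le> N" unfolding N_def using b \<open>cos (pi * r) \<le> 1\<close> by linarith
    then have "ln (U\<^sup>2 / 2) \<le> ln N" using U by (intro ln_mono) auto
    then have N1: "2 * ln U - ln 2 \<le> ln N" using U by (simp add: ln_div ln_realpow)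
    have "(sinh (U/2))\<^sup>2 \<le> (U / 2 * exp (U / 2))\<^sup>2"
      using U sinh_le_mult_exp[of "U/2"] by (intro power_mono) auto
    also have "\<dots> = U\<^sup>2 / 4 * exp U" by (simp add: power_mult_distrib power_divide flip: exp_double)
    finally have sh: "(sinh (U/2))\<^sup>2 \<le> U\<^sup>2 / 4 * exp U" .
    have "\<bar>sin (pi * r / 2)\<bar> \<le> \<bar>pi * r / 2\<bar>" by (rule abs_sin_x_le_abs_x)
    also have "\<dots> \<le> U / 2" using U pr by simp
    finally have "\<bar>sin (pi * r / 2)\<bar>\<^sup>2 \<le> (U / 2)\<^sup>2" by (intro power_mono) auto
    then have "(sin (pi * r / 2))\<^sup>2 \<le> U\<^sup>2 / 4 * 1" by (simp add: power_divide)
    also have "\<dots> \<le> U\<^sup>2 / 4 * exp U" using U by (intro mult_left_mono) auto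
    finally have "N \<le> U\<^sup>2 * exp U" using sh unfolding N_def cosh_minus_cos[of U] by simp
    then have "ln N \<le> ln (U\<^sup>2 * exp U)" using Npos by (intro ln_mono)
    then have N2: "ln N \<le> 2 * ln U + U" using U by (simp add: ln_mult ln_realpow)
    have "U = r * (3 * pi + t)" by (simp add: U_def algebra_simps)
    moreover have p: "0 < 3 * pi + t" using t pi_gt_zero by linarith
    ultimately have lnU: "ln U = ln r + ln (3 * pi + t)" using r by (simp add: ln_mult)
    have "s \<le> 3 * pi + t" using t pi_gt3 unfolding s_def by auto
    then have L1: "ln s \<le> ln (3 * pi + t)" using s by (intro ln_mono) auto
    have "3 * pi + t \<le> 13 * s" using s pi_less_4 by linarith
    then have "ln (3 * pi + t) \<le> ln (13 * s)" using p by (intro ln_mono)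
    also have "\<dots> = ln 13 + ln s" using s by (simp add: ln_mult)
    also have "ln 13 \<le> (12::real)" using ln_le_minus_one[of "13::real"] by simp
    finally have L2: "ln (3 * pi + t) \<le> 12 + ln s" by simp
    have rt: "0 \<le> r * t" using r t by simp
    have gen: "\<bar>a / 2 + (n - d) / 2 - k\<bar> \<le> 17"
      if "0 \<le> a" "a \<le> 1" "2 * u - l \<le> n" "l \<le> 1" "n \<le> 2 * u + v" "v \<le> 7"
         "2 * z \<le> d" "d \<le> 16 + 2 * z" "u = z + p" "k \<le> p" "p \<le> 12 + k" for a n d k u v l z p :: real
      by (rule abs_leI) (use that in \<open>simp_all add: field_simps\<close>)
    show ?thesis unfolding e inv
      by (rule gen[OF rt True N1 ln2 N2 U7 D1 D2 lnU L1 L2])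
  next
    case False
    then have rt: "1 < r * t" by simp
    then have "1 / r < t" using r by (simp add: field_simps)
    moreover have "1 < 1 / r" using r by simp
    ultimately have "max t 1 = t" "\<not> t \<le> 1 / r" by auto
    then have inv: "herman_inv r t = r * t + ln (1 / r) - 1" by (simp add: herman_inv_def)
    have "1 \<le> U" unfolding U_def using rt pr by simp
    have "5/2 \<le> exp (1::real)" using exp_lower_Taylor_quadratic[of "1::real"] by simp
    also have "\<dots> \<le> exp U" using \<open>1 \<le> U\<close> by simp
    finally have "exp U / 16 \<le> exp U / 2 - 1" by simp
    also have "exp U / 2 \<le> cosh U" by (simp add: cosh_field_def)
    then have "exp U / 2 - 1 \<le> N" unfolding N_def using \<open>cos (pi * r) \<le> 1\<close> by linarith
    finally have "ln (exp U / 16) \<le> ln N" by (intro ln_mono) auto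
    then have N1: "U - ln 16 \<le> ln N" by (simp add: ln_div)
    have "1 \<le> exp U" using U by simp
    moreover have "cosh U \<le> exp U" using U cosh_plus_sinh[of U] sinh_real_nonneg_iff[of U] by linarith
    ultimately have "N \<le> 2 * exp U" unfolding N_def using cos_ge_minus_one[of "pi * r"] by linarith
    then have "ln N \<le> ln (2 * exp U)" using Npos by (intro ln_mono)
    then have N2: "ln N \<le> ln 2 + U" by (simp add: ln_mult)
    have ln16: "ln 16 \<le> (7::real)" using ln_realpow[of "2::real" 4] ln2 by simp
    have gen: "\<bar>a / 2 + (n - d) / 2 - (a + k - 1)\<bar> \<le> 17"
      if "u - c \<le> n" "c \<le> 7" "n \<le> l + u" "l \<le> 1" "u = 3 * p + a" "0 \<le> p" "p \<le> 2"
         "2 * z \<le> d" "d \<le> 16 + 2 * z" "k = - z" for a n d k u c l p z :: real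
      by (rule abs_leI) (use that in \<open>simp_all add: field_simps\<close>)
    have Ueq2: "U = 3 * (pi * r) + r * t" by (simp add: U_def)
    show ?thesis unfolding e inv
      by (rule gen[OF N1 ln16 N2 ln2 Ueq2 pr D1 D2 ln_inv])
  qed
qed

section \<open>Nearest-integer and Gauss continued fractions\<close>

lemma infdist_Ints_frac: "infdist (x::real) \<int> = min (frac x) (1 - frac x)"
proof -
  have "\<bar>x - of_int (round x)\<bar> \<le> \<bar>x - of_int \<lfloor>x\<rfloor>\<bar>" "\<bar>x - of_int (round x)\<bar> \<le> \<bar>x - of_int (\<lfloor>x\<rfloor> + 1)\<bar>"
    by (intro round_diff_minimal)+
  then have 1: "\<bar>x - of_int (round x)\<bar> \<le> min (frac x) (1 - frac x)"
    using frac_lt_1[of x] frac_ge_0[of x] by (auto simp: frac_def)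
  have "round x = \<lfloor>x\<rfloor> \<or> round x = \<lfloor>x\<rfloor> + 1"
    unfolding round_def by linarith
  then have 2: "min (frac x) (1 - frac x) \<le> \<bar>x - of_int (round x)\<bar>"
    using frac_lt_1[of x] frac_ge_0[of x] by (auto simp: frac_def)
  show ?thesis unfolding infdist_Ints_eq_round using 1 2 by (rule antisym)
qed

lemma irrational_frac: "x \<notin> \<rat> \<Longrightarrow> frac x \<notin> \<rat>"
  using Rats_add[of "frac x" "of_int \<lfloor>x\<rfloor>"] by (auto simp: frac_def)

lemma irrational_inverse: "x \<notin> \<rat> \<Longrightarrow> 1 / x \<notin> (\<rat> :: real set)"
  using Rats_divide[OF Rats_1, of "1 / x"] by auto

lemma gauss_alpha_irrational: "\<alpha> \<notin> \<rat> \<Longrightarrow> gauss_alpha \<alpha> n \<notin> \<rat>"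
proof (induction n)
  case (Suc n)
  then show ?case unfolding gauss_alpha.simps by (intro irrational_frac irrational_inverse)
qed (simp add: irrational_frac)

lemma gauss_alpha_bounds:
  assumes "\<alpha> \<notin> \<rat>" shows "0 < gauss_alpha \<alpha> n" "gauss_alpha \<alpha> n < 1"
proof -
  have "0 \<le> gauss_alpha \<alpha> n" "gauss_alpha \<alpha> n < 1" by (cases n; simp add: frac_lt_1)+
  moreover have "gauss_alpha \<alpha> n \<noteq> 0" using gauss_alpha_irrational[OF assms, of n] by auto
  ultimately show "0 < gauss_alpha \<alpha> n" "gauss_alpha \<alpha> n < 1" by simp_all
qed

lemma gauss_alpha_shift: "gauss_alpha (gauss_alpha \<alpha> m) i = gauss_alpha \<alpha> (m + i)"
proof (induction i)
  case 0 show ?case by (cases m) simp_all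
qed simp

text \<open>A nearest-integer step merges two steps of the Gauss map whenever the first remainder exceeds one half.\<close>
primrec gauss_index :: "real \<Rightarrow> nat \<Rightarrow> nat" where
  "gauss_index \<alpha> 0 = 0"
| "gauss_index \<alpha> (Suc n) = gauss_index \<alpha> n + (if gauss_alpha \<alpha> (gauss_index \<alpha> n) < 1/2 then 1 else 2)"

lemma gauss_index_ge: "n \<le> gauss_index \<alpha> n"
  by (induction n) auto

lemma gauss_index_mono: "m \<le> n \<Longrightarrow> gauss_index \<alpha> m \<le> gauss_index \<alpha> n"
  by (rule lift_Suc_mono_le[of "gauss_index \<alpha>"]) auto

text \<open>For a remainder x > 1/2 the partial quotient is 1 and the next remainder is 1/x - 1. Its
  reciprocal is 1/(1-x) - 1, and \<open>frac\<close> removes the integer.\<close>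

lemma gauss_alpha_large:
  assumes "\<alpha> \<notin> \<rat>" "1/2 \<le> gauss_alpha \<alpha> k"
  shows "gauss_alpha \<alpha> k * gauss_alpha \<alpha> (Suc k) = 1 - gauss_alpha \<alpha> k"
    "gauss_alpha \<alpha> (Suc (Suc k)) = frac (1 / (1 - gauss_alpha \<alpha> k))"
proof -
  define x where "x = gauss_alpha \<alpha> k"
  have "x \<noteq> 1/2"
    using gauss_alpha_irrational[OF assms(1), of k] unfolding x_def by (metis Rats_1 Rats_divide Rats_number_of)
  then have x: "1/2 < x" "x < 1"
    using assms(2) gauss_alpha_bounds[OF assms(1), of k] unfolding x_def by auto
  have "frac (1 / x) = 1 / x - 1"
    using x by (intro frac_unique_iff[THEN iffD2]) (auto simp: field_simps)
  then have s: "gauss_alpha \<alpha> (Suc k) = 1 / x - 1" by (simp add: x_def)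
  then show "gauss_alpha \<alpha> k * gauss_alpha \<alpha> (Suc k) = 1 - gauss_alpha \<alpha> k"
    using x by (simp add: x_def[symmetric] field_simps)
  have "1 / (1 / x - 1) = 1 / (1 - x) - 1" using x by (simp add: field_simps)
  then have "frac (1 / (1 / x - 1)) = frac (1 / (1 - x))"
    using frac_1_eq[of "1 / (1 - x) - 1"] by simp
  then show "gauss_alpha \<alpha> (Suc (Suc k)) = frac (1 / (1 - gauss_alpha \<alpha> k))"
    using s by (simp add: x_def[symmetric])
qed

text \<open>When the remainder x exceeds 1/2, the nearest-integer expansion continues with 1/(1-x),
  whose fractional part is the result of two Gauss steps.\<close>

lemma frac_cf_arg:
  assumes "\<alpha> \<notin> \<rat>" shows "frac (cf_arg \<alpha> n) = gauss_alpha \<alpha> (gauss_index \<alpha> n)"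
proof (induction n)
  case (Suc n)
  let ?x = "gauss_alpha \<alpha> (gauss_index \<alpha> n)"
  have d: "infdist (cf_arg \<alpha> n) \<int> = min ?x (1 - ?x)" using Suc infdist_Ints_frac by simp
  show ?case
  proof (cases "?x < 1/2")
    case True
    then show ?thesis using d by (simp add: min_def)
  next
    case False
    then have "min ?x (1 - ?x) = 1 - ?x" by auto
    then show ?thesis using d False gauss_alpha_large(2)[OF assms, of "gauss_index \<alpha> n"] by simp
  qed
qed simp

lemma cf_alpha_gauss:
  assumes "\<alpha> \<notin> \<rat>"
  shows "gauss_alpha \<alpha> (gauss_index \<alpha> n) < 1/2 \<Longrightarrow> cf_alpha \<alpha> n = gauss_alpha \<alpha> (gauss_index \<alpha> n)"
    and "\<not> gauss_alpha \<alpha> (gauss_index \<alpha> n) < 1/2 \<Longrightarrow>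
      cf_alpha \<alpha> n = gauss_alpha \<alpha> (gauss_index \<alpha> n) * gauss_alpha \<alpha> (Suc (gauss_index \<alpha> n))"
    and "\<not> gauss_alpha \<alpha> (gauss_index \<alpha> n) < 1/2 \<Longrightarrow> cf_alpha \<alpha> n = 1 - gauss_alpha \<alpha> (gauss_index \<alpha> n)"
  using gauss_alpha_large(1)[OF assms, of "gauss_index \<alpha> n"]
  by (auto simp: cf_alpha_def infdist_Ints_frac frac_cf_arg[OF assms])

lemma cf_alpha_bounds:
  assumes "\<alpha> \<notin> \<rat>" shows "0 < cf_alpha \<alpha> n" "cf_alpha \<alpha> n < 1/2" "cf_alpha \<alpha> n \<notin> \<rat>"
proof -
  let ?x = "gauss_alpha \<alpha> (gauss_index \<alpha> n)"
  have x: "?x \<notin> \<rat>" "0 < ?x" "?x < 1" using gauss_alpha_irrational gauss_alpha_bounds assms by auto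
  have half: "?x \<noteq> 1/2" using x(1) by (metis Rats_1 Rats_divide Rats_number_of)
  show "0 < cf_alpha \<alpha> n" "cf_alpha \<alpha> n < 1/2"
    using cf_alpha_gauss(1,3)[OF assms, of n] x half by (cases "?x < 1/2"; simp)+
  have "1 - ?x \<notin> \<rat>" using x(1) Rats_diff[OF Rats_1, of "1 - ?x"] by auto
  then show "cf_alpha \<alpha> n \<notin> \<rat>"
    using cf_alpha_gauss(1,3)[OF assms, of n] x by (cases "?x < 1/2") simp_all
qed

lemma cf_arg_irrational: "\<alpha> \<notin> \<rat> \<Longrightarrow> cf_arg \<alpha> n \<notin> \<rat>"
  using irrational_inverse[OF cf_alpha_bounds(3)] by (cases n) (auto simp: cf_alpha_def)

lemma nearest_decomp:
  assumes "x \<notin> \<rat>"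
  shows "snd (nearest_decomp x) \<in> {1, -1}"
    "x = of_int (fst (nearest_decomp x)) + of_int (snd (nearest_decomp x)) * infdist x \<int>"
proof -
  have "case nearest_decomp x of (a, \<epsilon>) \<Rightarrow> \<epsilon> \<in> {1, -1} \<and> x = of_int a + of_int \<epsilon> * infdist x \<int>"
    unfolding nearest_decomp_def by (rule theI'[OF nearest_decomp_ex1[OF assms]])
  then show "snd (nearest_decomp x) \<in> {1, -1}"
    "x = of_int (fst (nearest_decomp x)) + of_int (snd (nearest_decomp x)) * infdist x \<int>"
    by (simp_all only: prod.case_eq_if)
qed

lemma cf_eps_cases: "\<alpha> \<notin> \<rat> \<Longrightarrow> cf_eps \<alpha> n = 1 \<or> cf_eps \<alpha> n = -1"
  using nearest_decomp(1)[OF cf_arg_irrational] by (auto simp: cf_eps_def)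

lemma cf_step:
  assumes "\<alpha> \<notin> \<rat>"
  shows "1 / cf_alpha \<alpha> n = of_int (cf_a \<alpha> n) + of_int (cf_eps \<alpha> (Suc n)) * cf_alpha \<alpha> (Suc n)"
  using nearest_decomp(2)[OF cf_arg_irrational[OF assms, of "Suc n"]]
  by (simp add: cf_a_def cf_eps_def cf_alpha_def)

lemma nearest_cf_cf:
  assumes "\<alpha> \<notin> \<rat>" shows "nearest_cf (cf_alpha \<alpha>) (\<lambda>n. of_int (cf_eps \<alpha> n))"
proof
  fix n
  show "0 < cf_alpha \<alpha> n" "cf_alpha \<alpha> n < 1/2" using cf_alpha_bounds[OF assms] by auto
  show "real_of_int (cf_eps \<alpha> n) = 1 \<or> real_of_int (cf_eps \<alpha> n) = -1" using cf_eps_cases[OF assms, of n] by auto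
  show "1 / cf_alpha \<alpha> n - real_of_int (cf_eps \<alpha> (Suc n)) * cf_alpha \<alpha> (Suc n) \<in> \<int>"
    using cf_step[OF assms, of n] by simp
qed

section \<open>Comparison of the two Brjuno sums\<close>

definition gauss_term :: "real \<Rightarrow> nat \<Rightarrow> nat \<Rightarrow> real" where
  "gauss_term \<alpha> m i = (\<Prod>l<i. gauss_alpha \<alpha> (m + l)) * ln (1 / gauss_alpha \<alpha> (m + i))"

lemma gauss_term_nonneg: assumes "\<alpha> \<notin> \<rat>" shows "0 \<le> gauss_term \<alpha> m i"
  unfolding gauss_term_def
  by (intro mult_nonneg_nonneg prod_nonneg less_imp_le[OF mult_ln_inverse_le(1)]
      less_imp_le[OF gauss_alpha_bounds(1)] gauss_alpha_bounds assms)

lemma gauss_term_0: "gauss_term \<alpha> m 0 = ln (1 / gauss_alpha \<alpha> m)"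
  and gauss_term_Suc: "gauss_term \<alpha> m (Suc i) = gauss_alpha \<alpha> m * gauss_term \<alpha> (Suc m) i"
  by (simp_all add: gauss_term_def prod.lessThan_Suc_shift del: prod.lessThan_Suc)

lemma brjuno_sum_gauss: "brjuno_sum (gauss_alpha \<alpha> m) = (\<Sum>i. ereal (gauss_term \<alpha> m i))"
  by (simp add: brjuno_sum_def gauss_term_def gauss_alpha_shift)

lemma brjuno_sum_gauss_0: "brjuno_sum (gauss_alpha \<alpha> 0) = brjuno_sum \<alpha>"
proof -
  have "gauss_alpha (gauss_alpha \<alpha> 0) = gauss_alpha \<alpha>"
    using gauss_alpha_shift[of \<alpha> 0] by (simp add: fun_eq_iff)
  then show ?thesis unfolding brjuno_sum_def by (simp only:)
qed

lemma brjuno_number_iff: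
  assumes "\<alpha> \<notin> \<rat>" shows "brjuno_number \<alpha> \<longleftrightarrow> summable (gauss_term \<alpha> 0)"
proof
  assume "brjuno_number \<alpha>"
  then have "(\<Sum>i. ereal (gauss_term \<alpha> 0 i)) \<noteq> \<infinity>"
    by (simp add: brjuno_number_def flip: brjuno_sum_gauss brjuno_sum_gauss_0[of \<alpha>])
  then show "summable (gauss_term \<alpha> 0)" by (rule summable_ereal[OF gauss_term_nonneg[OF assms]])
next
  assume "summable (gauss_term \<alpha> 0)"
  then have "(\<lambda>i. ereal (gauss_term \<alpha> 0 i)) sums ereal (suminf (gauss_term \<alpha> 0))"
    by (simp add: sums_ereal summable_sums)
  then show "brjuno_number \<alpha>"
    using assms by (simp add: brjuno_number_def sums_iff flip: brjuno_sum_gauss_0[of \<alpha>] brjuno_sum_gauss)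
qed

text \<open>One merged step changes the Brjuno sum by $(1 - x) \log (1/y)$ where $xy = 1 - x$, which is bounded.\<close>
lemma merged_step_error:
  assumes "\<alpha> \<notin> \<rat>" "\<not> gauss_alpha \<alpha> (gauss_index \<alpha> n) < 1/2"
  shows "ln (1 / cf_alpha \<alpha> n) - (gauss_term \<alpha> (gauss_index \<alpha> n) 0 + gauss_term \<alpha> (gauss_index \<alpha> n) 1) \<in> {0..1}"
proof -
  let ?k = "gauss_index \<alpha> n"
  define x y where "x = gauss_alpha \<alpha> ?k" and "y = gauss_alpha \<alpha> (Suc ?k)"
  have x: "0 < x" "x < 1" and y: "0 < y" "y < 1"
    unfolding x_def y_def by (intro gauss_alpha_bounds assms)+
  have xy: "x * y = 1 - x" using gauss_alpha_large(1)[OF assms(1), of ?k] assms(2) by (simp add: x_def y_def)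
  note l = mult_ln_inverse_le[OF y]
  have "ln (1 / (x * y)) = ln (1 / x * (1 / y))" by simp
  also have "\<dots> = ln (1 / x) + ln (1 / y)" using x y by (intro ln_mult_pos) auto
  finally have "ln (1 / (x * y)) = ln (1 / x) + ln (1 / y)" .
  moreover have "cf_alpha \<alpha> n = x * y" using cf_alpha_gauss(2)[OF assms] by (simp only: x_def y_def)
  moreover have "gauss_term \<alpha> ?k 0 = ln (1 / x)" "gauss_term \<alpha> ?k 1 = x * ln (1 / y)"
    by (simp_all only: One_nat_def gauss_term_Suc gauss_term_0 x_def y_def)
  ultimately have "ln (1 / cf_alpha \<alpha> n) - (gauss_term \<alpha> ?k 0 + gauss_term \<alpha> ?k 1) = (1 - x) * ln (1 / y)"
    by (simp add: left_diff_distrib)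
  also have "\<dots> = x * (y * ln (1 / y))" by (simp flip: xy)
  finally have e: "ln (1 / cf_alpha \<alpha> n) - (gauss_term \<alpha> ?k 0 + gauss_term \<alpha> ?k 1) = x * (y * ln (1 / y))" .
  define z where "z = y * ln (1 / y)"
  have "0 \<le> z" "z \<le> 1" using y l unfolding z_def by simp_all
  then have "x * z \<le> 1" "0 \<le> x * z"
    using x mult_mono[of x 1 z 1] by simp_all
  then have "x * (y * ln (1 / y)) \<le> 1" "0 \<le> x * (y * ln (1 / y))" by (simp_all add: z_def)
  then show ?thesis unfolding e by simp
qed

text \<open>Each step adds an error of at most 1 and multiplies the remaining error by less than
  1/2, so the bound 2 reproduces itself.\<close>

lemma brjuno_partial_sums:
  assumes "\<alpha> \<notin> \<rat>"
  shows "\<bar>(\<Sum>i<N. (\<Prod>l<i. cf_alpha \<alpha> (n + l)) * ln (1 / cf_alpha \<alpha> (n + i)))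
     - (\<Sum>i<gauss_index \<alpha> (n + N) - gauss_index \<alpha> n. gauss_term \<alpha> (gauss_index \<alpha> n) i)\<bar> \<le> 2"
proof (induction N arbitrary: n)
  case (Suc N)
  let ?r = "cf_alpha \<alpha>" and ?k = "gauss_index \<alpha> n"
  define S where "S = (\<Sum>i<N. (\<Prod>l<i. ?r (Suc n + l)) * ln (1 / ?r (Suc n + i)))"
  define M where "M = gauss_index \<alpha> (Suc n + N) - gauss_index \<alpha> (Suc n)"
  define T where "T = (\<Sum>i<M. gauss_term \<alpha> (gauss_index \<alpha> (Suc n)) i)"
  have IH: "\<bar>S - T\<bar> \<le> 2" unfolding S_def T_def M_def by (rule Suc.IH)
  have r: "0 < ?r n" "?r n < 1/2" using cf_alpha_bounds[OF assms] by auto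
  have S: "(\<Sum>i<Suc N. (\<Prod>l<i. ?r (n + l)) * ln (1 / ?r (n + i))) = ln (1 / ?r n) + ?r n * S"
    unfolding S_def sum.lessThan_Suc_shift prod.lessThan_Suc_shift
    by (simp add: sum_distrib_left mult.assoc)
  have mono: "gauss_index \<alpha> (Suc n) \<le> gauss_index \<alpha> (Suc n + N)" by (intro gauss_index_mono) simp
  have bound: "?r n * (S - T) \<in> {-1..1}"
  proof -
    have "\<bar>?r n * (S - T)\<bar> \<le> 1/2 * 2" unfolding abs_mult using r IH by (intro mult_mono) auto
    then show ?thesis by (simp add: abs_le_iff)
  qed
  show ?case
  proof (cases "gauss_alpha \<alpha> ?k < 1/2")
    case True
    then have len: "gauss_index \<alpha> (n + Suc N) - ?k = Suc M" using mono by (simp add: M_def)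
    have "(\<Sum>i<gauss_index \<alpha> (n + Suc N) - ?k. gauss_term \<alpha> ?k i) = ln (1 / ?r n) + ?r n * T"
      unfolding len sum.lessThan_Suc_shift T_def using True cf_alpha_gauss(1)[OF assms, of n]
      by (simp add: gauss_term_0 gauss_term_Suc sum_distrib_left)
    moreover have "ln (1 / ?r n) + ?r n * S - (ln (1 / ?r n) + ?r n * T) = ?r n * (S - T)"
      by (simp add: algebra_simps)
    ultimately show ?thesis using bound unfolding S by (simp only:) (simp add: abs_le_iff)
  next
    case False
    then have len: "gauss_index \<alpha> (n + Suc N) - ?k = Suc (Suc M)" using mono by (simp add: M_def)
    have "(\<Sum>i<gauss_index \<alpha> (n + Suc N) - ?k. gauss_term \<alpha> ?k i)
        = gauss_term \<alpha> ?k 0 + gauss_term \<alpha> ?k 1 + ?r n * T"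
      unfolding len sum.lessThan_Suc_shift T_def using False cf_alpha_gauss(2)[OF assms, of n]
      by (simp add: gauss_term_Suc sum_distrib_left mult.assoc)
    moreover have "ln (1 / ?r n) + ?r n * S - (gauss_term \<alpha> ?k 0 + gauss_term \<alpha> ?k 1 + ?r n * T)
        = (ln (1 / ?r n) - (gauss_term \<alpha> ?k 0 + gauss_term \<alpha> ?k 1)) + ?r n * (S - T)"
      by (simp add: algebra_simps)
    ultimately show ?thesis using bound merged_step_error[OF assms False]
      unfolding S by (simp only: atLeastAtMost_iff abs_le_iff) linarith
  qed
qed simp

section \<open>The Herman condition\<close>

lemma nearest_term_nonneg:
  assumes "\<alpha> \<notin> \<rat>" shows "0 \<le> nearest_cf.rprod (cf_alpha \<alpha>) n k * ln (1 / cf_alpha \<alpha> (n + k))"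
proof -
  interpret nearest_cf "cf_alpha \<alpha>" "\<lambda>n. of_int (cf_eps \<alpha> n)" by (rule nearest_cf_cf[OF assms])
  show ?thesis by (rule less_imp_le[OF brjuno_term_pos])
qed

lemma nearest_partial_sums:
  assumes "\<alpha> \<notin> \<rat>"
  shows "\<bar>(\<Sum>i<N. nearest_cf.rprod (cf_alpha \<alpha>) n i * ln (1 / cf_alpha \<alpha> (n + i)))
     - (\<Sum>i<gauss_index \<alpha> (n + N) - gauss_index \<alpha> n. gauss_term \<alpha> (gauss_index \<alpha> n) i)\<bar> \<le> 2"
  using brjuno_partial_sums[OF assms, where n = n and N = N]
  by (simp only: nearest_cf.rprod_def[OF nearest_cf_cf[OF assms]])

lemma gauss_index_diff: "N \<le> gauss_index \<alpha> (n + N) - gauss_index \<alpha> n"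
proof -
  have "gauss_index \<alpha> n + N \<le> gauss_index \<alpha> (n + N)" by (induction N) auto
  then show ?thesis by simp
qed

lemma brjuno_iff_nearest:
  assumes "\<alpha> \<notin> \<rat>"
  shows "brjuno_number \<alpha> \<longleftrightarrow> summable (\<lambda>k. nearest_cf.rprod (cf_alpha \<alpha>) 0 k * ln (1 / cf_alpha \<alpha> (0 + k)))"
    (is "_ \<longleftrightarrow> summable ?f")
proof -
  note ps = nearest_partial_sums[OF assms, where n = 0, unfolded add_0 gauss_index.simps diff_zero]
  have "summable ?f" if g: "summable (gauss_term \<alpha> 0)"
  proof (rule summableI_nonneg_bounded)
    show "0 \<le> ?f k" for k by (rule nearest_term_nonneg[OF assms])
    fix N
    have "(\<Sum>i<gauss_index \<alpha> N. gauss_term \<alpha> 0 i) \<le> suminf (gauss_term \<alpha> 0)"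
      by (intro sum_le_suminf g gauss_term_nonneg assms) auto
    then show "(\<Sum>i<N. ?f i) \<le> suminf (gauss_term \<alpha> 0) + 2" using ps[of N] by (simp add: abs_le_iff)
  qed
  moreover have "summable (gauss_term \<alpha> 0)" if f: "summable ?f"
  proof (rule summableI_nonneg_bounded)
    show "0 \<le> gauss_term \<alpha> 0 k" for k by (rule gauss_term_nonneg[OF assms])
    fix N
    have "(\<Sum>i<N. gauss_term \<alpha> 0 i) \<le> (\<Sum>i<gauss_index \<alpha> N. gauss_term \<alpha> 0 i)"
      by (intro sum_mono2 gauss_term_nonneg assms) (use gauss_index_ge[of N \<alpha>] in auto)
    moreover have "(\<Sum>i<N. ?f i) \<le> suminf ?f"
      by (intro sum_le_suminf f nearest_term_nonneg assms) auto
    ultimately show "(\<Sum>i<N. gauss_term \<alpha> 0 i) \<le> suminf ?f + 2" using ps[of N] by (simp add: abs_le_iff)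
  qed
  ultimately show ?thesis using brjuno_number_iff[OF assms] by blast
qed

lemma summable_gauss_term:
  assumes "\<alpha> \<notin> \<rat>" "summable (gauss_term \<alpha> 0)" shows "summable (gauss_term \<alpha> m)"
proof (induction m)
  case (Suc m)
  then have "summable (\<lambda>i. gauss_term \<alpha> m (Suc i) / gauss_alpha \<alpha> m)"
    by (intro summable_divide) (simp only: summable_Suc_iff)
  then show ?case using gauss_alpha_bounds(1)[OF assms(1), of m] by (simp add: gauss_term_Suc)
qed (rule assms)

definition gauss_sum :: "real \<Rightarrow> nat \<Rightarrow> real" where
  "gauss_sum \<alpha> m = suminf (gauss_term \<alpha> m)"

lemma gauss_sum_rec:
  assumes "\<alpha> \<notin> \<rat>" "summable (gauss_term \<alpha> 0)"
  shows "gauss_sum \<alpha> m = ln (1 / gauss_alpha \<alpha> m) + gauss_alpha \<alpha> m * gauss_sum \<alpha> (Suc m)"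
proof -
  have "gauss_sum \<alpha> m = gauss_term \<alpha> m 0 + (\<Sum>k. gauss_term \<alpha> m (Suc k))"
    unfolding gauss_sum_def using suminf_split_head[OF summable_gauss_term[OF assms], of m] by simp
  then show ?thesis
    unfolding gauss_sum_def
    by (simp only: gauss_term_0 gauss_term_Suc suminf_mult[OF summable_gauss_term[OF assms]])
qed

lemma gauss_sum_nonneg:
  assumes "\<alpha> \<notin> \<rat>" "summable (gauss_term \<alpha> 0)" shows "0 \<le> gauss_sum \<alpha> m"
  unfolding gauss_sum_def by (intro suminf_nonneg summable_gauss_term[OF assms] gauss_term_nonneg[OF assms(1)])

lemma brjuno_sum_eq_gauss_sum:
  assumes "\<alpha> \<notin> \<rat>" "summable (gauss_term \<alpha> 0)"
  shows "brjuno_sum (gauss_alpha \<alpha> m) = ereal (gauss_sum \<alpha> m)"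
proof -
  have "(\<lambda>i. ereal (gauss_term \<alpha> m i)) sums ereal (gauss_sum \<alpha> m)"
    unfolding gauss_sum_def by (simp add: sums_ereal summable_sums summable_gauss_term[OF assms])
  then show ?thesis by (simp add: brjuno_sum_gauss sums_iff)
qed

abbreviation herman_orbit :: "real \<Rightarrow> nat \<Rightarrow> nat \<Rightarrow> real \<Rightarrow> real" where
  "herman_orbit \<alpha> n m y \<equiv> fold (\<lambda>i. herman_h (gauss_alpha \<alpha> i)) [n..<m] y"

primrec herman_pull :: "real \<Rightarrow> nat \<Rightarrow> nat \<Rightarrow> real \<Rightarrow> real" where
  "herman_pull \<alpha> 0 n t = t"
| "herman_pull \<alpha> (Suc j) n t = herman_inv (gauss_alpha \<alpha> n) (herman_pull \<alpha> j (Suc n) t)"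

lemma herman_orbit_ge:
  assumes "\<alpha> \<notin> \<rat>" "0 \<le> y" shows "y + real j \<le> herman_orbit \<alpha> n (n + j) y"
  using assms(2)
proof (induction j arbitrary: n y)
  case (Suc j)
  have h: "y + 1 \<le> herman_h (gauss_alpha \<alpha> n) y"
    by (intro herman_h_ge gauss_alpha_bounds assms Suc.prems)
  then have "herman_h (gauss_alpha \<alpha> n) y + real j \<le> herman_orbit \<alpha> (Suc n) (Suc n + j) (herman_h (gauss_alpha \<alpha> n) y)"
    using Suc.prems by (intro Suc.IH) simp
  then show ?case using h by (simp add: upt_conv_Cons del: upt_Suc)
qed simp

lemma herman_orbit_ge_iff:
  assumes "\<alpha> \<notin> \<rat>" "0 \<le> y" shows "t \<le> herman_orbit \<alpha> n (n + j) y \<longleftrightarrow> herman_pull \<alpha> j n t \<le> y"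
  using assms(2)
proof (induction j arbitrary: n y)
  case (Suc j)
  have "0 \<le> herman_h (gauss_alpha \<alpha> n) y"
    using herman_h_ge[OF gauss_alpha_bounds[OF assms(1)] Suc.prems, of n] Suc.prems by simp
  then have "t \<le> herman_orbit \<alpha> (Suc n) (Suc n + j) (herman_h (gauss_alpha \<alpha> n) y)
      \<longleftrightarrow> herman_pull \<alpha> j (Suc n) t \<le> herman_h (gauss_alpha \<alpha> n) y" by (rule Suc.IH)
  also have "\<dots> \<longleftrightarrow> herman_pull \<alpha> (Suc j) n t \<le> y"
    by (simp add: herman_h_ge_iff[OF gauss_alpha_bounds[OF assms(1)] Suc.prems])
  finally show ?case by (simp add: upt_conv_Cons del: upt_Suc)
qed simp

lemma herman_orbit_add:
  assumes "n \<le> m" "m \<le> k" shows "herman_orbit \<alpha> n k y = herman_orbit \<alpha> m k (herman_orbit \<alpha> n m y)"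
proof -
  have "[n..<k] = [n..<m] @ [m..<k]" using assms by (metis le_add_diff_inverse upt_add_eq_append)
  then show ?thesis by simp
qed

text \<open>An iterate above the Brjuno sum is also above
  \<open>ln (1 / gauss_alpha \<alpha> m)\<close>, so the affine branch of \<open>h\<close> applies;
  up to its positive summand this branch is the recursion of \<open>gauss_sum\<close> solved for the
  next sum.\<close>

lemma herman_condition_Suc:
  assumes a: "\<alpha> \<notin> \<rat>" "summable (gauss_term \<alpha> 0)" and "n \<le> m" "gauss_sum \<alpha> m \<le> herman_orbit \<alpha> n m y"
  shows "gauss_sum \<alpha> (Suc m) \<le> herman_orbit \<alpha> n (Suc m) y"
proof -
  let ?g = "gauss_alpha \<alpha> m" and ?v = "herman_orbit \<alpha> n m y"
  have g: "0 < ?g" "?g < 1" by (intro gauss_alpha_bounds a)+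
  note rec = gauss_sum_rec[OF a, of m]
  have "0 \<le> ?g * gauss_sum \<alpha> (Suc m)" using g gauss_sum_nonneg[OF a] by simp
  then have "ln (1 / ?g) \<le> ?v" using assms(4) rec by linarith
  then have "herman_h ?g ?v = (1 / ?g) * (?v - ln (1 / ?g) + 1)" by (simp add: herman_h_def)
  moreover have "(1 / ?g) * (?g * gauss_sum \<alpha> (Suc m)) \<le> (1 / ?g) * (?v - ln (1 / ?g) + 1)"
    using assms(4) rec g by (intro mult_left_mono) auto
  ultimately show ?thesis using g assms(3) by simp
qed

lemma herman_condition_mono:
  assumes a: "\<alpha> \<notin> \<rat>" "summable (gauss_term \<alpha> 0)" and "n \<le> m" "gauss_sum \<alpha> m \<le> herman_orbit \<alpha> n m y" and "m \<le> k"
  shows "gauss_sum \<alpha> k \<le> herman_orbit \<alpha> n k y"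
  using assms(5)
proof (induction k rule: dec_induct)
  case (step k)
  then show ?case using assms(3) by (intro herman_condition_Suc a) auto
qed (rule assms)

text \<open>Two relaxations. Testing at the indices \<open>gauss_index\<close> suffices, since the
  inequality persists once it holds. The bound 0 may be weakened to any constant, since an earlier
  start raises the iterates by at least 1 per step.\<close>

lemma herman_number_iff:
  assumes a: "\<alpha> \<notin> \<rat>" "summable (gauss_term \<alpha> 0)"
  shows "herman_number \<alpha> \<longleftrightarrow> (\<exists>C. \<forall>n. \<exists>j.
    herman_pull \<alpha> (gauss_index \<alpha> (n + j) - gauss_index \<alpha> n) (gauss_index \<alpha> n) (gauss_sum \<alpha> (gauss_index \<alpha> (n + j))) \<le> C)"
    (is "_ \<longleftrightarrow> (\<exists>C. \<forall>n. \<exists>j. ?P n j \<le> C)")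
proof -
  let ?k = "gauss_index \<alpha>"
  have H: "herman_number \<alpha> \<longleftrightarrow> (\<forall>n. \<exists>m\<ge>n. gauss_sum \<alpha> m \<le> herman_orbit \<alpha> n m 0)"
    using a(1) by (simp add: herman_number_def brjuno_sum_eq_gauss_sum[OF a])
  have P: "?P n j \<le> y \<longleftrightarrow> gauss_sum \<alpha> (?k (n + j)) \<le> herman_orbit \<alpha> (?k n) (?k (n + j)) y" if "0 \<le> y" for n j y
  proof -
    have "?k n + (?k (n + j) - ?k n) = ?k (n + j)" using gauss_index_mono[of n "n + j" \<alpha>] by simp
    then show ?thesis
      using herman_orbit_ge_iff[OF a(1) that, of "gauss_sum \<alpha> (?k (n + j))" "?k n" "?k (n + j) - ?k n"] by simp
  qed
  show ?thesis
  proof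
    assume "herman_number \<alpha>"
    have "\<exists>j. ?P n j \<le> 0" for n
    proof -
      obtain m where m: "?k n \<le> m" "gauss_sum \<alpha> m \<le> herman_orbit \<alpha> (?k n) m 0"
        using \<open>herman_number \<alpha>\<close> H by blast
      have "m \<le> ?k (n + m)" using gauss_index_ge[of "n + m" \<alpha>] by simp
      then show ?thesis using P[of 0 n m] herman_condition_mono[OF a m] by auto
    qed
    then show "\<exists>C. \<forall>n. \<exists>j. ?P n j \<le> C" by blast
  next
    assume "\<exists>C. \<forall>n. \<exists>j. ?P n j \<le> C"
    then obtain C where C: "\<And>n. \<exists>j. ?P n j \<le> C" by blast
    obtain L :: nat where L: "C \<le> real L" using real_arch_simple by blast
    show "herman_number \<alpha>" unfolding H
    proof
      fix n
      let ?N = "?k (n + L)"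
      obtain j where j: "?P (n + L) j \<le> C" using C by blast
      let ?m = "?k (n + L + j)"
      have le: "n + L \<le> ?N" "?N \<le> ?m" by (auto intro: gauss_index_ge gauss_index_mono)
      have "0 + real (?N - n) \<le> herman_orbit \<alpha> n (n + (?N - n)) 0" by (intro herman_orbit_ge a) simp
      then have big: "real L \<le> herman_orbit \<alpha> n ?N 0" using le(1) by simp
      then have "gauss_sum \<alpha> ?m \<le> herman_orbit \<alpha> ?N ?m (herman_orbit \<alpha> n ?N 0)"
        using j L by (intro P[THEN iffD1]) auto
      then have "gauss_sum \<alpha> ?m \<le> herman_orbit \<alpha> n ?m 0"
        using herman_orbit_add[of n ?N ?m \<alpha> 0] le by simp
      then show "\<exists>m\<ge>n. gauss_sum \<alpha> m \<le> herman_orbit \<alpha> n m 0" using le by (intro exI[of _ ?m]) auto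
    qed
  qed
qed

definition merged_inv :: "real \<Rightarrow> nat \<Rightarrow> real \<Rightarrow> real" where
  "merged_inv \<alpha> n t = herman_pull \<alpha> (gauss_index \<alpha> (Suc n) - gauss_index \<alpha> n) (gauss_index \<alpha> n) t"

lemma merged_inv_approx:
  assumes "\<alpha> \<notin> \<rat>"
  shows "\<bar>merged_inv \<alpha> n t - herman_inv (cf_alpha \<alpha> n) t\<bar> \<le> 6" "0 \<le> merged_inv \<alpha> n t"
proof -
  let ?k = "gauss_index \<alpha> n"
  note b = gauss_alpha_bounds[OF assms]
  show "0 \<le> merged_inv \<alpha> n t"
    unfolding merged_inv_def using herman_inv_nonneg[OF b] by (simp add: numeral_2_eq_2)
  show "\<bar>merged_inv \<alpha> n t - herman_inv (cf_alpha \<alpha> n) t\<bar> \<le> 6"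
  proof (cases "gauss_alpha \<alpha> ?k < 1/2")
    case True
    then show ?thesis using cf_alpha_gauss(1)[OF assms] by (simp add: merged_inv_def)
  next
    case False
    then have m: "merged_inv \<alpha> n t = herman_inv (gauss_alpha \<alpha> ?k) (herman_inv (gauss_alpha \<alpha> (Suc ?k)) t)"
      unfolding merged_inv_def by (simp add: numeral_2_eq_2 del: gauss_alpha.simps)
    have c: "cf_alpha \<alpha> n = gauss_alpha \<alpha> ?k * gauss_alpha \<alpha> (Suc ?k)" by (rule cf_alpha_gauss(2)[OF assms False])
    show ?thesis unfolding m c
      using False by (intro herman_inv_two_steps b gauss_alpha_large(1)[OF assms]) auto
  qed
qed

lemma herman_pull_add: "herman_pull \<alpha> (i + j) n t = herman_pull \<alpha> i n (herman_pull \<alpha> j (n + i) t)"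
proof (induction i arbitrary: n)
  case (Suc i)
  show ?case using Suc[of "Suc n"] by (simp only: add_Suc add_Suc_right herman_pull.simps)
qed simp

lemma herman_pull_merged:
  "herman_pull \<alpha> (gauss_index \<alpha> (n + Suc j) - gauss_index \<alpha> n) (gauss_index \<alpha> n) t
    = merged_inv \<alpha> n (herman_pull \<alpha> (gauss_index \<alpha> (Suc n + j) - gauss_index \<alpha> (Suc n)) (gauss_index \<alpha> (Suc n)) t)"
proof -
  have 1: "gauss_index \<alpha> n \<le> gauss_index \<alpha> (Suc n)" "gauss_index \<alpha> (Suc n) \<le> gauss_index \<alpha> (Suc n + j)"
    by (intro gauss_index_mono; simp)+
  then have "gauss_index \<alpha> (n + Suc j) - gauss_index \<alpha> n
      = (gauss_index \<alpha> (Suc n) - gauss_index \<alpha> n) + (gauss_index \<alpha> (Suc n + j) - gauss_index \<alpha> (Suc n))"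
    by simp
  moreover have "gauss_index \<alpha> n + (gauss_index \<alpha> (Suc n) - gauss_index \<alpha> n) = gauss_index \<alpha> (Suc n)" using 1 by simp
  ultimately show ?thesis unfolding merged_inv_def by (simp only: herman_pull_add)
qed

lemma hgt_lipschitz_scaled:
  assumes "0 < r" "r \<le> 1/2" "-1 \<le> c" "0 \<le> p" "\<bar>2 * pi * c - p\<bar> \<le> B"
  shows "\<bar>2 * pi * hgt r x c - 2 * pi * hgt r x (p / (2 * pi))\<bar> \<le> 5/6 * B"
proof -
  have "0 \<le> p / (2 * pi)" by (rule divide_nonneg_pos[OF assms(4)]) simp
  then have pp: "-1 \<le> p / (2 * pi)" by linarith
  have "2 * pi * hgt r x c - 2 * pi * hgt r x (p / (2 * pi)) = 2 * pi * (hgt r x c - hgt r x (p / (2 * pi)))"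
    by (simp only: right_diff_distrib)
  then have "\<bar>2 * pi * hgt r x c - 2 * pi * hgt r x (p / (2 * pi))\<bar>
      = 2 * pi * \<bar>hgt r x c - hgt r x (p / (2 * pi))\<bar>"
    by (simp only: abs_mult) simp
  also have "\<dots> \<le> 2 * pi * (5/6 * \<bar>c - p / (2 * pi)\<bar>)"
    by (rule mult_left_mono[OF hgt_lipschitz_height[OF assms(1,2) pp assms(3)]]) simp
  also have "\<dots> = 5/6 * \<bar>2 * pi * (c - p / (2 * pi))\<bar>" by (simp only: abs_mult) simp
  also have "2 * pi * (c - p / (2 * pi)) = 2 * pi * c - p" by (simp add: right_diff_distrib)
  finally show ?thesis using assms(5) by simp
qed

text \<open>Both \<open>herman_pull\<close> and the ceilings at the origin follow the same recursion
  up to an error 17 + 6 per level, and 138 is the fixed point of d = 5/6 * d + 23. The initial error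
  is at most 64 + 2.\<close>

lemma herman_iff_peak:
  assumes a: "\<alpha> \<notin> \<rat>" and b: "brjuno_number \<alpha>"
  shows "herman_number \<alpha> \<longleftrightarrow> (\<exists>C. \<forall>n. nearest_cf_brjuno.peak (cf_alpha \<alpha>) (\<lambda>n. of_int (cf_eps \<alpha> n)) n 0 \<le> C)"
proof -
  interpret nearest_cf "cf_alpha \<alpha>" "\<lambda>n. of_int (cf_eps \<alpha> n)" by (rule nearest_cf_cf[OF a])
  interpret nearest_cf_brjuno "cf_alpha \<alpha>" "\<lambda>n. of_int (cf_eps \<alpha> n)"
    by unfold_locales (rule brjuno_iff_nearest[OF a, THEN iffD1, OF b])
  have g: "summable (gauss_term \<alpha> 0)" using brjuno_number_iff[OF a] b by simp
  let ?k = "gauss_index \<alpha>"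
  let ?P = "\<lambda>n j. herman_pull \<alpha> (?k (n + j) - ?k n) (?k n) (gauss_sum \<alpha> (?k (n + j)))"
  have sums: "\<bar>suminf (brjuno_term n) - gauss_sum \<alpha> (?k n)\<bar> \<le> 2" for n
  proof (rule LIMSEQ_le_const2)
    have "filterlim (\<lambda>N. ?k (n + N) - ?k n) at_top at_top"
      by (rule filterlim_at_top_mono[OF filterlim_ident]) (simp add: gauss_index_diff)
    then have "(\<lambda>N. \<Sum>i<?k (n + N) - ?k n. gauss_term \<alpha> (?k n) i) \<longlonglongrightarrow> gauss_sum \<alpha> (?k n)"
      unfolding gauss_sum_def by (rule filterlim_compose[OF summable_LIMSEQ[OF summable_gauss_term[OF a g]]])
    then show "(\<lambda>N. \<bar>(\<Sum>i<N. brjuno_term n i) - (\<Sum>i<?k (n + N) - ?k n. gauss_term \<alpha> (?k n) i)\<bar>)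
        \<longlonglongrightarrow> \<bar>suminf (brjuno_term n) - gauss_sum \<alpha> (?k n)\<bar>"
      by (intro tendsto_intros summable_LIMSEQ summable_brjuno)
    show "\<exists>M. \<forall>N\<ge>M. \<bar>(\<Sum>i<N. brjuno_term n i) - (\<Sum>i<?k (n + N) - ?k n. gauss_term \<alpha> (?k n) i)\<bar> \<le> 2"
      using nearest_partial_sums[OF a] by blast
  qed
  have cmp: "\<bar>2 * pi * ceil_fun n j 0 - ?P n j\<bar> \<le> 138 \<and> 0 \<le> ?P n j" for n j
  proof (induction j arbitrary: n)
    case 0
    show ?case using sums[of n] ceil_sum_approx[of n] gauss_sum_nonneg[OF a g, of "?k n"]
      by (simp add: ceil_origin_0)
  next
    case (Suc j)
    let ?r = "cf_alpha \<alpha> n"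
    let ?p = "?P (Suc n) j" and ?c = "ceil_fun (Suc n) j 0"
    have IH: "\<bar>2 * pi * ?c - ?p\<bar> \<le> 138" "0 \<le> ?p" using Suc.IH[of "Suc n"] by auto
    have P: "?P n (Suc j) = merged_inv \<alpha> n ?p" by (simp only: herman_pull_merged) simp
    have 1: "\<bar>2 * pi * hgt ?r 0 ?c - 2 * pi * hgt ?r 0 (?p / (2 * pi))\<bar> \<le> 5/6 * 138"
      by (rule hgt_lipschitz_scaled[OF r_pos r_le admissibleD(1)[OF admissible_ceil] IH(2,1)])
    have 2: "\<bar>2 * pi * hgt ?r 0 (?p / (2 * pi)) - herman_inv ?r ?p\<bar> \<le> 17"
      by (rule hgt_origin_approx[OF r_pos r_le IH(2)])
    have 3: "\<bar>merged_inv \<alpha> n ?p - herman_inv ?r ?p\<bar> \<le> 6" by (rule merged_inv_approx(1)[OF a])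
    have "\<bar>u - z\<bar> \<le> 138" if "\<bar>u - v\<bar> \<le> 5/6 * 138" "\<bar>v - w\<bar> \<le> 17" "\<bar>z - w\<bar> \<le> 6" for u v w z :: real
      using that by linarith
    from this[OF 1 2 3] have "\<bar>2 * pi * ceil_fun n (Suc j) 0 - ?P n (Suc j)\<bar> \<le> 138"
      by (simp only: ceil_origin_Suc P)
    moreover have "0 \<le> ?P n (Suc j)" unfolding P by (rule merged_inv_approx(2)[OF a])
    ultimately show ?case by blast
  qed
  have pi1: "1 \<le> 2 * pi" using pi_gt3 by simp
  show ?thesis unfolding herman_number_iff[OF a g]
  proof
    assume "\<exists>C. \<forall>n. \<exists>j. ?P n j \<le> C"
    then obtain C where C: "\<And>n. \<exists>j. ?P n j \<le> C" by blast
    have "peak n 0 \<le> \<bar>C\<bar> + 138" for n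
    proof -
      obtain j where "?P n j \<le> C" using C by blast
      then have "2 * pi * ceil_fun n j 0 \<le> \<bar>C\<bar> + 138" using cmp[of n j] by linarith
      then have "ceil_fun n j 0 \<le> \<bar>C\<bar> + 138"
        using mult_right_mono[OF pi1, of "ceil_fun n j 0"] by (cases "0 \<le> ceil_fun n j 0") auto
      then show ?thesis using peak_le_ceil[of n 0 j] by simp
    qed
    then show "\<exists>C. \<forall>n. peak n 0 \<le> C" by blast
  next
    assume "\<exists>C. \<forall>n. peak n 0 \<le> C"
    then obtain C where C: "\<And>n. peak n 0 \<le> C" by blast
    have "\<exists>j. ?P n j \<le> 2 * pi * (C + 1) + 138" for n
    proof -
      have "\<forall>\<^sub>F j in sequentially. ceil_fun n j 0 < C + 1"
        by (rule order_tendstoD(2)[OF ceil_tendsto]) (use C[of n] in simp)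
      then obtain j where "ceil_fun n j 0 < C + 1" by (auto simp: eventually_sequentially)
      then have "2 * pi * ceil_fun n j 0 \<le> 2 * pi * (C + 1)" by (intro mult_left_mono) auto
      then show ?thesis using cmp[of n j] by (intro exI[of _ j]) linarith
    qed
    then show "\<exists>C. \<forall>n. \<exists>j. ?P n j \<le> C" by blast
  qed
qed

section \<open>Star-shaped plane sets\<close>

definition ray :: "real \<Rightarrow> complex" where
  "ray \<theta> = exp (2 * of_real pi * \<i> * of_real \<theta>)"

text \<open>Angles in full turns. Radius functions are 1-periodic, so the choice of branch in
  \<open>Arg\<close> is immaterial to them.\<close>

definition ang :: "complex \<Rightarrow> real" where
  "ang z = Arg z / (2 * pi)"

lemma norm_ray [simp]: "cmod (ray \<theta>) = 1"
proof -
  have "ray \<theta> = exp (\<i> * of_real (2 * pi * \<theta>))" by (simp add: ray_def ac_simps)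
  then show ?thesis by (simp only: norm_exp_i_times)
qed

lemma ray_nz [simp]: "ray \<theta> \<noteq> 0" by (simp add: ray_def)

lemma ray_eq_iff: "ray x = ray y \<longleftrightarrow> x - y \<in> \<int>"
proof -
  have "ray x = ray y \<longleftrightarrow> (\<exists>n::int. 2 * of_real pi * \<i> * of_real x = 2 * of_real pi * \<i> * of_real y + of_real (of_int (2 * n) * pi) * \<i>)"
    unfolding ray_def by (rule exp_eq)
  also have "\<dots> \<longleftrightarrow> (\<exists>n::int. complex_of_real x = of_real (y + of_int n))"
  proof (rule ex_cong1)
    fix n :: int
    have "2 * of_real pi * \<i> * of_real y + of_real (of_int (2 * n) * pi) * \<i>
        = 2 * of_real pi * \<i> * complex_of_real (y + of_int n)" by (simp add: algebra_simps)
    then show "2 * of_real pi * \<i> * of_real x = 2 * of_real pi * \<i> * of_real y + of_real (of_int (2 * n) * pi) * \<i>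
        \<longleftrightarrow> complex_of_real x = of_real (y + of_int n)"
      by (simp only: mult_cancel_left) simp
  qed
  also have "\<dots> \<longleftrightarrow> (\<exists>n::int. x - y = of_int n)"
    unfolding of_real_eq_iff by (intro ex_cong1) (auto simp: algebra_simps)
  finally show ?thesis by (auto simp: Ints_def)
qed

lemma polar: "z = of_real (cmod z) * ray (ang z)"
  using Arg_eq[of z] by (cases "z = 0") (simp_all add: ray_def ang_def)

lemma sgn_polar: "z \<noteq> 0 \<Longrightarrow> sgn z = ray (ang z)"
  using polar[of z] by (metis norm_eq_zero mult.commute nonzero_mult_div_cancel_right of_real_eq_0_iff sgn_eq)

lemma ang_ray: "0 < \<rho> \<Longrightarrow> ang (of_real \<rho> * ray \<theta>) - \<theta> \<in> \<int>"
  using polar[of "of_real \<rho> * ray \<theta>"] by (simp add: norm_mult ray_eq_iff flip: ray_eq_iff)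

lemma continuous_ray: "continuous_on S ray"
  unfolding ray_def by (intro continuous_intros)

section \<open>Closed curves in polar coordinates\<close>

locale radius_loop =
  fixes q :: "real \<Rightarrow> real"
  assumes per: "x - y \<in> \<int> \<Longrightarrow> q x = q y" and cont: "continuous_on UNIV q" and pos: "0 < q x"
begin

lemma bounds: obtains m K where "0 < m" "\<And>x. m \<le> q x" "\<And>x. q x \<le> K"
proof -
  have c: "continuous_on {0..1} q" using cont continuous_on_subset by blast
  obtain a where a: "a \<in> {0..1}" "\<And>y. y \<in> {0..1} \<Longrightarrow> q a \<le> q y"
    using continuous_attains_inf[OF _ _ c] by auto
  obtain b where b: "b \<in> {0..1}" "\<And>y. y \<in> {0..1} \<Longrightarrow> q y \<le> q b"
    using continuous_attains_sup[OF _ _ c] by auto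
  have "q x = q (frac x)" for x by (rule per) (simp add: frac_def)
  moreover have "frac x \<in> {0..1}" for x :: real using frac_lt_1[of x] by (simp add: less_imp_le)
  ultimately have "q a \<le> q x" "q x \<le> q b" for x using a(2) b(2) by metis+
  with pos[of a] show thesis by (rule that)
qed

lemma q_ang_ray: "0 < \<rho> \<Longrightarrow> q (ang (of_real \<rho> * ray \<theta>)) = q \<theta>"
  by (rule per[OF ang_ray])

text \<open>\<open>Arg\<close> jumps on the negative real axis. Near it the branch
  \<open>Arg (- z) / (2 * pi) + 1/2\<close> is used, which differs from \<open>ang z\<close> by an
  integer.\<close>

lemma continuous_q_ang: "continuous_on (- {0}) (\<lambda>z. q (ang z))"
proof -
  let ?A = "- \<real>\<^sub>\<le>\<^sub>0 :: complex set" and ?B = "uminus -` (- \<real>\<^sub>\<le>\<^sub>0) :: complex set"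
  have "continuous_on ?A (\<lambda>z. q (ang z))"
    unfolding ang_def by (intro continuous_on_compose2[OF cont] continuous_intros) auto
  moreover have "continuous_on ?B (\<lambda>z. q (ang z))"
  proof (rule continuous_on_eq)
    show "continuous_on ?B (\<lambda>z. q (Arg (- z) / (2 * pi) + 1 / 2))"
      by (intro continuous_on_compose2[OF cont] continuous_intros) auto
    fix z assume "z \<in> ?B"
    then have z: "z \<noteq> 0" by auto
    have "ray (ang (- z) + 1/2) = ray (ang (- z)) * ray (1/2)"
      by (simp add: ray_def ring_distribs exp_add)
    also have "ray (1/2) = - 1" by (simp add: ray_def)
    also have "ray (ang (- z)) = sgn (- z)" using z by (intro sgn_polar[symmetric]) simp
    also have "sgn (- z) * - 1 = sgn z" by (simp add: sgn_minus)
    also have "\<dots> = ray (ang z)" by (rule sgn_polar[OF z])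
    finally have "ang (- z) + 1/2 - ang z \<in> \<int>" by (simp only: ray_eq_iff)
    then show "q (Arg (- z) / (2 * pi) + 1 / 2) = q (ang z)" unfolding ang_def by (rule per)
  qed
  moreover have "open ?A" "open ?B"
    by (auto intro!: open_vimage continuous_intros)
  ultimately have "continuous_on (?A \<union> ?B) (\<lambda>z. q (ang z))"
    by (rule continuous_on_open_Un[rotated 2])
  moreover have "?A \<union> ?B = - {0}" by (auto simp: complex_nonpos_Reals_iff complex_eq_iff)
  ultimately show ?thesis by simp
qed

end

lemma continuous_on_UNIV_if_bounded:
  fixes \<psi> :: "complex \<Rightarrow> 'b::real_normed_vector"
  assumes c: "continuous_on (- {0}) \<psi>" and z: "\<psi> 0 = 0" and b: "\<And>z. norm (\<psi> z) \<le> C * cmod z powr \<kappa>" and k: "0 < \<kappa>"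
  shows "continuous_on UNIV \<psi>"
proof -
  have "isCont \<psi> z" for z
  proof (cases "z = 0")
    case False
    then show ?thesis
      using c continuous_on_eq_continuous_at[OF open_Compl[OF closed_singleton[of "0::complex"]], of \<psi>] by simp
  next
    case True
    have "((\<lambda>z. C * cmod z powr \<kappa>) \<longlongrightarrow> C * cmod 0 powr \<kappa>) (at (0::complex))"
      using k by (intro tendsto_intros) (auto intro!: tendsto_powr' tendsto_intros)
    then have "((\<lambda>z. C * cmod z powr \<kappa>) \<longlongrightarrow> 0) (at (0::complex))" by simp
    then have "(\<psi> \<longlongrightarrow> 0) (at 0)" by (rule Lim_null_comparison[OF always_eventually, rotated]) (use b in blast)
    then show ?thesis using True z by (simp add: isCont_def)
  qed
  then show ?thesis by (simp add: continuous_at_imp_continuous_on)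
qed

context radius_loop
begin

definition rel_radius :: "complex \<Rightarrow> real" where
  "rel_radius z = cmod z / q (ang z)"

lemma rel_radius_nonneg: "0 \<le> rel_radius z"
  unfolding rel_radius_def using less_imp_le[OF pos] by simp

lemma continuous_rel_radius: "continuous_on UNIV rel_radius"
proof (rule bounds)
  fix m K assume m: "0 < m" "\<And>x. m \<le> q x"
  show ?thesis
  proof (rule continuous_on_UNIV_if_bounded)
    have "q (ang z) \<noteq> 0" for z using pos[of "ang z"] by simp
    then show "continuous_on (- {0}) rel_radius"
      unfolding rel_radius_def by (intro continuous_intros continuous_q_ang) auto
    show "norm (rel_radius z) \<le> 1 / m * cmod z powr 1" for z
      using m pos[of "ang z"] by (simp add: rel_radius_def frac_le)
  qed (simp_all add: rel_radius_def)
qed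

lemma continuous_radial:
  assumes "continuous_on (- {0}) \<phi>" "\<And>z. \<bar>\<phi> z\<bar> \<le> C * cmod z powr \<kappa>" "0 < \<kappa>"
  shows "continuous_on UNIV (\<lambda>z. of_real (\<phi> z) * sgn z :: complex)"
proof (rule continuous_on_UNIV_if_bounded)
  show "continuous_on (- {0}) (\<lambda>z. of_real (\<phi> z) * sgn z :: complex)"
    by (intro continuous_intros assms(1)) auto
  show "norm (of_real (\<phi> z) * sgn z :: complex) \<le> C * cmod z powr \<kappa>" for z
    using assms(2)[of z] assms(2)[of 0] by (cases "z = 0") (auto simp: norm_mult norm_sgn)
qed (use assms(3) in auto)

lemma closed_rel_radius_le: "closed {z. rel_radius z \<le> 1}"
  by (intro closed_Collect_le continuous_rel_radius continuous_intros)

lemma open_rel_radius_less: "open {z. rel_radius z < 1}"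
  by (intro open_Collect_less continuous_rel_radius continuous_intros)

lemma rel_radius_le_iff: "rel_radius z \<le> 1 \<longleftrightarrow> cmod z \<le> q (ang z)"
  and rel_radius_less_iff: "rel_radius z < 1 \<longleftrightarrow> cmod z < q (ang z)"
  unfolding rel_radius_def using pos[of "ang z"] by simp_all

lemma jordan_curve_graph: "jordan_curve {z. cmod z = q (ang z)}"
proof -
  define \<gamma> where "\<gamma> t = of_real (q t) * ray t" for t
  have n: "cmod (\<gamma> t) = q t" for t using pos[of t] by (simp add: \<gamma>_def norm_mult)
  have "path \<gamma>"
    unfolding path_def \<gamma>_def
    by (intro continuous_intros continuous_ray continuous_on_subset[OF cont]) auto
  moreover have "x = y \<or> x = 0 \<and> y = 1 \<or> x = 1 \<and> y = 0"
    if xy: "x \<in> {0..1}" "y \<in> {0..1}" "\<gamma> x = \<gamma> y" for x y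
  proof -
    have "q x = q y" using xy(3) n by metis
    then have "x - y \<in> \<int>" using xy(3) pos[of y] by (simp add: \<gamma>_def ray_eq_iff)
    then obtain k where k: "x - y = of_int k" by (rule Ints_cases)
    then have "real_of_int k \<le> 1" "-1 \<le> real_of_int k" using xy by auto
    then have "k \<le> 1" "-1 \<le> k" by linarith+
    then have "k = -1 \<or> k = 0 \<or> k = 1" by linarith
    then show ?thesis using k xy by auto
  qed
  ultimately have "simple_path \<gamma>" unfolding simple_path_def loop_free_def by blast
  moreover have "pathfinish \<gamma> = pathstart \<gamma>"
    using per[of 1 0] ray_eq_iff[of 1 0] by (simp add: pathfinish_def pathstart_def \<gamma>_def)
  moreover have "path_image \<gamma> = {z. cmod z = q (ang z)}"
  proof (intro set_eqI iffI)
    fix z assume "z \<in> path_image \<gamma>"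
    then obtain t where "z = \<gamma> t" by (auto simp: path_image_def)
    then show "z \<in> {z. cmod z = q (ang z)}" using n[of t] q_ang_ray[OF pos, of t t] by (simp add: \<gamma>_def)
  next
    fix z assume z: "z \<in> {z. cmod z = q (ang z)}"
    let ?t = "frac (ang z)"
    have "q ?t = q (ang z)" "ray ?t = ray (ang z)" by (auto intro: per simp: ray_eq_iff frac_def)
    then have "\<gamma> ?t = z" using polar[of z] z by (simp add: \<gamma>_def)
    moreover have "?t \<in> {0..1}" using frac_lt_1[of "ang z"] by (simp add: less_imp_le)
    ultimately show "z \<in> path_image \<gamma>" unfolding path_image_def by (rule image_eqI[OF sym])
  qed
  ultimately show ?thesis unfolding jordan_curve_def by blast
qed

text \<open>Dividing each ray by \<open>q\<close> turns the inner curve into the unit circle; a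
  suitable exponent \<open>\<kappa>\<close> then brings hairs of bounded relative length below
  length 1.\<close>

lemma radial_power_homeomorphism:
  fixes \<kappa> :: real
  assumes k: "0 < \<kappa>"
  defines "f \<equiv> \<lambda>z. of_real (rel_radius z powr \<kappa>) * sgn z"
    and "g \<equiv> \<lambda>w. of_real (cmod w powr (1 / \<kappa>) * q (ang w)) * sgn w"
  shows "homeomorphism UNIV UNIV f g" and "\<And>w. q (ang (g w)) = q (ang w) \<or> w = 0"
    and "\<And>w. w \<noteq> 0 \<Longrightarrow> ang (g w) - ang w \<in> \<int>" and "\<And>w. cmod (g w) = cmod w powr (1 / \<kappa>) * q (ang w)"
proof -
  have gpos: "0 < rel_radius z" if "z \<noteq> 0" for z unfolding rel_radius_def using that pos by simp
  have fr: "f z = of_real (rel_radius z powr \<kappa>) * ray (ang z)" if "z \<noteq> 0" for z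
    unfolding f_def by (simp only: sgn_polar[OF that])
  have gr: "g w = of_real (cmod w powr (1 / \<kappa>) * q (ang w)) * ray (ang w)" if "w \<noteq> 0" for w
    unfolding g_def by (simp only: sgn_polar[OF that])
  have f0: "f 0 = 0" and g0: "g 0 = 0" by (simp_all add: f_def g_def)
  have qf: "q (ang (f z)) = q (ang z)" "cmod (f z) = rel_radius z powr \<kappa>" "sgn (f z) = sgn z" if "z \<noteq> 0" for z
  proof -
    have p: "0 < rel_radius z powr \<kappa>" using gpos[OF that] by simp
    show "q (ang (f z)) = q (ang z)" unfolding fr[OF that] by (rule q_ang_ray[OF p])
    show "cmod (f z) = rel_radius z powr \<kappa>" unfolding fr[OF that] using p by (simp add: norm_mult)
    show "sgn (f z) = sgn z" using p that by (simp add: f_def sgn_mult sgn_of_real)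
  qed
  have pg: "0 < cmod w powr (1 / \<kappa>) * q (ang w)" if "w \<noteq> 0" for w using that pos by simp
  have ag: "ang (g w) - ang w \<in> \<int>" if "w \<noteq> 0" for w unfolding gr[OF that] by (rule ang_ray[OF pg[OF that]])
  then show "\<And>w. w \<noteq> 0 \<Longrightarrow> ang (g w) - ang w \<in> \<int>" .
  have qg: "q (ang (g w)) = q (ang w)" if "w \<noteq> 0" for w by (rule per[OF ag[OF that]])
  then show "\<And>w. q (ang (g w)) = q (ang w) \<or> w = 0" by blast
  have ng: "cmod (g w) = cmod w powr (1 / \<kappa>) * q (ang w)" for w
    using pg[of w] pos[of "ang w"] by (cases "w = 0") (auto simp: gr g0 norm_mult)
  then show "\<And>w. cmod (g w) = cmod w powr (1 / \<kappa>) * q (ang w)" .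
  have sg: "sgn (g w) = sgn w" if "w \<noteq> 0" for w
    using pos[of "ang w"] that by (simp add: g_def sgn_mult sgn_of_real)
  have gf: "g (f z) = z" for z
  proof (cases "z = 0")
    case False
    have "cmod (f z) powr (1 / \<kappa>) * q (ang (f z)) = cmod z"
      using qf[OF False] gpos[OF False] k pos[of "ang z"] by (simp add: powr_powr rel_radius_def)
    moreover have "of_real (cmod z) * sgn z = z" by (simp only: sgn_polar[OF False] polar[symmetric])
    ultimately show ?thesis using qf(3)[OF False] by (simp only: g_def)
  qed (simp add: f0 g0)
  have fg: "f (g w) = w" for w
  proof (cases "w = 0")
    case False
    have "rel_radius (g w) = cmod w powr (1 / \<kappa>)"
      unfolding rel_radius_def ng qg[OF False] using pos[of "ang w"] by simp
    then have "rel_radius (g w) powr \<kappa> = cmod w" using False k by (simp add: powr_powr)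
    then show ?thesis using sg[OF False] polar[of w] sgn_polar[OF False] by (simp add: f_def)
  qed (simp add: f0 g0)
  obtain m K where mK: "0 < m" "\<And>x. m \<le> q x" "\<And>x. q x \<le> K" using bounds by blast
  have cf: "continuous_on UNIV f"
    unfolding f_def
  proof (rule continuous_radial)
    show "continuous_on (- {0}) (\<lambda>z. rel_radius z powr \<kappa>)"
      using k by (intro continuous_on_powr' continuous_on_subset[OF continuous_rel_radius] continuous_intros)
        (auto simp: rel_radius_nonneg)
    show "\<bar>rel_radius z powr \<kappa>\<bar> \<le> (1 / m) powr \<kappa> * cmod z powr \<kappa>" for z
    proof -
      have "rel_radius z \<le> 1 / m * cmod z" using mK pos[of "ang z"] by (simp add: rel_radius_def frac_le)
      then have "rel_radius z powr \<kappa> \<le> (1 / m * cmod z) powr \<kappa>" using k rel_radius_nonneg by (intro powr_mono2) auto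
      also have "\<dots> = (1 / m) powr \<kappa> * cmod z powr \<kappa>" by (rule powr_mult)
      finally show ?thesis by simp
    qed
  qed (rule k)
  have cg: "continuous_on UNIV g"
    unfolding g_def
  proof (rule continuous_radial)
    show "continuous_on (- {0}) (\<lambda>w. cmod w powr (1 / \<kappa>) * q (ang w))"
      using k by (intro continuous_intros continuous_q_ang) auto
    show "\<bar>cmod w powr (1 / \<kappa>) * q (ang w)\<bar> \<le> K * cmod w powr (1 / \<kappa>)" for w
      using mK(3)[of "ang w"] pos[of "ang w"] by (simp add: abs_mult mult.commute mult_right_mono)
  qed (use k in simp)
  show "homeomorphism UNIV UNIV f g"
    unfolding homeomorphism_def using cf cg fg gf by (auto simp: surj_def) metis+
qed

end

lemma ang_0 [simp]: "ang 0 = 0" by (simp add: ang_def Arg_zero)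

lemma powr_le_powr_iff:
  fixes x y a :: real
  assumes "0 < a" "0 \<le> x" "0 \<le> y" shows "x powr a \<le> y powr a \<longleftrightarrow> x \<le> y"
  using powr_less_mono2[of a y x] powr_mono2[of a x y] assms by force

lemma polar_set_eq:
  assumes per: "\<And>x y. x - y \<in> \<int> \<Longrightarrow> b x = b y" and "0 \<le> c" and cb: "\<And>\<theta>. c \<le> b \<theta>"
  shows "{of_real r * exp (2 * of_real pi * \<i> * of_real \<theta>) | r \<theta>. 0 \<le> \<theta> \<and> \<theta> \<le> 1 \<and> c \<le> r \<and> r \<le> b \<theta>}
    = {z. c \<le> cmod z \<and> cmod z \<le> b (ang z)}"
  unfolding ray_def[symmetric]
proof (intro set_eqI iffI)
  fix z assume "z \<in> {of_real r * ray \<theta> | r \<theta>. 0 \<le> \<theta> \<and> \<theta> \<le> 1 \<and> c \<le> r \<and> r \<le> b \<theta>}"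
  then obtain r \<theta> where z: "z = of_real r * ray \<theta>" "c \<le> r" "r \<le> b \<theta>" by blast
  show "z \<in> {z. c \<le> cmod z \<and> cmod z \<le> b (ang z)}"
  proof (cases "r = 0")
    case True
    then show ?thesis using z assms(2) order.trans[OF assms(2) cb[of 0]] by simp
  next
    case False
    then have "ang z - \<theta> \<in> \<int>" unfolding z(1) using z(2) assms(2) by (intro ang_ray) simp
    then have "b (ang z) = b \<theta>" by (rule per)
    then show ?thesis using z assms(2) by (simp add: norm_mult)
  qed
next
  fix z assume z: "z \<in> {z. c \<le> cmod z \<and> cmod z \<le> b (ang z)}"
  let ?t = "frac (ang z)"
  have i: "?t - ang z \<in> \<int>" by (simp add: frac_def)
  have "z = of_real (cmod z) * ray ?t" using polar[of z] i ray_eq_iff[of ?t "ang z"] by simp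
  moreover have "b ?t = b (ang z)" by (rule per[OF i])
  moreover have "0 \<le> ?t" "?t \<le> 1" using frac_lt_1[of "ang z"] by (simp_all add: less_imp_le)
  ultimately show "z \<in> {of_real r * ray \<theta> | r \<theta>. 0 \<le> \<theta> \<and> \<theta> \<le> 1 \<and> c \<le> r \<and> r \<le> b \<theta>}"
    using z by (intro CollectI exI[of _ "cmod z"] exI[of _ ?t]) auto
qed

section \<open>Hair functions and their standard models\<close>

lemma hair_function_periodic:
  assumes "hair_function R" "x - y \<in> \<int>" shows "R x = R y"
proof -
  have nat: "R (t + real n) = R t" for t n
  proof (induction n)
    case (Suc n)
    then show ?case using assms(1)[unfolded hair_function_def, THEN conjunct1, rule_format, of "t + real n"]
      by (simp add: ac_simps)
  qed simp
  obtain k where k: "x - y = of_int k" using assms(2) by (rule Ints_cases)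
  show ?thesis
  proof (cases "0 \<le> k")
    case True
    then have "x = y + real (nat k)" using k by simp
    then show ?thesis using nat by simp
  next
    case False
    then have "y = x + real (nat (- k))" using k by simp
    then show ?thesis using nat by simp
  qed
qed

text \<open>Upper semicontinuity bounds the upper limit from above; the other inequality needs a
  single sequence from the given side along which the values converge to \<open>R t\<close>.\<close>

lemma Limsup_eq_if_approached:
  fixes R :: "real \<Rightarrow> real"
  assumes usc: "\<And>y. R t < y \<Longrightarrow> \<forall>\<^sub>F s in at t. R s < y"
    and le: "F \<le> at t" and s: "filterlim s F sequentially" "(\<lambda>k. R (s k)) \<longlonglongrightarrow> R t"
  shows "Limsup F (\<lambda>\<theta>. ereal (R \<theta>)) = ereal (R t)"
proof (rule antisym)
  show "Limsup F (\<lambda>\<theta>. ereal (R \<theta>)) \<le> ereal (R t)"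
    unfolding Limsup_le_iff
  proof (intro allI impI)
    fix y assume y: "ereal (R t) < y"
    obtain z where z: "ereal (R t) < ereal z" "ereal z < y" using ereal_dense2[OF y] by blast
    have "\<forall>\<^sub>F s in F. R s < z" using usc[of z] z(1) le by (auto intro: filter_leD)
    then show "\<forall>\<^sub>F s in F. ereal (R s) < y"
      by (rule eventually_mono) (rule less_trans[OF _ z(2)], simp)
  qed
  show "ereal (R t) \<le> Limsup F (\<lambda>\<theta>. ereal (R \<theta>))"
  proof (rule ccontr)
    assume "\<not> ?thesis"
    then have "Limsup F (\<lambda>\<theta>. ereal (R \<theta>)) < ereal (R t)" by simp
    then obtain z where z: "Limsup F (\<lambda>\<theta>. ereal (R \<theta>)) < ereal z" "ereal z < ereal (R t)"
      using ereal_dense2 by blast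
    have "\<forall>\<^sub>F \<theta> in F. ereal (R \<theta>) < ereal z" by (rule Limsup_lessD[OF z(1)])
    then have "\<forall>\<^sub>F k in sequentially. ereal (R (s k)) < ereal z" by (rule eventually_compose_filterlim[OF _ s(1)])
    then have "\<forall>\<^sub>F k in sequentially. R (s k) \<le> z" by (rule eventually_mono) simp
    then have "R t \<le> z" by (intro tendsto_upperbound[OF s(2)]) auto
    with z(2) show False by simp
  qed
qed

text \<open>One sequence \<open>d\<close> serves all points and both sides: it will be
  \<open>rprod 0\<close>, the translation lengths of the return maps.\<close>

lemma hair_functionI:
  assumes "\<And>t. R (t + 1) = R t" "\<And>t. R t \<in> {0..1}" "closure {t. R t = 0} = UNIV" "closure {t. R t > 0} = UNIV"
    and usc: "\<And>t y. R t < y \<Longrightarrow> \<forall>\<^sub>F s in at t. R s < y"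
    and d: "\<And>k. 0 < d k" "d \<longlonglongrightarrow> 0"
    and app: "\<And>t. (\<lambda>k. R (t + d k)) \<longlonglongrightarrow> R t" "\<And>t. (\<lambda>k. R (t - d k)) \<longlonglongrightarrow> R t"
  shows "hair_function R"
proof -
  have nz: "d k \<noteq> 0" for k using d(1)[of k] by simp
  have r: "filterlim (\<lambda>k. t + d k) (at_right t) sequentially" for t
    unfolding filterlim_at using d tendsto_add[OF tendsto_const[of t] d(2)] by (auto simp: nz)
  have l: "filterlim (\<lambda>k. t - d k) (at_left t) sequentially" for t
    unfolding filterlim_at using d tendsto_diff[OF tendsto_const[of t] d(2)] by (auto simp: nz)
  have "Limsup (at_right t) (\<lambda>\<theta>. ereal (R \<theta>)) = ereal (R t)" for t
    by (rule Limsup_eq_if_approached[OF usc at_le[OF subset_UNIV] r app(1)])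
  moreover have "Limsup (at_left t) (\<lambda>\<theta>. ereal (R \<theta>)) = ereal (R t)" for t
    by (rule Limsup_eq_if_approached[OF usc at_le[OF subset_UNIV] l app(2)])
  ultimately show ?thesis unfolding hair_function_def using assms(1-4) by blast
qed

lemma cantor_bouquet_region:
  assumes R: "hair_function R" and K: "0 < K"
  shows "cantor_bouquet {z. cmod z \<le> K * R (ang z)}"
proof -
  let ?f = "\<lambda>z. of_real (1 / K) * z :: complex" and ?g = "\<lambda>z. of_real K * z :: complex"
  have R0: "0 \<le> R t" for t using R unfolding hair_function_def by auto
  have fg: "?f (?g w) = w" "?g (?f w) = w" for w using K by simp_all
  have "homeomorphism UNIV UNIV ?f ?g"
    unfolding homeomorphism_def
    by (intro conjI ballI continuous_intros fg surjI[where f = ?f and g = ?g] surjI[where f = ?g and g = ?f])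
  moreover have "?f ` {z. cmod z \<le> K * R (ang z)} = {z. 0 \<le> cmod z \<and> cmod z \<le> R (ang z)}"
  proof -
    have ang: "R (ang (?g w)) = R (ang w)" for w
    proof (cases "w = 0")
      case False
      have "?g w = of_real (K * cmod w) * ray (ang w)" using polar[of w] by (metis mult.assoc of_real_mult)
      then show ?thesis using K False by (simp only:) (intro hair_function_periodic[OF R] ang_ray; simp)
    qed simp
    have gA: "?g w \<in> {z. cmod z \<le> K * R (ang z)} \<longleftrightarrow> cmod w \<le> R (ang w)" for w
      using K by (simp only: mem_Collect_eq ang) (simp add: norm_mult)
    show ?thesis
    proof (intro set_eqI iffI)
      fix w assume "w \<in> ?f ` {z. cmod z \<le> K * R (ang z)}"
      then obtain z where "z \<in> {z. cmod z \<le> K * R (ang z)}" "w = ?f z" by blast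
      then have "?g w \<in> {z. cmod z \<le> K * R (ang z)}" by (simp only: fg)
      then show "w \<in> {z. 0 \<le> cmod z \<and> cmod z \<le> R (ang z)}" unfolding gA by simp
    next
      fix w assume "w \<in> {z. 0 \<le> cmod z \<and> cmod z \<le> R (ang z)}"
      then have "?g w \<in> {z. cmod z \<le> K * R (ang z)}" unfolding gA by simp
      from imageI[OF this, of ?f] show "w \<in> ?f ` {z. cmod z \<le> K * R (ang z)}" by (simp only: fg)
    qed
  qed
  moreover have "{of_real r * exp (2 * of_real pi * \<i> * of_real \<theta>) | r \<theta>. 0 \<le> \<theta> \<and> \<theta> \<le> 1 \<and> 0 \<le> r \<and> r \<le> R \<theta>}
      = {z. 0 \<le> cmod z \<and> cmod z \<le> R (ang z)}"
    by (rule polar_set_eq[OF hair_function_periodic[OF R]]) (use R0 in auto)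
  ultimately show ?thesis
    unfolding cantor_bouquet_def ambiently_homeomorphic_def
    by (intro exI[of _ R] conjI R exI[of _ ?f] exI[of _ ?g]) (simp_all only:)
qed

lemma (in radius_loop) one_sided_hairy_jordan_curve_band:
  assumes R: "hair_function R" and k: "0 < \<kappa>"
  shows "one_sided_hairy_jordan_curve {z. q (ang z) \<le> cmod z \<and> cmod z \<le> q (ang z) * (1 + R (ang z)) powr (1 / \<kappa>)}"
    (is "one_sided_hairy_jordan_curve ?A")
proof -
  let ?f = "\<lambda>z. of_real (rel_radius z powr \<kappa>) * sgn z"
  let ?g = "\<lambda>w. of_real (cmod w powr (1 / \<kappa>) * q (ang w)) * sgn w"
  note h = radial_power_homeomorphism[OF k]
  have R0: "0 \<le> R t" for t using R unfolding hair_function_def by auto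
  have gA: "?g w \<in> ?A \<longleftrightarrow> 1 \<le> cmod w \<and> cmod w \<le> 1 + R (ang w)" for w
  proof (cases "w = 0")
    case True
    then show ?thesis using pos[of 0] by simp
  next
    case False
    have q: "q (ang (?g w)) = q (ang w)" using h(2)[of w] False by simp
    have Rw: "R (ang (?g w)) = R (ang w)" by (rule hair_function_periodic[OF R h(3)[OF False]])
    have p: "0 < q (ang w)" by (rule pos)
    have "1 \<le> cmod w powr (1 / \<kappa>) \<longleftrightarrow> 1 \<le> cmod w"
      using powr_le_powr_iff[of "1/\<kappa>" 1 "cmod w"] k by simp
    moreover have "cmod w powr (1 / \<kappa>) \<le> (1 + R (ang w)) powr (1 / \<kappa>) \<longleftrightarrow> cmod w \<le> 1 + R (ang w)"
      using k R0[of "ang w"] by (intro powr_le_powr_iff) auto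
    ultimately show ?thesis
      unfolding mem_Collect_eq h(4) q Rw using p by (simp add: mult.commute[of "q (ang w)"])
  qed
  have fg: "?f (?g w) = w" "?g (?f w) = w" for w using h(1) unfolding homeomorphism_def by auto
  have "?f ` ?A = {z. 1 \<le> cmod z \<and> cmod z \<le> 1 + R (ang z)}"
  proof (intro set_eqI iffI)
    fix w assume "w \<in> ?f ` ?A"
    then obtain z where z: "z \<in> ?A" "w = ?f z" by blast
    have "?g w = z" unfolding z(2) by (rule fg)
    then show "w \<in> {z. 1 \<le> cmod z \<and> cmod z \<le> 1 + R (ang z)}" using gA[of w] z(1) by simp
  next
    fix w assume "w \<in> {z. 1 \<le> cmod z \<and> cmod z \<le> 1 + R (ang z)}"
    then have "?g w \<in> ?A" unfolding gA by simp
    from imageI[OF this, of ?f] show "w \<in> ?f ` ?A" by (simp only: fg)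
  qed
  moreover have "{of_real r * exp (2 * of_real pi * \<i> * of_real \<theta>) | r \<theta>. 0 \<le> \<theta> \<and> \<theta> \<le> 1 \<and> 1 \<le> r \<and> r \<le> 1 + R \<theta>}
      = {z. 1 \<le> cmod z \<and> cmod z \<le> 1 + R (ang z)}"
    by (rule polar_set_eq) (use R0 hair_function_periodic[OF R] in auto)
  ultimately show ?thesis
    unfolding one_sided_hairy_jordan_curve_def ambiently_homeomorphic_def
    by (intro exI[of _ R] conjI R exI[of _ ?f] exI[of _ ?g] h(1)) (simp_all only:)
qed

text \<open>Take a slightly larger radius and a nearby direction in which the region reaches only up
  to \<open>q\<close>; continuity keeps \<open>q\<close> below the new radius there.\<close>

lemma region_closure_complement:
  fixes q Q :: "real \<Rightarrow> real"
  assumes per: "\<And>x y. x - y \<in> \<int> \<Longrightarrow> Q x = Q y"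
    and cont: "continuous_on UNIV q" and dense: "closure {\<theta>. Q \<theta> = q \<theta>} = UNIV"
    and z: "q (ang z) \<le> cmod z"
  shows "z \<in> closure (- {z. cmod z \<le> Q (ang z)})"
  unfolding closure_approachable
proof (intro allI impI)
  fix \<epsilon> :: real assume e: "0 < \<epsilon>"
  define \<rho> where "\<rho> = cmod z + \<epsilon> / 2"
  have \<rho>: "0 < \<rho>" "q (ang z) < \<rho>" unfolding \<rho>_def using e z norm_ge_zero[of z] by linarith+
  have "open {\<theta>. q \<theta> < \<rho> \<and> cmod (of_real \<rho> * (ray \<theta> - ray (ang z))) < \<epsilon> / 2}" (is "open ?S")
    unfolding Collect_conj_eq
    by (intro open_Int open_Collect_less cont continuous_intros continuous_ray)
  moreover have "ang z \<in> ?S" using \<rho> e by simp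
  moreover have "ang z \<in> closure {\<theta>. Q \<theta> = q \<theta>}" using dense by simp
  ultimately have "?S \<inter> {\<theta>. Q \<theta> = q \<theta>} \<noteq> {}"
    using open_Int_closure_eq_empty[of ?S "{\<theta>. Q \<theta> = q \<theta>}"] by blast
  then obtain t where t: "q t < \<rho>" "cmod (of_real \<rho> * (ray t - ray (ang z))) < \<epsilon> / 2" "Q t = q t" by auto
  let ?y = "of_real \<rho> * ray t"
  have "Q (ang ?y) = Q t" by (rule per[OF ang_ray[OF \<rho>(1)]])
  then have "?y \<in> - {z. cmod z \<le> Q (ang z)}" using t \<rho> by (simp add: norm_mult)
  moreover have "dist ?y z < \<epsilon>"
  proof -
    have alg: "(m + h) * s - m * a = (m + h) * (s - a) + h * a" for m h s a :: complex
      by (simp add: algebra_simps)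
    have "?y - z = of_real \<rho> * ray t - of_real (cmod z) * ray (ang z)" by (simp only: polar[symmetric])
    also have "\<dots> = of_real \<rho> * (ray t - ray (ang z)) + of_real (\<epsilon> / 2) * ray (ang z)"
      unfolding \<rho>_def of_real_add by (rule alg)
    finally have "dist ?y z \<le> cmod (of_real \<rho> * (ray t - ray (ang z))) + cmod (of_real (\<epsilon> / 2) * ray (ang z))"
      unfolding dist_norm by (simp only: norm_triangle_ineq)
    also have "cmod (of_real (\<epsilon> / 2) * ray (ang z)) = \<epsilon> / 2" using e by (simp add: norm_mult)
    finally show ?thesis using t(2) by simp
  qed
  ultimately show "\<exists>y\<in>- {z. cmod z \<le> Q (ang z)}. dist y z < \<epsilon>" by blast
qed

lemma frontier_region_dense_zeros:
  fixes Q :: "real \<Rightarrow> real"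
  assumes "\<And>x y. x - y \<in> \<int> \<Longrightarrow> Q x = Q y" "closure {\<theta>. Q \<theta> = 0} = UNIV" "closed {z. cmod z \<le> Q (ang z)}"
  shows "frontier {z. cmod z \<le> Q (ang z)} = {z. cmod z \<le> Q (ang z)}"
  using region_closure_complement[of Q "\<lambda>_. 0", OF assms(1) continuous_on_const assms(2) norm_ge_zero]
  unfolding frontier_closures closure_closed[OF assms(3)] by blast

lemma (in radius_loop) frontier_region_band:
  assumes "\<And>x y. x - y \<in> \<int> \<Longrightarrow> Q x = Q y" "closure {\<theta>. Q \<theta> = q \<theta>} = UNIV" "closed {z. cmod z \<le> Q (ang z)}"
    and qQ: "\<And>\<theta>. q \<theta> \<le> Q \<theta>"
  shows "frontier {z. cmod z \<le> Q (ang z)} = {z. q (ang z) \<le> cmod z \<and> cmod z \<le> Q (ang z)}"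
proof -
  let ?M = "{z. cmod z \<le> Q (ang z)}"
  have "{z. rel_radius z < 1} \<subseteq> ?M" using qQ unfolding rel_radius_less_iff by (auto intro: less_imp_le less_le_trans)
  then have "{z. rel_radius z < 1} \<subseteq> interior ?M" by (rule interior_maximal[OF _ open_rel_radius_less])
  then have "q (ang z) \<le> cmod z" if "z \<in> closure (- ?M)" for z
    using that by (auto simp: closure_complement rel_radius_less_iff subset_iff not_less[symmetric])
  then show ?thesis
    using region_closure_complement[of Q q, OF assms(1) cont assms(2)]
    unfolding frontier_closures closure_closed[OF assms(3)] by blast
qed

lemma irrational_rotation_dense:
  fixes E :: "real set"
  assumes s: "s \<notin> \<rat>" and E: "\<And>x. x + s \<in> E \<longleftrightarrow> x \<in> E" "\<And>x. x + 1 \<in> E \<longleftrightarrow> x \<in> E" and ne: "x0 \<in> E"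
  shows "closure E = UNIV"
proof -
  have nat: "x + real n * u \<in> E" if "\<And>x. x \<in> E \<Longrightarrow> x + u \<in> E" "x \<in> E" for x u n
  proof (induction n)
    case (Suc n)
    have "x + real (Suc n) * u = (x + real n * u) + u" by (simp add: algebra_simps)
    then show ?case using that(1)[OF Suc] by (simp only:)
  qed (use that in simp)
  have int: "x + of_int k * u \<in> E" if u: "\<And>x. x + u \<in> E \<longleftrightarrow> x \<in> E" "x \<in> E" for x u k
  proof (cases "0 \<le> k")
    case True
    then show ?thesis using nat[of u x "nat k"] u by simp
  next
    case False
    have "x + - u \<in> E" if "x \<in> E" for x using u(1)[of "x - u"] that by simp
    then show ?thesis using nat[of "- u" x "nat (- k)"] u(2) False by simp
  qed
  have "y \<in> closure E" for y
    unfolding closure_approachable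
  proof (intro allI impI)
    fix e :: real assume "0 < e"
    then obtain h k where hk: "k > 0" "\<bar>of_int k * s - of_int h - (y - x0)\<bar> < e"
      using sequence_of_fractional_parts_is_dense[OF s] by blast
    have "x0 + of_int k * s + of_int (- h) * 1 \<in> E"
      using int[of 1 "x0 + of_int k * s" "- h"] int[of s x0 k] E ne by blast
    then show "\<exists>x\<in>E. dist x y < e" using hk by (intro bexI) (auto simp: dist_real_def algebra_simps)
  qed
  then show ?thesis by blast
qed

section \<open>The model in terms of floor functions\<close>

lemma norm_sq_diff_exp:
  "(cmod (exp (of_real a) - exp (Complex b v)))\<^sup>2 = 2 * exp (a + b) * (cosh (b - a) - cos v)"
proof -
  have "(cmod (exp (of_real a) - exp (Complex b v)))\<^sup>2 = (exp a - exp b * cos v)\<^sup>2 + (exp b * sin v)\<^sup>2"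
    unfolding cmod_power2 by (simp add: Re_exp Im_exp exp_of_real)
  also have "\<dots> = exp a * exp a + exp b * exp b - 2 * exp a * exp b * cos v"
    using sin_cos_squared_add[of v] by algebra
  also have "\<dots> = 2 * exp (a + b) * (cosh (b - a) - cos v)"
    by (simp add: cosh_field_def exp_add exp_diff field_simps)
  finally show ?thesis .
qed

lemma Ymap_hgt:
  assumes r: "0 < r" and w: "-1 \<le> Im w"
  shows "Ymap r w = Complex (r * Re w) (hgt r (Re w) (Im w))"
proof -
  let ?U = "pi * r * (3 + 2 * Im w)" and ?v = "pi * r * (1 + 2 * Re w)"
  define X where "X = exp (- 3 * of_real pi * of_real r) - exp (- of_real pi * of_real r * \<i>) * exp (- 2 * of_real pi * of_real r * \<i> * w)"
  define D where "D = exp (- 3 * of_real pi * of_real r) - exp (of_real pi * of_real r * \<i>)"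
  have "X = exp (of_real (- 3 * pi * r)) - exp (Complex (2 * pi * r * Im w) (- ?v))"
  proof -
    have "- of_real pi * of_real r * \<i> + - 2 * of_real pi * of_real r * \<i> * w = Complex (2 * pi * r * Im w) (- ?v)"
      by (simp add: complex_eq_iff algebra_simps)
    then show ?thesis unfolding X_def by (simp flip: exp_add)
  qed
  moreover have U: "2 * pi * r * Im w - - 3 * pi * r = ?U" by (simp add: algebra_simps)
  ultimately have X: "(cmod X)\<^sup>2 = 2 * exp (- 3 * pi * r + 2 * pi * r * Im w) * (cosh ?U - cos ?v)"
    by (simp only: norm_sq_diff_exp cos_minus U)
  have "D = exp (of_real (- 3 * pi * r)) - exp (Complex 0 (pi * r))"
  proof -
    have "of_real pi * of_real r * \<i> = Complex 0 (pi * r)" by (simp add: complex_eq_iff)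
    then show ?thesis unfolding D_def by simp
  qed
  then have D: "(cmod D)\<^sup>2 = 2 * exp (- 3 * pi * r) * (cosh (3 * pi * r) - cos (pi * r))"
    by (simp only: norm_sq_diff_exp) simp
  note pos = hgt_arg_pos[OF r w]
  have nz: "cmod X \<noteq> 0" "cmod D \<noteq> 0"
    using X D pos(1)[of ?v] pos(2) by auto
  have lnX: "2 * ln (cmod X) = ln 2 + (- 3 * pi * r + 2 * pi * r * Im w) + ln (cosh ?U - cos ?v)"
  proof -
    have "2 * ln (cmod X) = ln ((cmod X)\<^sup>2)" using nz by (simp add: ln_realpow)
    then show ?thesis unfolding X using pos(1)[of ?v] by (simp add: ln_mult_pos)
  qed
  have lnD: "2 * ln (cmod D) = ln 2 - 3 * pi * r + ln (cosh (3 * pi * r) - cos (pi * r))"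
  proof -
    have "2 * ln (cmod D) = ln ((cmod D)\<^sup>2)" using nz by (simp add: ln_realpow)
    then show ?thesis unfolding D using pos(2) by (simp add: ln_mult_pos)
  qed
  have "cmod (X / D) = cmod X / cmod D" by (simp add: norm_divide)
  moreover have "ln (cmod X / cmod D) = ln (cmod X) - ln (cmod D)" using nz by (simp add: ln_div)
  ultimately have "ln (cmod (X / D)) / (2 * pi) = hgt r (Re w) (Im w)"
    unfolding hgt_alt[OF r w] using lnX lnD by (simp add: field_simps)
  moreover have "Ymap r w = Complex (r * Re w) (ln (cmod (X / D)) / (2 * pi))"
    unfolding Ymap_def X_def[symmetric] D_def[symmetric] by (simp add: complex_eq_iff)
  ultimately show ?thesis by simp
qed

text \<open>The height derivative is at least \<open>r / 2\<close>, so climbing by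
  \<open>2 / r\<close> times the missing amount is enough.\<close>

lemma hgt_surj:
  assumes r: "0 < r" and t: "-1 \<le> t" and s: "hgt r x t \<le> s"
  shows "\<exists>u\<ge>t. hgt r x u = s"
proof -
  define T where "T = t + 2 / r * (s - hgt r x t)"
  have T: "t \<le> T" using r s by (simp add: T_def)
  have "hgt r x t - r / 2 * t \<le> hgt r x T - r / 2 * T"
  proof (rule DERIV_nonneg_imp_nondecreasing[OF T])
    fix u assume "t \<le> u" "u \<le> T"
    then have u: "-1 \<le> u" using t by simp
    let ?d = "sinh (pi * r * (3 + 2 * u)) / (cosh (pi * r * (3 + 2 * u)) - cos (pi * r * (1 + 2 * x)))"
    have "0 \<le> ?d" using hgt_arg_pos(1)[OF r u] r u by (intro divide_nonneg_pos) auto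
    moreover have "0 \<le> r / 2 * (1 + d) - r / 2" if "0 \<le> d" for d using that r by (simp add: distrib_left)
    ultimately have "0 \<le> r / 2 * (1 + ?d) - r / 2" by blast
    moreover have "((\<lambda>u. hgt r x u - r / 2 * u) has_real_derivative (r / 2 * (1 + ?d) - r / 2)) (at u)"
      using hgt_deriv_height[OF r u] by (auto intro!: derivative_eq_intros)
    ultimately show "\<exists>y. ((\<lambda>u. hgt r x u - r / 2 * u) has_real_derivative y) (at u) \<and> 0 \<le> y" by blast
  qed
  then have "s \<le> hgt r x T" using r unfolding T_def by (simp add: algebra_simps)
  moreover have "continuous_on {t..T} (\<lambda>u. hgt r x u)"
    using t by (intro continuous_on_hgt[OF r] continuous_intros) auto
  ultimately obtain u where "t \<le> u" "u \<le> T" "hgt r x u = s"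
    using IVT'[of "\<lambda>u. hgt r x u" t s T] s T by blast
  then show ?thesis by blast
qed

lemma scaled_interval:
  fixes a r :: real assumes "0 < r"
  shows "a / r \<in> {0..1 / r} \<longleftrightarrow> a \<in> {0..1}" "a / r \<in> {0..1 / r - 1} \<longleftrightarrow> a \<in> {0..1 - r}"
    "a / r \<in> {1 / r - 1..1 / r} \<longleftrightarrow> a \<in> {1 - r..1}"
proof -
  have e: "1 / r - 1 = (1 - r) / r" using assms by (simp add: diff_divide_distrib)
  show "a / r \<in> {0..1 / r} \<longleftrightarrow> a \<in> {0..1}" "a / r \<in> {0..1 / r - 1} \<longleftrightarrow> a \<in> {0..1 - r}"
    "a / r \<in> {1 / r - 1..1 / r} \<longleftrightarrow> a \<in> {1 - r..1}"
    unfolding e using assms by (auto simp: divide_le_cancel zero_le_divide_iff)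
qed

definition strip :: "real set \<Rightarrow> (real \<Rightarrow> real) \<Rightarrow> complex set" where
  "strip X g = {w. Re w \<in> X \<and> g (Re w) \<le> Im w}"

lemma strip_Un: "strip X g \<union> strip Y g = strip (X \<union> Y) g"
  and strip_UN: "(\<Union>l\<in>L. strip (Z l) g) = strip (\<Union>l\<in>L. Z l) g"
  by (auto simp: strip_def)

context
  fixes \<alpha> :: real assumes irr: "\<alpha> \<notin> \<rat>"
begin

interpretation nearest_cf "cf_alpha \<alpha>" "\<lambda>n. of_int (cf_eps \<alpha> n)" by (rule nearest_cf_cf[OF irr])

abbreviation (input) "al \<equiv> cf_alpha \<alpha>"
abbreviation (input) "ep \<equiv> \<lambda>n. real_of_int (cf_eps \<alpha> n)"

text \<open>The map \<open>- cnj\<close> flips the real part and keeps the imaginary part, so the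
  factor \<open>- ep n\<close> covers both signs. On each vertical line the height map is increasing
  and onto a half-line, so the image of a half-line is again one.\<close>

lemma Yn_image:
  assumes g: "admissible (Suc n) g" and X: "X \<subseteq> {0..1 / al n}"
  shows "translate (of_int l) (Yn \<alpha> n ` strip X g) = strip {x. - ep n * (x - of_int l) / al n \<in> X} (lift n g)"
proof -
  have Y: "Yn \<alpha> n w = Complex (- ep n * (al n * Re w)) (hgt (al n) (Re w) (Im w))" if "w \<in> strip X g" for w
  proof -
    have "-1 \<le> Im w" using that admissibleD(1)[OF g, of "Re w"] by (auto simp: strip_def)
    then have "Ymap (al n) w = Complex (al n * Re w) (hgt (al n) (Re w) (Im w))" by (intro Ymap_hgt r_pos)
    then show ?thesis using cf_eps_cases[OF irr, of n] by (auto simp: Yn_def complex_eq_iff)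
  qed
  have L: "lift n g (of_int l - ep n * (al n * y)) = hgt (al n) y (g y)" if "y \<in> X" for y
    using that X by (intro lift_eq[OF g]) (auto simp: algebra_simps e_sq)
  show ?thesis
  proof (intro set_eqI iffI)
    fix z assume "z \<in> translate (of_int l) (Yn \<alpha> n ` strip X g)"
    then obtain w where w: "w \<in> strip X g" "z = Yn \<alpha> n w + of_int l" by blast
    have re: "Re z = of_int l - ep n * (al n * Re w)" "Im z = hgt (al n) (Re w) (Im w)"
      unfolding w(2) Y[OF w(1)] by simp_all
    have x: "Re w \<in> X" "g (Re w) \<le> Im w" using w(1) by (auto simp: strip_def)
    have "- ep n * (Re z - of_int l) / al n = Re w" using r_nz[of n] by (simp add: re e_sq)
    moreover have "lift n g (Re z) \<le> Im z"
      unfolding re L[OF x(1)] by (rule hgt_mono[OF r_pos admissibleD(1)[OF g] x(2)])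
    ultimately show "z \<in> strip {x. - ep n * (x - of_int l) / al n \<in> X} (lift n g)"
      using x(1) by (simp add: strip_def)
  next
    fix z assume z: "z \<in> strip {x. - ep n * (x - of_int l) / al n \<in> X} (lift n g)"
    define y where "y = - ep n * (Re z - of_int l) / al n"
    have y: "y \<in> X" "lift n g (Re z) \<le> Im z" using z by (auto simp: strip_def y_def)
    have re: "Re z = of_int l - ep n * (al n * y)" using r_nz[of n] by (simp add: y_def e_sq)
    then have "hgt (al n) y (g y) \<le> Im z" using y L[of y] by simp
    then obtain t where t: "g y \<le> t" "hgt (al n) y t = Im z"
      using hgt_surj[OF r_pos admissibleD(1)[OF g]] by blast
    have w: "Complex y t \<in> strip X g" using y t by (simp add: strip_def)
    have "z = Yn \<alpha> n (Complex y t) + of_int l" unfolding Y[OF w] using re t by (simp add: complex_eq_iff)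
    then show "z \<in> translate (of_int l) (Yn \<alpha> n ` strip X g)" using w by blast
  qed
qed

lemma closure_Hprime: "closure Hprime = {w. -1 \<le> Im w}"
proof -
  have "Hprime = {w. \<i> \<bullet> w > -1}" by (simp add: Hprime_def inner_complex_def)
  then show ?thesis using closure_halfspace_gt[of "\<i>" "-1"] by (simp add: inner_complex_def)
qed

text \<open>The pieces tile \<open>{0..1 / al n}\<close>. Its length is a - r or a + r, with a the
  partial quotient and r the next remainder, so one piece is incomplete: it has width 1 - r (from
  \<open>Kpart\<close>) or r (from \<open>Jpart\<close>).\<close>

lemma I_set_strip: "I_set \<alpha> j n = strip {0..1 / al n} (floor_fun (Suc n) j)"
proof (induction j arbitrary: n)
  case 0
  show ?case by (auto simp: closure_Hprime strip_def floor_fun_def)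
next
  case (Suc j)
  let ?g = "floor_fun (Suc (Suc n)) j" and ?r = "al (Suc n)" and ?a = "cf_a \<alpha> n"
  let ?L = "lift (Suc n) ?g"
  have inv: "2 < 1 / ?r" "2 < 1 / al n" by (rule inv_r_gt)+
  have r: "0 < ?r" "?r < 1/2" by (rule r_pos, rule r_less)
  have step: "1 / al n = of_int ?a + ep (Suc n) * ?r" by (rule cf_step[OF irr])
  have K: "Kpart \<alpha> (Suc n) (strip {0..1 / ?r} ?g) = strip {0..1 / ?r - 1} ?g"
    by (auto simp: Kpart_def strip_def)
  have J: "Jpart \<alpha> (Suc n) (strip {0..1 / ?r} ?g) = strip {1 / ?r - 1..1 / ?r} ?g"
    using inv by (auto simp: Jpart_def strip_def)
  have sub: "{0..1 / ?r - 1} \<subseteq> {0..1 / ?r}" "{1 / ?r - 1..1 / ?r} \<subseteq> {0..1 / ?r}" using inv by auto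
  note img = Yn_image[OF admissible_floor[of "Suc (Suc n)" j] subset_refl] Yn_image[OF admissible_floor[of "Suc (Suc n)" j] sub(1)]
    Yn_image[OF admissible_floor[of "Suc (Suc n)" j] sub(2)]
  have Lg: "floor_fun (Suc n) (Suc j) = ?L" by (rule floor_Suc)
  show ?case
  proof (cases "cf_eps \<alpha> (Suc n) = -1")
    case True
    have a: "1 / al n = of_int ?a - ?r" using step True by simp
    have S: "{x. - ep (Suc n) * (x - of_int l) / ?r \<in> {0..1 / ?r}} = {of_int l..of_int l + 1}" for l
      unfolding True by (simp only: of_int_minus of_int_1 minus_minus mult_1 scaled_interval[OF r(1)]) auto
    have S': "{x. - ep (Suc n) * (x - of_int l) / ?r \<in> {0..1 / ?r - 1}} = {of_int l..of_int l + 1 - ?r}" for l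
      unfolding True by (simp only: of_int_minus of_int_1 minus_minus mult_1 scaled_interval[OF r(1)]) auto
    have "I_set \<alpha> (Suc j) n = (\<Union>l\<in>{0..?a - 2}. strip {of_int l..of_int l + 1} ?L)
        \<union> strip {of_int (?a - 1)..of_int (?a - 1) + 1 - ?r} ?L"
      by (simp only: I_set.simps True simp_thms if_True Suc.IH K img S[unfolded True] S'[unfolded True])
    also have "\<dots> = strip ((\<Union>l\<in>{0..?a - 2}. {of_int l..of_int l + 1}) \<union> {of_int (?a - 1)..of_int (?a - 1) + 1 - ?r}) ?L"
      by (simp only: strip_UN strip_Un)
    also have "(\<Union>l\<in>{0..?a - 2}. {of_int l..of_int l + 1}) \<union> {of_int (?a - 1)..of_int (?a - 1) + 1 - ?r} = {0..1 / al n}"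
    proof (intro set_eqI iffI)
      fix x assume "x \<in> (\<Union>l\<in>{0..?a - 2}. {of_int l..of_int l + 1}) \<union> {of_int (?a - 1)..of_int (?a - 1) + 1 - ?r}"
      then consider l where "0 \<le> l" "l \<le> ?a - 2" "of_int l \<le> x" "x \<le> of_int l + 1"
        | "of_int (?a - 1) \<le> x" "x \<le> of_int (?a - 1) + 1 - ?r" by auto
      then show "x \<in> {0..1 / al n}"
      proof cases
        case 1
        then have "0 \<le> real_of_int l" "real_of_int l \<le> of_int ?a - 2" by linarith+
        then show ?thesis using 1 a r by simp
      next
        case 2
        then show ?thesis using a inv r by simp
      qed
    next
      fix x assume x: "x \<in> {0..1 / al n}"
      show "x \<in> (\<Union>l\<in>{0..?a - 2}. {of_int l..of_int l + 1}) \<union> {of_int (?a - 1)..of_int (?a - 1) + 1 - ?r}"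
      proof (cases "of_int (?a - 1) \<le> x")
        case True
        then show ?thesis using x a by simp
      next
        case False
        then have "\<lfloor>x\<rfloor> < ?a - 1" by (simp add: floor_less_iff)
        then have "\<lfloor>x\<rfloor> \<in> {0..?a - 2}" using x by simp
        moreover have "x \<in> {of_int \<lfloor>x\<rfloor>..of_int \<lfloor>x\<rfloor> + 1}"
          using of_int_floor_le[of x] real_of_int_floor_add_one_gt[of x] by (simp add: less_imp_le)
        ultimately show ?thesis by blast
      qed
    qed
    finally show ?thesis unfolding Lg .
  next
    case False
    then have e: "cf_eps \<alpha> (Suc n) = 1" using cf_eps_cases[OF irr] by blast
    have a: "1 / al n = of_int ?a + ?r" using step e by simp
    have S: "{x. - ep (Suc n) * (x - of_int l) / ?r \<in> {0..1 / ?r}} = {of_int l - 1..of_int l}" for l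
      unfolding e by (simp only: of_int_1 mult_minus1 scaled_interval[OF r(1)]) auto
    have S': "{x. - ep (Suc n) * (x - of_int l) / ?r \<in> {1 / ?r - 1..1 / ?r}} = {of_int l - 1..of_int l - 1 + ?r}" for l
      unfolding e by (simp only: of_int_1 mult_minus1 scaled_interval[OF r(1)]) auto
    have "I_set \<alpha> (Suc j) n = (\<Union>l\<in>{1..?a}. strip {of_int l - 1..of_int l} ?L)
        \<union> strip {of_int (?a + 1) - 1..of_int (?a + 1) - 1 + ?r} ?L"
      by (simp only: I_set.simps False if_False Suc.IH J img S S')
    also have "\<dots> = strip ((\<Union>l\<in>{1..?a}. {of_int l - 1..of_int l}) \<union> {of_int (?a + 1) - 1..of_int (?a + 1) - 1 + ?r}) ?L"
      by (simp only: strip_UN strip_Un)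
    also have "(\<Union>l\<in>{1..?a}. {of_int l - 1..of_int l}) \<union> {of_int (?a + 1) - 1..of_int (?a + 1) - 1 + ?r} = {0..1 / al n}"
    proof (intro set_eqI iffI)
      fix x assume "x \<in> (\<Union>l\<in>{1..?a}. {of_int l - 1..of_int l}) \<union> {of_int (?a + 1) - 1..of_int (?a + 1) - 1 + ?r}"
      then consider l where "1 \<le> l" "l \<le> ?a" "of_int l - 1 \<le> x" "x \<le> of_int l"
        | "of_int (?a + 1) - 1 \<le> x" "x \<le> of_int (?a + 1) - 1 + ?r" by auto
      then show "x \<in> {0..1 / al n}"
      proof cases
        case 1
        then have "1 \<le> real_of_int l" "real_of_int l \<le> of_int ?a" by linarith+
        then show ?thesis using 1 a r by simp
      next
        case 2
        then show ?thesis using a inv r by simp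
      qed
    next
      fix x assume x: "x \<in> {0..1 / al n}"
      show "x \<in> (\<Union>l\<in>{1..?a}. {of_int l - 1..of_int l}) \<union> {of_int (?a + 1) - 1..of_int (?a + 1) - 1 + ?r}"
      proof (cases "of_int ?a \<le> x")
        case True
        then show ?thesis using x a by simp
      next
        case False
        then have "\<lfloor>x\<rfloor> < ?a" by (simp add: floor_less_iff)
        then have "\<lfloor>x\<rfloor> + 1 \<in> {1..?a}" using x by simp
        moreover have "x \<in> {of_int (\<lfloor>x\<rfloor> + 1) - 1..of_int (\<lfloor>x\<rfloor> + 1)}"
          using of_int_floor_le[of x] real_of_int_floor_add_one_gt[of x] by (simp add: less_imp_le)
        ultimately show ?thesis by blast
      qed
    qed
    finally show ?thesis unfolding Lg .
  qed
qed

lemma I_minus_set_strip: "I_minus_set \<alpha> (Suc j) = strip {0..1} (floor_fun 0 (Suc j))"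
proof -
  define l :: int where "l = (if cf_eps \<alpha> 0 = -1 then 0 else 1)"
  have l: "(of_int (cf_eps \<alpha> 0) + 1) / 2 = complex_of_int l"
    using cf_eps_cases[OF irr, of 0] by (auto simp: l_def)
  have r: "0 < al 0" by (rule r_pos)
  have "{x. - ep 0 * (x - of_int l) / al 0 \<in> {0..1 / al 0}} = {0..1}"
    using cf_eps_cases[OF irr, of 0] unfolding scaled_interval[OF r] by (auto simp: l_def)
  then show ?thesis
    unfolding I_minus_set_def l diff_Suc_1 I_set_strip
    using Yn_image[OF admissible_floor[of "Suc 0" j] subset_refl] by (simp only: floor_Suc)
qed

text \<open>The conjugation in \<open>M_set\<close> reverses the angle, hence
  \<open>- \<theta>\<close>. An infimum of exponentials, instead of the exponential of a supremum,
  gives the value 0 where the floors are unbounded.\<close>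

definition outer_radius :: "real \<Rightarrow> real" where
  "outer_radius \<theta> = (INF j. exp (- 2 * pi * floor_fun 0 j (- \<theta>)))"

lemma bdd_outer: "bdd_below (range (\<lambda>j. exp (- 2 * pi * floor_fun 0 j t)))"
  by (rule bdd_belowI2[of _ 0]) simp

lemma le_outer_radius_iff: "s \<le> outer_radius \<theta> \<longleftrightarrow> (\<forall>j. s \<le> exp (- 2 * pi * floor_fun 0 j (- \<theta>)))"
  unfolding outer_radius_def by (subst le_cINF_iff[OF UNIV_not_empty bdd_outer]) simp

lemma outer_radius_le: "outer_radius \<theta> \<le> exp (- 2 * pi * floor_fun 0 j (- \<theta>))"
  using le_outer_radius_iff[of "outer_radius \<theta>" \<theta>] by simp

lemma M_set_region: "M_set \<alpha> = {z. cmod z \<le> outer_radius (ang z)}"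
proof -
  have I: "w \<in> I_minus \<alpha> \<longleftrightarrow> Re w \<in> {0..1} \<and> (\<forall>j. floor_fun 0 j (Re w) \<le> Im w)" for w
  proof -
    have "w \<in> I_minus \<alpha> \<longleftrightarrow> (\<forall>j. w \<in> strip {0..1} (floor_fun 0 (Suc j)))"
      unfolding I_minus_def I_minus_set_strip[symmetric] by (auto simp: Suc_le_eq gr0_conv_Suc)
    also have "\<dots> \<longleftrightarrow> Re w \<in> {0..1} \<and> (\<forall>j. floor_fun 0 j (Re w) \<le> Im w)"
      unfolding strip_def using order.trans[OF floor_mono[OF le_SucI[OF order_refl]]] by blast
    finally show ?thesis .
  qed
  have ex: "cnj (exp (2 * of_real pi * \<i> * w)) = of_real (exp (- 2 * pi * Im w)) * ray (- Re w)" for w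
  proof -
    have "cnj (2 * of_real pi * \<i> * w) = of_real (- 2 * pi * Im w) + 2 * of_real pi * \<i> * of_real (- Re w)"
      by (simp add: complex_eq_iff)
    then show ?thesis unfolding ray_def exp_cnj by (simp only: exp_add exp_of_real)
  qed
  have le: "exp (- 2 * pi * s) \<le> exp (- 2 * pi * t) \<longleftrightarrow> t \<le> s" for s t :: real by simp
  show ?thesis
  proof (intro set_eqI iffI)
    fix z assume "z \<in> M_set \<alpha>"
    then consider "z = 0" | w where "w \<in> I_minus \<alpha>" "z = cnj (exp (2 * of_real pi * \<i> * w))"
      unfolding M_set_def by blast
    then show "z \<in> {z. cmod z \<le> outer_radius (ang z)}"
    proof cases
      case 1
      then show ?thesis by (simp add: le_outer_radius_iff)
    next
      case 2
      have z: "z = of_real (exp (- 2 * pi * Im w)) * ray (- Re w)" unfolding 2(2) ex ..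
      have "ang z - - Re w \<in> \<int>" unfolding z by (intro ang_ray) simp
      then have "- (ang z - - Re w) \<in> \<int>" by (rule Ints_minus)
      then have "- ang z - Re w \<in> \<int>" by simp
      then have "floor_fun 0 j (- ang z) = floor_fun 0 j (Re w)" for j
        by (rule admissibleD(2)[OF admissible_floor])
      moreover have "cmod z = exp (- 2 * pi * Im w)" unfolding z by (simp add: norm_mult)
      ultimately show ?thesis using 2(1) by (simp only: mem_Collect_eq le_outer_radius_iff le I simp_thms)
    qed
  next
    fix z assume z: "z \<in> {z. cmod z \<le> outer_radius (ang z)}"
    show "z \<in> M_set \<alpha>"
    proof (cases "z = 0")
      case False
      define w where "w = Complex (frac (- ang z)) (- ln (cmod z) / (2 * pi))"
      have m: "exp (- 2 * pi * Im w) = cmod z" using False by (simp add: w_def)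
      have "- ang z - Re w \<in> \<int>" by (simp add: w_def frac_def)
      then have fl: "floor_fun 0 j (- ang z) = floor_fun 0 j (Re w)" for j
        by (rule admissibleD(2)[OF admissible_floor])
      have "Re w \<in> {0..1}" using frac_lt_1[of "- ang z"] by (simp add: w_def less_imp_le)
      moreover have "floor_fun 0 j (Re w) \<le> Im w" for j
        using z unfolding mem_Collect_eq le_outer_radius_iff fl m[symmetric] le by blast
      ultimately have "w \<in> I_minus \<alpha>" unfolding I by blast
      moreover have "- Re w - ang z \<in> \<int>" by (simp add: w_def frac_def)
      then have "ray (- Re w) = ray (ang z)" by (simp only: ray_eq_iff)
      then have "cnj (exp (2 * of_real pi * \<i> * w)) = z" unfolding ex m using polar[of z] by simp
      ultimately show ?thesis unfolding M_set_def by blast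
    qed (simp add: M_set_def)
  qed
qed

end

context
  fixes \<alpha> :: real assumes irr: "\<alpha> \<notin> \<rat>"
begin

interpretation nearest_cf "cf_alpha \<alpha>" "\<lambda>n. of_int (cf_eps \<alpha> n)" by (rule nearest_cf_cf[OF irr])

abbreviation (input) "Q \<equiv> outer_radius \<alpha>"

section \<open>Regularity of the outer radius\<close>

lemma floor_periodic: "x - y \<in> \<int> \<Longrightarrow> floor_fun n j (- x) = floor_fun n j (- y)"
proof -
  assume "x - y \<in> \<int>"
  then have "- (x - y) \<in> \<int>" by (rule Ints_minus)
  then show ?thesis by (intro admissibleD(2)[OF admissible_floor]) simp
qed

lemma outer_radius_periodic: "x - y \<in> \<int> \<Longrightarrow> Q x = Q y"
  unfolding outer_radius_def[OF irr] by (simp only: floor_periodic[of x y])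

lemma outer_radius_nonneg: "0 \<le> Q t"
  by (simp add: le_outer_radius_iff[OF irr])

lemma outer_radius_le_exp: "Q t \<le> exp (2 * pi)"
proof -
  have "Q t \<le> exp (- 2 * pi * floor_fun 0 0 (- t))" by (rule outer_radius_le[OF irr])
  then show ?thesis by (simp add: floor_fun_def)
qed

lemma radius_loop_floor: "radius_loop (\<lambda>t. exp (- 2 * pi * floor_fun 0 j (- t)))"
proof
  show "exp (- 2 * pi * floor_fun 0 j (- x)) = exp (- 2 * pi * floor_fun 0 j (- y))" if "x - y \<in> \<int>" for x y
    using floor_periodic[OF that] by simp
  show "continuous_on UNIV (\<lambda>t. exp (- 2 * pi * floor_fun 0 j (- t)))"
    by (intro continuous_intros continuous_on_compose2[OF continuous_floor]) auto
qed simp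

lemma closed_region: "closed {z. cmod z \<le> Q (ang z)}"
proof -
  have "{z. cmod z \<le> Q (ang z)} = (\<Inter>j. {z. cmod z \<le> exp (- 2 * pi * floor_fun 0 j (- ang z))})"
    by (auto simp: le_outer_radius_iff[OF irr])
  moreover have "closed {z. cmod z \<le> exp (- 2 * pi * floor_fun 0 j (- ang z))}" for j
    using radius_loop.closed_rel_radius_le[OF radius_loop_floor]
    by (simp only: radius_loop.rel_radius_le_iff[OF radius_loop_floor])
  ultimately show ?thesis by auto
qed

lemma outer_radius_usc: assumes "Q t < y" shows "\<forall>\<^sub>F s in at t. Q s < y"
proof -
  have "\<not> y \<le> Q t" using assms by simp
  then obtain j where j: "exp (- 2 * pi * floor_fun 0 j (- t)) < y"
    by (auto simp: le_outer_radius_iff[OF irr] not_le)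
  have "isCont (\<lambda>t. exp (- 2 * pi * floor_fun 0 j (- t))) t"
    using radius_loop.cont[OF radius_loop_floor] by (simp add: continuous_on_eq_continuous_at)
  then have "\<forall>\<^sub>F s in at t. exp (- 2 * pi * floor_fun 0 j (- s)) < y"
    unfolding isCont_def by (rule order_tendstoD(2)) (rule j)
  then show ?thesis by (rule eventually_mono) (rule le_less_trans[OF outer_radius_le[OF irr]])
qed

text \<open>Multiplicative form, as \<open>Q\<close> may vanish. Large \<open>j\<close> suffice
  because the floors increase with \<open>j\<close>.\<close>

lemma outer_radius_compare:
  assumes "\<And>j. k \<le> j \<Longrightarrow> floor_fun 0 j (- t) \<le> floor_fun 0 j (- s) + c"
  shows "exp (- 2 * pi * c) * Q s \<le> Q t"
  unfolding le_outer_radius_iff[OF irr]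
proof
  fix j
  let ?j = "max j k"
  have "exp (- 2 * pi * c) * Q s \<le> exp (- 2 * pi * c) * exp (- 2 * pi * floor_fun 0 ?j (- s))"
    by (intro mult_left_mono outer_radius_le[OF irr]) simp
  also have "\<dots> = exp (- 2 * pi * (floor_fun 0 ?j (- s) + c))"
    by (simp add: algebra_simps flip: exp_add)
  also have "\<dots> \<le> exp (- 2 * pi * floor_fun 0 j (- t))"
    using assms[of ?j] floor_mono[of j ?j 0 "- t"] by simp
  finally show "exp (- 2 * pi * c) * Q s \<le> exp (- 2 * pi * floor_fun 0 j (- t))" .
qed

lemma outer_radius_shift_compare:
  assumes "\<And>j x. k \<le> j \<Longrightarrow> \<bar>floor_fun 0 j (x + d) - floor_fun 0 j x\<bar> \<le> c" "s = t + d \<or> s = t - d"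
  shows "exp (- 2 * pi * c) * Q s \<le> Q t"
proof (rule outer_radius_compare)
  fix j assume "k \<le> j"
  note c = assms(1)[OF this]
  from assms(2) show "floor_fun 0 j (- t) \<le> floor_fun 0 j (- s) + c"
  proof
    assume "s = t + d"
    then have e: "- s + d = - t" by simp
    show ?thesis using c[of "- s"] unfolding e by linarith
  next
    assume "s = t - d"
    then have e: "- t + d = - s" by simp
    show ?thesis using c[of "- t"] unfolding e by linarith
  qed
qed

lemma rprod_tendsto_0: "rprod 0 \<longlonglongrightarrow> 0"
proof (rule Lim_null_comparison)
  show "\<forall>\<^sub>F k in sequentially. norm (rprod 0 k) \<le> (1/2) ^ k"
    using rprod_le rprod_pos by (intro always_eventually) (auto simp: less_imp_le)
qed (simp add: LIMSEQ_power_zero)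

text \<open>The factors in the two-sided comparison tend to 1, so the sandwich works for zero and
  positive values alike.\<close>

lemma outer_radius_approach:
  assumes s: "\<And>k. s k = t + rprod 0 k \<or> s k = t - rprod 0 k"
  shows "(\<lambda>k. Q (s k)) \<longlonglongrightarrow> Q t"
proof -
  have lim: "(\<lambda>k. 2 * (5/6) ^ k) \<longlonglongrightarrow> (0::real)"
    using tendsto_mult_right_zero[OF LIMSEQ_power_zero[of "5/6::real"], of 2] by simp
  let ?c = "\<lambda>k. 2 * (5/6::real) ^ k"
  have 1: "exp (- 2 * pi * ?c k) * Q (s k) \<le> Q t" for k
    by (rule outer_radius_shift_compare[OF small_shift_floor s])
  have 2: "exp (- 2 * pi * ?c k) * Q t \<le> Q (s k)" for k
    by (rule outer_radius_shift_compare[OF small_shift_floor]) (use s[of k] in auto)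
  have "(\<lambda>k. exp (b * ?c k) * Q t) \<longlonglongrightarrow> exp (b * 0) * Q t" for b
    by (intro tendsto_intros lim)
  then have lims: "(\<lambda>k. exp (b * ?c k) * Q t) \<longlonglongrightarrow> Q t" for b by (simp only: mult_zero_right exp_zero mult_1)
  have 3: "Q (s k) \<le> exp (2 * pi * ?c k) * Q t" for k
  proof -
    have "exp (2 * pi * ?c k) * (exp (- 2 * pi * ?c k) * Q (s k)) \<le> exp (2 * pi * ?c k) * Q t"
      by (intro mult_left_mono 1) simp
    moreover have "exp (2 * pi * ?c k) * exp (- 2 * pi * ?c k) = 1" by (simp flip: exp_add)
    ultimately show ?thesis by (simp only: mult.assoc[symmetric] mult_1)
  qed
  show ?thesis
    by (rule tendsto_sandwich[OF _ _ lims[of "- 2 * pi"] lims[of "2 * pi"]])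
       (intro always_eventually allI 2 3)+
qed

lemma outer_radius_pos_shift: "0 < Q (t + cf_alpha \<alpha> 0) \<longleftrightarrow> 0 < Q t"
proof -
  have *: "exp (- 2 * pi * 1) * Q s \<le> Q u" if "s = u + cf_alpha \<alpha> 0 \<or> s = u - cf_alpha \<alpha> 0" for s u
    by (rule outer_radius_shift_compare[OF shift_bound_floor that])
  have **: "0 < Q u" if "s = u + cf_alpha \<alpha> 0 \<or> s = u - cf_alpha \<alpha> 0" "0 < Q s" for s u
  proof -
    have "0 < exp (- 2 * pi * 1) * Q s" using that(2) by simp
    with *[OF that(1)] show ?thesis by linarith
  qed
  show ?thesis using **[of t "t + cf_alpha \<alpha> 0"] **[of "t + cf_alpha \<alpha> 0" t] by auto
qed

lemma outer_radius_pos_dense: "closure {t. 0 < Q t} = UNIV"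
proof (rule irrational_rotation_dense[OF cf_alpha_bounds(3)[OF irr]])
  show "x + cf_alpha \<alpha> 0 \<in> {t. 0 < Q t} \<longleftrightarrow> x \<in> {t. 0 < Q t}" for x using outer_radius_pos_shift by simp
  show "x + 1 \<in> {t. 0 < Q t} \<longleftrightarrow> x \<in> {t. 0 < Q t}" for x using outer_radius_periodic[of "x + 1" x] by simp
  \<comment> \<open>Floors at the origin never exceed 0, Brjuno number or not; the orbit of the
    origin therefore has positive radius.\<close>
  have "1 \<le> Q 0" using floor_origin by (simp add: le_outer_radius_iff[OF irr] mult_nonneg_nonpos)
  then show "0 \<in> {t. 0 < Q t}" by simp
qed

lemma cantor_bouquet_if_not_brjuno:
  assumes "\<not> brjuno_number \<alpha>" shows "cantor_bouquet (A_set \<alpha>)"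
proof -
  have ns: "\<not> summable (brjuno_term 0)" using assms brjuno_iff_nearest[OF irr] by simp
  obtain x where x: "\<And>B. \<exists>j. B < floor_fun 0 j x" using floor_unbounded[OF ns] by blast
  have Qx: "Q (- x) = 0"
  proof (rule ccontr)
    assume "Q (- x) \<noteq> 0"
    then have p: "0 < Q (- x)" using outer_radius_nonneg[of "- x"] by simp
    obtain j where "- ln (Q (- x)) / (2 * pi) < floor_fun 0 j x" using x by blast
    then have "- 2 * pi * floor_fun 0 j x < ln (Q (- x))" by (simp add: field_simps)
    then have "exp (- 2 * pi * floor_fun 0 j x) < Q (- x)" using p by (metis exp_less_cancel_iff exp_ln)
    then show False using outer_radius_le[OF irr, of "- x" j] by simp
  qed
  have zd: "closure {t. Q t = 0} = UNIV"
  proof (rule irrational_rotation_dense[OF cf_alpha_bounds(3)[OF irr]])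
    have e: "Q t = 0 \<longleftrightarrow> \<not> 0 < Q t" for t using outer_radius_nonneg[of t] by auto
    show "y + cf_alpha \<alpha> 0 \<in> {t. Q t = 0} \<longleftrightarrow> y \<in> {t. Q t = 0}" for y
      unfolding mem_Collect_eq e using outer_radius_pos_shift by simp
    show "y + 1 \<in> {t. Q t = 0} \<longleftrightarrow> y \<in> {t. Q t = 0}" for y using outer_radius_periodic[of "y + 1" y] by simp
    show "- x \<in> {t. Q t = 0}" using Qx by simp
  qed
  \<comment> \<open>The floors are at least -1, so this bounds \<open>Q\<close>.\<close>
  let ?K = "exp (2 * pi)"
  let ?R = "\<lambda>t. Q t / ?K"
  have "hair_function ?R"
  proof (rule hair_functionI[where d = "rprod 0"])
    show "?R (t + 1) = ?R t" for t using outer_radius_periodic[of "t + 1" t] by simp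
    show "?R t \<in> {0..1}" for t using outer_radius_nonneg[of t] outer_radius_le_exp[of t] by simp
    show "closure {t. ?R t = 0} = UNIV" using zd by simp
    show "closure {t. 0 < ?R t} = UNIV" using outer_radius_pos_dense by (simp add: zero_less_divide_iff)
    show "\<forall>\<^sub>F s in at t. ?R s < y" if "?R t < y" for t y
      using outer_radius_usc[of t "y * ?K"] that by (simp add: pos_divide_less_eq)
    show "0 < rprod 0 k" for k by (rule rprod_pos)
    show "rprod 0 \<longlonglongrightarrow> 0" by (rule rprod_tendsto_0)
    show "(\<lambda>k. ?R (t + rprod 0 k)) \<longlonglongrightarrow> ?R t" "(\<lambda>k. ?R (t - rprod 0 k)) \<longlonglongrightarrow> ?R t" for t
      by (intro tendsto_divide outer_radius_approach tendsto_const; simp)+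
  qed
  then have "cantor_bouquet {z. cmod z \<le> ?K * ?R (ang z)}" by (rule cantor_bouquet_region) simp
  moreover have "A_set \<alpha> = {z. cmod z \<le> Q (ang z)}"
    unfolding A_set_def M_set_region[OF irr]
    by (rule frontier_region_dense_zeros[OF outer_radius_periodic zd closed_region])
  ultimately show ?thesis by simp
qed

lemma brjuno_case:
  assumes b: "brjuno_number \<alpha>"
  shows "(herman_number \<alpha> \<longrightarrow> jordan_curve (A_set \<alpha>)) \<and> (\<not> herman_number \<alpha> \<longrightarrow> one_sided_hairy_jordan_curve (A_set \<alpha>))"
proof -
  interpret B: nearest_cf_brjuno "cf_alpha \<alpha>" "\<lambda>n. of_int (cf_eps \<alpha> n)"
    by unfold_locales (rule brjuno_iff_nearest[OF irr, THEN iffD1, OF b])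
  define q where "q t = exp (- 2 * pi * B.peak 0 (- t))" for t
  have herman: "herman_number \<alpha> \<longleftrightarrow> (\<forall>x. B.base 0 x = B.peak 0 x)"
    using herman_iff_peak[OF irr b] B.peak_origin_bounded_iff by simp
  have Q: "Q t = exp (- 2 * pi * B.base 0 (- t))" for t
  proof (rule LIMSEQ_unique)
    show "(\<lambda>j. exp (- 2 * pi * floor_fun 0 j (- t))) \<longlonglongrightarrow> Q t"
      unfolding outer_radius_def[OF irr]
      by (intro LIMSEQ_decseq_INF bdd_outer[OF irr]) (auto simp: decseq_def floor_mono)
    show "(\<lambda>j. exp (- 2 * pi * floor_fun 0 j (- t))) \<longlonglongrightarrow> exp (- 2 * pi * B.base 0 (- t))"
      by (intro tendsto_intros B.floor_tendsto)
  qed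
  interpret q: radius_loop q
  proof
    show "q x = q y" if "x - y \<in> \<int>" for x y
    proof -
      have "- (x - y) \<in> \<int>" using that by (rule Ints_minus)
      then have "B.peak 0 (- x) = B.peak 0 (- y)" by (intro admissibleD(2)[OF B.admissible_peak]) simp
      then show ?thesis by (simp add: q_def)
    qed
    show "continuous_on UNIV q"
      unfolding q_def by (intro continuous_intros continuous_on_compose2[OF B.continuous_peak]) auto
  qed (simp add: q_def)
  have qQ: "q t \<le> Q t" for t unfolding q_def Q using B.base_le_peak[of 0 "- t"] by simp
  have Qq_iff: "Q t = q t \<longleftrightarrow> B.base 0 (- t) = B.peak 0 (- t)" for t unfolding q_def Q by simp
  have inv: "Q (t + cf_alpha \<alpha> 0) = q (t + cf_alpha \<alpha> 0) \<longleftrightarrow> Q t = q t" for t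
    unfolding Qq_iff using B.base_eq_peak_shift[of "- t - cf_alpha \<alpha> 0"] by simp
  have inv1: "Q (t + 1) = q (t + 1) \<longleftrightarrow> Q t = q t" for t
    using outer_radius_periodic[of "t + 1" t] q.per[of "t + 1" t] by simp
  note dense = irrational_rotation_dense[OF cf_alpha_bounds(3)[OF irr, of 0]]
  obtain x0 where x0: "B.base 0 x0 = B.peak 0 x0" using B.base_peak_centre by blast
  have eq_dense: "closure {t. Q t = q t} = UNIV"
  proof (rule dense)
    show "- x0 \<in> {t. Q t = q t}" by (simp only: mem_Collect_eq Qq_iff minus_minus x0)
  qed (simp_all only: mem_Collect_eq inv inv1)
  have A: "A_set \<alpha> = {z. q (ang z) \<le> cmod z \<and> cmod z \<le> Q (ang z)}"
    unfolding A_set_def M_set_region[OF irr]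
    by (rule q.frontier_region_band[OF outer_radius_periodic eq_dense closed_region qQ])
  have "jordan_curve (A_set \<alpha>)" if "herman_number \<alpha>"
  proof -
    have "Q t = q t" for t using that herman Qq_iff by blast
    then have "A_set \<alpha> = {z. cmod z = q (ang z)}" unfolding A by (auto intro: antisym)
    then show ?thesis using q.jordan_curve_graph by simp
  qed
  moreover have "one_sided_hairy_jordan_curve (A_set \<alpha>)" if nh: "\<not> herman_number \<alpha>"
  proof -
    obtain x1 where x1: "B.base 0 x1 \<noteq> B.peak 0 x1" using nh herman by blast
    have ne_dense: "closure {t. Q t \<noteq> q t} = UNIV"
    proof (rule dense)
      show "- x1 \<in> {t. Q t \<noteq> q t}" using x1 by (simp only: mem_Collect_eq Qq_iff minus_minus) simp
    qed (simp_all only: mem_Collect_eq inv inv1)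
    \<comment> \<open>\<open>D\<close> bounds the gap: the peak is at most \<open>ceil_sum 0\<close>
      and the base at least -1. The exponent \<open>\<kappa>\<close> is chosen so that
      \<open>exp (2 * pi * D) powr \<kappa> = 2\<close>.\<close>
    define D where "D = B.ceil_sum 0 + 1"
    define \<kappa> where "\<kappa> = ln 2 / (2 * pi * D)"
    have D: "0 < D" unfolding D_def using B.ceil_sum_nonneg[of 0] by simp
    have k: "0 < \<kappa>" unfolding \<kappa>_def using D by simp
    define R where "R t = (Q t / q t) powr \<kappa> - 1" for t
    have qp: "0 < q t" "0 < Q t" for t unfolding q_def Q by simp_all
    have ratio: "1 \<le> Q t / q t" for t using qQ[of t] qp[of t] by simp
    have one_le: "1 \<le> (Q t / q t) powr \<kappa>" for t using ratio[of t] k by (simp add: ge_one_powr_ge_zero)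
    have band: "Q t = q t * (1 + R t) powr (1 / \<kappa>)" for t
      unfolding R_def using qp[of t] k by (simp add: powr_powr)
    have R_zero: "R t = 0 \<longleftrightarrow> Q t = q t" for t
    proof
      assume "R t = 0"
      then show "Q t = q t" using band[of t] by simp
    next
      assume "Q t = q t"
      then show "R t = 0" unfolding R_def using qp[of t] by simp
    qed
    have R_nonneg: "0 \<le> R t" for t using one_le[of t] by (simp add: R_def)
    have R_le: "R t \<le> 1" for t
    proof -
      have "B.peak 0 (- t) - B.base 0 (- t) \<le> D"
        using B.peak_le_ceil[of 0 "- t" 0] admissibleD(1)[OF B.admissible_base, of 0 "- t"]
        unfolding D_def B.ceil_origin_0 by simp
      moreover have "Q t / q t = exp (2 * pi * (B.peak 0 (- t) - B.base 0 (- t)))"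
        unfolding Q q_def by (simp add: algebra_simps flip: exp_diff)
      ultimately have "Q t / q t \<le> exp (2 * pi * D)" by simp
      then have "(Q t / q t) powr \<kappa> \<le> exp (2 * pi * D) powr \<kappa>"
        using k ratio[of t] by (intro powr_mono2) auto
      also have "\<dots> = 2" unfolding \<kappa>_def using D by (simp add: powr_def)
      finally show ?thesis by (simp add: R_def)
    qed
    have "hair_function R"
    proof (rule hair_functionI[where d = "rprod 0"])
      show "R (t + 1) = R t" for t
        using outer_radius_periodic[of "t + 1" t] q.per[of "t + 1" t] by (simp add: R_def)
      show "R t \<in> {0..1}" for t using R_nonneg R_le by simp
      show "closure {t. R t = 0} = UNIV" using eq_dense by (simp add: R_zero)
      have "0 < R t \<longleftrightarrow> Q t \<noteq> q t" for t using R_nonneg[of t] R_zero[of t] by (auto simp: less_le)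
      then show "closure {t. 0 < R t} = UNIV" using ne_dense by simp
      show "\<forall>\<^sub>F s in at t. R s < y" if y: "R t < y" for t y
      proof -
        \<comment> \<open>\<open>R s < y\<close> becomes \<open>Q s < h s\<close> with
          \<open>h\<close> continuous; a number strictly between the two values at \<open>t\<close>
          separates the upper semicontinuous \<open>Q\<close> from \<open>h\<close> nearby.\<close>
        define h where "h s = q s * (1 + y) powr (1 / \<kappa>)" for s
        have y0: "0 < 1 + y" using y R_nonneg[of t] by simp
        have R_less: "R s < y \<longleftrightarrow> Q s < h s" for s
        proof -
          have "Q s < h s \<longleftrightarrow> (1 + R s) powr (1 / \<kappa>) < (1 + y) powr (1 / \<kappa>)"
            using qp(1)[of s] by (subst band) (simp add: h_def)
          also have "\<dots> \<longleftrightarrow> 1 + R s < 1 + y"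
            using powr_le_powr_iff[of "1 / \<kappa>" "1 + y" "1 + R s"] k y0 R_nonneg[of s] by (simp add: not_le[symmetric])
          finally show ?thesis by simp
        qed
        obtain m where m: "Q t < m" "m < h t" using y R_less[of t] dense_order_class.dense by (meson dense)
        have "isCont h t"
          unfolding h_def using q.cont by (intro continuous_intros) (simp add: continuous_on_eq_continuous_at)
        then have "\<forall>\<^sub>F s in at t. m < h s" unfolding isCont_def by (rule order_tendstoD(1)) (rule m(2))
        moreover have "\<forall>\<^sub>F s in at t. Q s < m" by (rule outer_radius_usc[OF m(1)])
        ultimately show ?thesis by eventually_elim (simp add: R_less)
      qed
      show "0 < rprod 0 k" for k by (rule rprod_pos)
      show "rprod 0 \<longlonglongrightarrow> 0" by (rule rprod_tendsto_0)
      have app: "(\<lambda>k. R (s k)) \<longlonglongrightarrow> R t" if s: "\<And>k. s k = t + rprod 0 k \<or> s k = t - rprod 0 k" for s t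
      proof -
        have "(\<lambda>k. \<bar>s k - t\<bar>) \<longlonglongrightarrow> 0"
        proof -
          have "\<bar>s k - t\<bar> = rprod 0 k" for k using s[of k] rprod_pos[of 0 k] by auto
          then show ?thesis using rprod_tendsto_0 by simp
        qed
        then have "s \<longlonglongrightarrow> t" by (rule LIM_zero_cancel[OF tendsto_rabs_zero_cancel])
        then have "(\<lambda>k. q (s k)) \<longlonglongrightarrow> q t"
          using q.cont by (simp add: continuous_on_eq_continuous_at isCont_tendsto_compose)
        then show ?thesis
          unfolding R_def using qp[of t] by (intro tendsto_intros outer_radius_approach s) auto
      qed
      show "(\<lambda>k. R (t + rprod 0 k)) \<longlonglongrightarrow> R t" "(\<lambda>k. R (t - rprod 0 k)) \<longlonglongrightarrow> R t" for t
        by (intro app; simp)+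
    qed
    then have "one_sided_hairy_jordan_curve
        {z. q (ang z) \<le> cmod z \<and> cmod z \<le> q (ang z) * (1 + R (ang z)) powr (1 / \<kappa>)}"
      using k by (rule q.one_sided_hairy_jordan_curve_band)
    then show ?thesis unfolding A band .
  qed
  ultimately show ?thesis by blast
qed

end

theorem theoremB:
  fixes \<alpha> :: real
  assumes "\<alpha> \<notin> \<rat>"
  shows "(herman_number \<alpha> \<and> jordan_curve (A_set \<alpha>))
       \<or> (brjuno_number \<alpha> \<and> \<not> herman_number \<alpha> \<and> one_sided_hairy_jordan_curve (A_set \<alpha>))
       \<or> (\<not> brjuno_number \<alpha> \<and> cantor_bouquet (A_set \<alpha>))"
  using brjuno_case[OF assms] cantor_bouquet_if_not_brjuno[OF assms] by blast

end
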